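(* Let $\eta_1,\eta_2>0$, $y_{obs}\in L^2(q_T)$, $\rho_0\in\mathcal{R}$ and $\rho,\rho_1\in\mathcal{R}\cap L^\infty(Q_T)$. Consider the mixed formulation: find $((y,\mathbf{p}),(\lambda,\boldsymbol{\mu}))\in\mathcal{U}\times\mathcal{X}$ such that $$a((y,\mathbf{p}),(\overline y,\overline{\mathbf{p}}))+b((\overline y,\overline{\mathbf{p}}),(\lambda,\boldsymbol{\mu}))=l(\overline y,\overline{\mathbf{p}})\quad\forall(\overline y,\overline{\mathbf{p}})\in\mathcal{U},\qquad b((y,\mathbf{p}),(\overline\lambda,\overline{\boldsymbol{\mu}}))=0\quad\forall(\overline\lambda,\overline{\boldsymbol{\mu}})\in\mathcal{X},$$ where $$a((y,\mathbf{p}),(\overline y,\overline{\mathbf{p}})):=\iint_{q_T}\rho_0^{-2}y\,\overline y\,dx\,dt,\qquad l(y,\mathbf{p}):=\iint_{q_T}\rho_0^{-2}y\,y_{obs}\,dx\,dt,$$ $$b((y,\mathbf{p}),(\lambda,\boldsymbol{\mu})):=\iint_{Q_T}\rho_1^{-1}\mathcal{J}(y,\mathbf{p})\cdot\boldsymbol{\mu}\,dx\,dt+\iint_{Q_T}\rho^{-1}\mathcal{I}(y,\mathbf{p})\,\lambda\,dx\,dt.$$ Then: (1) The mixed formulation is well-posed. (2) Its unique solution $((y,\mathbf{p}),(\lambda,\boldsymbol{\mu}))\in\mathcal{U}\times\mathcal{X}$ is the unique saddle-point of the Lagrangian $\mathcal{L}:\mathcal{U}\times\mathcal{X}\to\mathbb{R}$,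 $\mathcal{L}((y,\mathbf{p}),(\lambda,\boldsymbol{\mu})):=\frac12a((y,\mathbf{p}),(y,\mathbf{p}))+b((y,\mathbf{p}),(\lambda,\boldsymbol{\mu}))-l(y,\mathbf{p})$. (3) The solution satisfies $\|(y,\mathbf{p})\|_{\mathcal{U}}\le\|\rho_0^{-1}y_{obs}\|_{L^2(q_T)}$ and $$\|(\lambda,\boldsymbol{\mu})\|_{\mathcal{X}}\le2\sqrt{\max\{C_{\Omega,T}\rho_\star^{-2}\|\rho_1\|_{L^\infty(Q_T)}^2+\eta_1,\ C_{\Omega,T}\rho_\star^{-2}\|\rho\|_{L^\infty(Q_T)}^2+\eta_2\}}\;\|\rho_0^{-1}y_{obs}\|_{L^2(q_T)},$$ where $C_{\Omega,T}>0$ is a constant depending only on $\Omega$, $T$ and the coefficients $c,d$.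
   Context: $\Omega\subset\mathbb{R}^N$ is a bounded domain with boundary $\partial\Omega$ of class $C^2$, $T>0$, $Q_T:=\Omega\times(0,T)$, $\Sigma_T:=\partial\Omega\times(0,T)$, $\omega\subset\Omega$ is a non-empty open subset and $q_T:=\omega\times(0,T)$. The coefficients satisfy $c=(c_{i,j})\in C^1(\overline\Omega;\mathcal{M}_N(\mathbb{R}))$ with $(c(x)\xi,\xi)\ge c_0|\xi|^2$ for all $x\in\overline\Omega$, $\xi\in\mathbb{R}^N$ (with $c_0>0$), and $d\in L^\infty(Q_T)$. Bold letters denote $\mathbb{R}^N$-valued function spaces: $\mathbf{L}^2(Q_T)=L^2(Q_T)^N$, $\mathbf{C}^1(\overline{Q_T})=C^1(\overline{Q_T})^N$. Set $\mathcal{I}(y,\mathbf{p}):=y_t-\nabla\cdot\mathbf{p}+d\,y$ and $\mathcal{J}(y,\mathbf{p}):=c(x)\nabla y-\mathbf{p}$. Fix $\rho_\star>0$ and let $\mathcal{R}:=\{w\in C(Q_T): w\ge\rho_\star \text{ in } Q_T,\ w\in L^\infty(\Omega\times(\delta,T))\ \forall\delta>0\}$. Let $\mathcal{U}_0:=\{(y,\mathbf{p})\in C^1(\overline{Q_T})\times\mathbf{C}^1(\overline{Q_T}): y=0\text{ on }\Sigma_T\}$ with scalar product $((y,\mathbf{p}),(\overline y,\overline{\mathbf{p}}))_{\mathcal{U}_0}=\iint_{q_T}\rho_0^{-2}y\,\overline y\,dx\,dt+\eta_1\iint_{Q_T}\rho_1^{-2}\mathcal{J}(y,\mathbf{p})\cdot\mathcal{J}(\overline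 y,\overline{\mathbf{p}})\,dx\,dt+\eta_2\iint_{Q_T}\rho^{-2}\mathcal{I}(y,\mathbf{p})\,\mathcal{I}(\overline y,\overline{\mathbf{p}})\,dx\,dt$ (a scalar product by unique continuation). $\mathcal{U}$ is the completion of $\mathcal{U}_0$ for this scalar product, with norm $\|(y,\mathbf{p})\|_{\mathcal{U}}^2=\|\rho_0^{-1}y\|_{L^2(q_T)}^2+\eta_1\|\rho_1^{-1}\mathcal{J}(y,\mathbf{p})\|_{\mathbf{L}^2(Q_T)}^2+\eta_2\|\rho^{-1}\mathcal{I}(y,\mathbf{p})\|_{L^2(Q_T)}^2$; the maps $(y,\mathbf{p})\mapsto\rho_0^{-1}y|_{q_T}$, $\rho_1^{-1}\mathcal{J}(y,\mathbf{p})$, $\rho^{-1}\mathcal{I}(y,\mathbf{p})$ are extended to $\mathcal{U}$ by continuity. $\mathcal{X}:=L^2(Q_T)\times\mathbf{L}^2(Q_T)$ with its product Hilbert norm. "Well-posed" means that there is exactly one solution and that it depends continuously on the data. *)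

theory Defs
  imports "HOL-Probability.Essential_Supremum"
begin

section \<open>Lebesgue spaces\<close>

text \<open>Elements of \<open>L\<^sup>2(S)\<close> and \<open>L\<^sup>\<infinity>(S)\<close> are represented by measurable functions; their values
  outside \<open>S\<close> are irrelevant, and equality in these spaces is equality almost everywhere
  on \<open>S\<close>.\<close>

definition L2 :: "'a::euclidean_space set \<Rightarrow> ('a \<Rightarrow> 'b::euclidean_space) set" where
  "L2 S = {f. f \<in> borel_measurable (lebesgue_on S) \<and>
              integrable (lebesgue_on S) (\<lambda>z. (norm (f z))\<^sup>2)}"

definition L2_norm :: "'a::euclidean_space set \<Rightarrow> ('a \<Rightarrow> 'b::euclidean_space) \<Rightarrow> real" where
  "L2_norm S f = sqrt (LINT z|lebesgue_on S. (norm (f z))\<^sup>2)"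

definition Linf :: "'a::euclidean_space set \<Rightarrow> ('a \<Rightarrow> real) set" where
  "Linf S = {f. f \<in> borel_measurable (lebesgue_on S) \<and>
                esssup (lebesgue_on S) (\<lambda>z. ereal \<bar>f z\<bar>) < \<infinity>}"

definition Linf_norm :: "'a::euclidean_space set \<Rightarrow> ('a \<Rightarrow> real) \<Rightarrow> real" where
  "Linf_norm S f = real_of_ereal (esssup (lebesgue_on S) (\<lambda>z. ereal \<bar>f z\<bar>))"


section \<open>Functions of class \<open>C\<^sup>1\<close> up to the boundary and domains of class \<open>C\<^sup>2\<close>\<close>

text \<open>\<open>C\<^sup>1\<close> on the closure of the open set \<open>S\<close>: the function and its derivative in \<open>S\<close> both
  extend continuously to \<open>closure S\<close> (the function being given there already).\<close>

definition C1_closure ::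
    "'a::real_normed_vector set \<Rightarrow> ('a \<Rightarrow> 'b::real_normed_vector) set" where
  "C1_closure S = {f. continuous_on (closure S) f \<and>
     (\<exists>f' :: 'a \<Rightarrow> 'a \<Rightarrow>\<^sub>L 'b.
        continuous_on (closure S) f' \<and>
        (\<forall>z\<in>S. (f has_derivative blinfun_apply (f' z)) (at z)))}"

definition C2_function :: "('a::real_normed_vector \<Rightarrow> real) \<Rightarrow> bool" where
  "C2_function g \<longleftrightarrow>
     (\<exists>(g' :: 'a \<Rightarrow> 'a \<Rightarrow>\<^sub>L real) (g'' :: 'a \<Rightarrow> 'a \<Rightarrow>\<^sub>L ('a \<Rightarrow>\<^sub>L real)).
        (\<forall>x. (g has_derivative blinfun_apply (g' x)) (at x)) \<and>
        (\<forall>x. (g' has_derivative blinfun_apply (g'' x)) (at x)) \<and>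
        continuous_on UNIV g'')"

text \<open>Near each boundary point \<open>\<Omega>\<close> is, in a suitable orthonormal system of coordinates whose
  last axis is \<open>e\<close>, the region above the graph of a \<open>C\<^sup>2\<close> function of the other coordinates.
  A function of those coordinates is written as a function of the orthogonal projection onto
  the hyperplane orthogonal to \<open>e\<close>.\<close>

definition C2_boundary :: "'a::euclidean_space set \<Rightarrow> bool" where
  "C2_boundary \<Omega> \<longleftrightarrow>
     (\<forall>x0\<in>frontier \<Omega>. \<exists>r>0. \<exists>e g. norm e = 1 \<and> C2_function g \<and>
        \<Omega> \<inter> ball x0 r = {x \<in> ball x0 r. x \<bullet> e > g (x - (x \<bullet> e) *\<^sub>R e)})"

definition bounded_C2_domain :: "'a::euclidean_space set \<Rightarrow> bool" where
  "bounded_C2_domain \<Omega> \<longleftrightarrow>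
     open \<Omega> \<and> connected \<Omega> \<and> \<Omega> \<noteq> {} \<and> bounded \<Omega> \<and> C2_boundary \<Omega>"


section \<open>The parabolic first-order system\<close>

text \<open>A point of space-time is a pair \<open>(x, t)\<close>; a state is a pair \<open>(y, p)\<close>.\<close>

type_synonym 'n spacetime = "(real ^ 'n) \<times> real"
type_synonym 'n state =
  "('n spacetime \<Rightarrow> real) \<times> ('n spacetime \<Rightarrow> real ^ 'n)"

definition cyl :: "(real ^ 'n::finite) set \<Rightarrow> real \<Rightarrow> 'n spacetime set" where
  "cyl S T = S \<times> {0<..<T}"

definition weight_class ::
    "(real ^ 'n::finite) set \<Rightarrow> real \<Rightarrow> real \<Rightarrow> ('n spacetime \<Rightarrow> real) set" where
  "weight_class \<Omega> T \<rho>s = {w. continuous_on (cyl \<Omega> T) w \<and>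
     (\<forall>z\<in>cyl \<Omega> T. w z \<ge> \<rho>s) \<and>
     (\<forall>\<delta>>0. w \<in> Linf (\<Omega> \<times> {\<delta><..<T}))}"

definition time_deriv ::
    "('n::finite spacetime \<Rightarrow> real) \<Rightarrow> 'n spacetime \<Rightarrow> real" where
  "time_deriv y z = frechet_derivative y (at z) (0, 1)"

definition space_grad ::
    "('n::finite spacetime \<Rightarrow> real) \<Rightarrow> 'n spacetime \<Rightarrow> real ^ 'n" where
  "space_grad y z = (\<chi> i. frechet_derivative y (at z) (axis i 1, 0))"

definition space_div ::
    "('n::finite spacetime \<Rightarrow> real ^ 'n) \<Rightarrow> 'n spacetime \<Rightarrow> real" where
  "space_div p z = (\<Sum>i\<in>UNIV. frechet_derivative p (at z) (axis i 1, 0) $ i)"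

record ('n::finite) problem =
  Omega :: "(real ^ 'n) set"
  omega :: "(real ^ 'n) set"
  horizon :: real
  coeff_c :: "real ^ 'n \<Rightarrow> real ^ 'n ^ 'n"
  coeff_d :: "(real ^ 'n) \<times> real \<Rightarrow> real"
  wt0 :: "(real ^ 'n) \<times> real \<Rightarrow> real"
  wt :: "(real ^ 'n) \<times> real \<Rightarrow> real"
  wt1 :: "(real ^ 'n) \<times> real \<Rightarrow> real"
  eta1 :: real
  eta2 :: real

definition QT :: "'n::finite problem \<Rightarrow> 'n spacetime set" where
  "QT P = cyl (Omega P) (horizon P)"

definition qT :: "'n::finite problem \<Rightarrow> 'n spacetime set" where
  "qT P = cyl (omega P) (horizon P)"

definition SigmaT :: "'n::finite problem \<Rightarrow> 'n spacetime set" where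
  "SigmaT P = cyl (frontier (Omega P)) (horizon P)"

definition opI :: "'n::finite problem \<Rightarrow> 'n state \<Rightarrow> 'n spacetime \<Rightarrow> real" where
  "opI P v z = time_deriv (fst v) z - space_div (snd v) z + coeff_d P z * fst v z"

definition opJ :: "'n::finite problem \<Rightarrow> 'n state \<Rightarrow> 'n spacetime \<Rightarrow> real ^ 'n" where
  "opJ P v z = coeff_c P (fst z) *v space_grad (fst v) z - snd v z"


section \<open>The space \<open>U\<^sub>0\<close> and its completion \<open>U\<close>\<close>

definition U0 :: "'n::finite problem \<Rightarrow> 'n state set" where
  "U0 P = {(y, p). y \<in> C1_closure (QT P) \<and> p \<in> C1_closure (QT P) \<and>
                   (\<forall>z\<in>SigmaT P. y z = 0)}"

definition U0_inner :: "'n::finite problem \<Rightarrow> 'n state \<Rightarrow> 'n state \<Rightarrow> real" where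
  "U0_inner P v w =
     (LINT z|lebesgue_on (qT P). fst v z * fst w z / (wt0 P z)\<^sup>2)
     + eta1 P * (LINT z|lebesgue_on (QT P). (opJ P v z \<bullet> opJ P w z) / (wt1 P z)\<^sup>2)
     + eta2 P * (LINT z|lebesgue_on (QT P). opI P v z * opI P w z / (wt P z)\<^sup>2)"

definition state_diff :: "'n::finite state \<Rightarrow> 'n state \<Rightarrow> 'n state" where
  "state_diff v w = (\<lambda>z. fst v z - fst w z, \<lambda>z. snd v z - snd w z)"

definition U0_dist :: "'n::finite problem \<Rightarrow> 'n state \<Rightarrow> 'n state \<Rightarrow> real" where
  "U0_dist P v w = sqrt (U0_inner P (state_diff v w) (state_diff v w))"

text \<open>The completion: Cauchy sequences in \<open>U\<^sub>0\<close> modulo sequences whose distance tends to 0.\<close>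

definition U_cauchy :: "'n::finite problem \<Rightarrow> (nat \<Rightarrow> 'n state) set" where
  "U_cauchy P = {s. (\<forall>k. s k \<in> U0 P) \<and>
     (\<forall>\<epsilon>>0. \<exists>M. \<forall>m\<ge>M. \<forall>n\<ge>M. U0_dist P (s m) (s n) < \<epsilon>)}"

definition U_rel :: "'n::finite problem \<Rightarrow> ((nat \<Rightarrow> 'n state) \<times> (nat \<Rightarrow> 'n state)) set" where
  "U_rel P = {(s, s'). s \<in> U_cauchy P \<and> s' \<in> U_cauchy P \<and>
     (\<lambda>k. U0_dist P (s k) (s' k)) \<longlonglongrightarrow> 0}"

definition U :: "'n::finite problem \<Rightarrow> (nat \<Rightarrow> 'n state) set set" where
  "U P = U_cauchy P // U_rel P"

definition U_diff :: "'n::finite problem \<Rightarrow> (nat \<Rightarrow> 'n state) set \<Rightarrow> (nat \<Rightarrow> 'n state) set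
    \<Rightarrow> (nat \<Rightarrow> 'n state) set" where
  "U_diff P u v = (\<Union>s\<in>u. \<Union>s'\<in>v. U_rel P `` {\<lambda>k. state_diff (s k) (s' k)})"

text \<open>Extension by continuity to \<open>U\<close> of a map \<open>F\<close> from \<open>U\<^sub>0\<close> to \<open>L\<^sup>2(S)\<close>: the \<open>L\<^sup>2(S)\<close> limit
  of \<open>F\<close> along the representing sequences, unique up to equality almost everywhere.\<close>

definition U_extend :: "'a::euclidean_space set \<Rightarrow>
    ('n::finite state \<Rightarrow> 'a \<Rightarrow> 'b::euclidean_space) \<Rightarrow> (nat \<Rightarrow> 'n state) set \<Rightarrow> 'a \<Rightarrow> 'b" where
  "U_extend S F u = (SOME f. f \<in> L2 S \<and>
     (\<forall>s\<in>u. (\<lambda>k. L2_norm S (\<lambda>z. F (s k) z - f z)) \<longlonglongrightarrow> 0))"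

definition obs_map ::
    "'n::finite problem \<Rightarrow> (nat \<Rightarrow> 'n state) set \<Rightarrow> 'n spacetime \<Rightarrow> real" where
  "obs_map P = U_extend (qT P) (\<lambda>v z. fst v z / wt0 P z)"

definition J_map ::
    "'n::finite problem \<Rightarrow> (nat \<Rightarrow> 'n state) set \<Rightarrow> 'n spacetime \<Rightarrow> real ^ 'n" where
  "J_map P = U_extend (QT P) (\<lambda>v z. (1 / wt1 P z) *\<^sub>R opJ P v z)"

definition I_map ::
    "'n::finite problem \<Rightarrow> (nat \<Rightarrow> 'n state) set \<Rightarrow> 'n spacetime \<Rightarrow> real" where
  "I_map P = U_extend (QT P) (\<lambda>v z. opI P v z / wt P z)"

definition U_norm :: "'n::finite problem \<Rightarrow> (nat \<Rightarrow> 'n state) set \<Rightarrow> real" where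
  "U_norm P u = sqrt ((L2_norm (qT P) (obs_map P u))\<^sup>2
     + eta1 P * (L2_norm (QT P) (J_map P u))\<^sup>2
     + eta2 P * (L2_norm (QT P) (I_map P u))\<^sup>2)"


section \<open>The multiplier space \<open>X = L\<^sup>2 \<times> L\<^sup>2\<close>\<close>

definition X :: "'n::finite problem \<Rightarrow> 'n state set" where
  "X P = L2 (QT P) \<times> L2 (QT P)"

definition X_eq :: "'n::finite problem \<Rightarrow> 'n state \<Rightarrow> 'n state \<Rightarrow> bool" where
  "X_eq P m m' \<longleftrightarrow>
     (AE z in lebesgue_on (QT P). fst m z = fst m' z \<and> snd m z = snd m' z)"

definition X_norm :: "'n::finite problem \<Rightarrow> 'n state \<Rightarrow> real" where
  "X_norm P m = sqrt ((L2_norm (QT P) (fst m))\<^sup>2 + (L2_norm (QT P) (snd m))\<^sup>2)"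


section \<open>The mixed formulation\<close>

text \<open>The integrands of \<open>a\<close> and \<open>l\<close> are \<open>\<rho>\<^sub>0\<close>-weighted products; one factor \<open>1/\<rho>\<^sub>0\<close> is attached
  to each of the two functions, since only the weighted restriction of \<open>y\<close> to \<open>q\<^sub>T\<close> is
  defined on \<open>U\<close>.\<close>

definition form_a ::
    "'n::finite problem \<Rightarrow> (nat \<Rightarrow> 'n state) set \<Rightarrow> (nat \<Rightarrow> 'n state) set \<Rightarrow> real" where
  "form_a P u v = (LINT z|lebesgue_on (qT P). obs_map P u z * obs_map P v z)"

definition form_l ::
    "'n::finite problem \<Rightarrow> ('n spacetime \<Rightarrow> real) \<Rightarrow> (nat \<Rightarrow> 'n state) set \<Rightarrow> real" where
  "form_l P yobs u = (LINT z|lebesgue_on (qT P). obs_map P u z * (yobs z / wt0 P z))"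

definition form_b ::
    "'n::finite problem \<Rightarrow> (nat \<Rightarrow> 'n state) set \<Rightarrow> 'n state \<Rightarrow> real" where
  "form_b P u m = (LINT z|lebesgue_on (QT P). J_map P u z \<bullet> snd m z)
                + (LINT z|lebesgue_on (QT P). I_map P u z * fst m z)"

definition is_solution :: "'n::finite problem \<Rightarrow> ('n spacetime \<Rightarrow> real)
    \<Rightarrow> (nat \<Rightarrow> 'n state) set \<Rightarrow> 'n state \<Rightarrow> bool" where
  "is_solution P yobs u m \<longleftrightarrow> u \<in> U P \<and> m \<in> X P \<and>
     (\<forall>v\<in>U P. form_a P u v + form_b P v m = form_l P yobs v) \<and>
     (\<forall>k\<in>X P. form_b P u k = 0)"

text \<open>The data of the problem is \<open>y\<^sub>o\<^sub>b\<^sub>s\<close>, an element of \<open>L\<^sup>2(q\<^sub>T)\<close>.\<close>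

definition well_posed :: "'n::finite problem \<Rightarrow> bool" where
  "well_posed P \<longleftrightarrow>
     (\<forall>yobs\<in>L2 (qT P). \<exists>u m. is_solution P yobs u m \<and>
        (\<forall>u' m'. is_solution P yobs u' m' \<longrightarrow> u' = u \<and> X_eq P m' m)) \<and>
     (\<forall>yobs\<in>L2 (qT P). \<forall>\<epsilon>>0. \<exists>\<delta>>0. \<forall>yobs'\<in>L2 (qT P).
        L2_norm (qT P) (\<lambda>z. yobs' z - yobs z) < \<delta> \<longrightarrow>
        (\<forall>u m u' m'. is_solution P yobs u m \<and> is_solution P yobs' u' m' \<longrightarrow>
           U_norm P (U_diff P u' u) < \<epsilon> \<and> X_norm P (state_diff m' m) < \<epsilon>))"

definition lagrangian :: "'n::finite problem \<Rightarrow> ('n spacetime \<Rightarrow> real)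
    \<Rightarrow> (nat \<Rightarrow> 'n state) set \<Rightarrow> 'n state \<Rightarrow> real" where
  "lagrangian P yobs u m = 1/2 * form_a P u u + form_b P u m - form_l P yobs u"

definition is_saddle_point :: "'n::finite problem \<Rightarrow> ('n spacetime \<Rightarrow> real)
    \<Rightarrow> (nat \<Rightarrow> 'n state) set \<Rightarrow> 'n state \<Rightarrow> bool" where
  "is_saddle_point P yobs u m \<longleftrightarrow> u \<in> U P \<and> m \<in> X P \<and>
     (\<forall>k\<in>X P. lagrangian P yobs u k \<le> lagrangian P yobs u m) \<and>
     (\<forall>v\<in>U P. lagrangian P yobs u m \<le> lagrangian P yobs v m)"

end

theory Submission
  imports Defs
begin

text \<open>
  Applying the three weighted operators to a smooth state gives a linear map \<open>Phi0\<close> from \<open>U\<^sub>0\<close> into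
  the Hilbert space \<open>L\<^sup>2(q\<^sub>T) \<times> (L\<^sup>2(Q\<^sub>T)\<^sup>N \<times> L\<^sup>2(Q\<^sub>T))\<close>, and the norm of \<open>U\<^sub>0\<close> is equivalent to the
  Hilbert norm of the image. The completion \<open>U\<close> is therefore the closure \<open>V\<close> of that image
  (\<open>state_space\<close> below). In these coordinates \<open>a\<close> is the inner product of first components, \<open>b\<close> pairs the
  second component with the multiplier, and the mixed formulation is a saddle point problem on a
  closed subspace. Existence, uniqueness, continuous dependence, the saddle point property and both
  estimates all follow from one inf-sup condition (\<open>infsup\<close>): every pair \<open>(\<mu>, \<lambda>)\<close> in
  \<open>X\<close> is the second component of an element \<open>(w, (\<mu>, \<lambda>))\<close> of \<open>V\<close>, with
  \<open>\<parallel>w\<parallel>\<close> at most \<open>\<beta>\<close> times \<open>\<parallel>(\<mu>, \<lambda>)\<parallel>\<close>. The constant \<open>\<beta>\<close> is then the one in the estimate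
  of the multiplier.

  The textbook way to the inf-sup condition is to solve a parabolic problem with right-hand side
  given by the multiplier. Here no parabolic equation is solved. Consider only states \<open>(y, p)\<close> that
  are \<open>C\<^sup>1\<close> on the whole space-time, with \<open>y\<close> vanishing for \<open>t \<le> 0\<close> and for \<open>x\<close> outside
  a compact subset of \<open>\<Omega>\<close>. Two facts about these interior states suffice, because a
  bounded lift defined on a dense subspace extends to the closure (\<open>bounded_lift_of_dense_range\<close>).

  The first fact is a bound: multiplying \<open>\<I>(y, p)\<close> by \<open>exp(-2kt) y\<close> with \<open>k\<close> large and integrating by parts
  controls \<open>y\<close> by \<open>\<I>(y, p)\<close> and \<open>\<J>(y, p)\<close> (\<open>energy_estimate\<close>). Its constant involves only
  \<open>T\<close>, the coercivity constant and the supremum of \<open>d\<close>.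

  The second fact is density of the pairs \<open>(\<J>/\<rho>\<^sub>1, \<I>/\<rho>)\<close> in \<open>X\<close>. If \<open>(\<mu>, \<lambda>)\<close> is
  orthogonal to all of them, put \<open>m = \<mu>/\<rho>\<^sub>1\<close> and \<open>l = \<lambda>/\<rho>\<close>, extended by zero. Varying \<open>p\<close> shows that
  \<open>m\<close> is the weak spatial gradient of \<open>l\<close> on all of space, so \<open>l\<close> has zero lateral trace;
  varying \<open>y\<close> gives the backward equation \<open>- l\<^sub>t - div(c\<^sup>T m) + d l = 0\<close> with final value zero,
  since nothing is required of \<open>y\<close> at \<open>t = T\<close>. Testing formally with \<open>l\<close> forces
  \<open>l = 0\<close> and \<open>m = 0\<close> (\<open>parabolic_uniqueness\<close>).

  The function \<open>l\<close> is not an admissible test function. It is localised by a cut-off near a point of the closure,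
  moved a little into the domain and forward in time, and mollified. The \<open>C\<^sup>2\<close> boundary enters only in providing the direction
  of that move (\<open>C2_domain_segment\<close>). All terms of the equation become correlations of square integrable
  functions at the shift, these are continuous in the shift (\<open>continuous_on_corr\<close>), and the term with
  the time derivative becomes the derivative of the correlation of \<open>l\<close> with its cut-off, which among
  shifts in time is largest at shift zero. Letting the shift tend to zero gives a local
  energy inequality (\<open>local_energy_inequality\<close>) without any regularity of \<open>l\<close> in time.
\<close>

section \<open>Complete inner product spaces\<close>

text \<open>This is the vanishing of the first variation: near \<open>t = 0\<close> the linear term dominates, so it must
  be zero if the polynomial has no sign change.\<close>

lemma quadratic_nonneg_imp_linear_zero:
  fixes a b :: real
  assumes "\<And>t. 0 \<le> t * a + t\<^sup>2 * b"
  shows "a = 0"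
proof (rule ccontr)
  assume "a \<noteq> 0"
  define n where "n = \<bar>b\<bar> + 1"
  have n: "n > 0" "b \<le> n - 1" unfolding n_def by auto
  have "(- a / n) * a + (- a / n)\<^sup>2 * b \<le> (- a / n) * a + (- a / n)\<^sup>2 * (n - 1)"
    using n by (intro add_left_mono mult_left_mono) auto
  also have "\<dots> = - a\<^sup>2 / n\<^sup>2" using n(1) by (simp add: power2_eq_square field_simps)
  also have "\<dots> < 0" using n \<open>a \<noteq> 0\<close> by simp
  finally show False using assms[of "- a / n"] by linarith
qed

text \<open>The representing vector minimises \<open>J x = \<parallel>x\<parallel>\<^sup>2 - 2 \<phi> x\<close> over \<open>V\<close>: by the parallelogram law
  a minimising sequence is Cauchy, and the first variation of \<open>J\<close> at its limit is the claim. Working on a closed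
  subspace directly covers projections and multiplier spaces without a separate type for each.\<close>

lemma Riesz_closed_subspace:
  fixes V :: "'a::{real_inner,complete_space} set" and \<phi> :: "'a \<Rightarrow> real"
  assumes V: "subspace V" "closed V"
    and add: "\<And>x y. x \<in> V \<Longrightarrow> y \<in> V \<Longrightarrow> \<phi> (x + y) = \<phi> x + \<phi> y"
    and scale: "\<And>r x. x \<in> V \<Longrightarrow> \<phi> (r *\<^sub>R x) = r * \<phi> x"
    and bdd: "\<And>x. x \<in> V \<Longrightarrow> \<bar>\<phi> x\<bar> \<le> B * norm x"
  shows "\<exists>m\<in>V. \<forall>x\<in>V. \<phi> x = m \<bullet> x"
proof -
  define J where "J x = (norm x)\<^sup>2 - 2 * \<phi> x" for x
  have B: "\<phi> x \<le> \<bar>B\<bar> * norm x" if "x \<in> V" for x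
  proof -
    have "\<phi> x \<le> B * norm x" using bdd[OF that] by linarith
    also have "\<dots> \<le> \<bar>B\<bar> * norm x" by (intro mult_right_mono) auto
    finally show ?thesis .
  qed
  have lower: "J x \<ge> - B\<^sup>2" if "x \<in> V" for x
  proof -
    have "0 \<le> (norm x - \<bar>B\<bar>)\<^sup>2" by simp
    then have "2 * (\<bar>B\<bar> * norm x) \<le> (norm x)\<^sup>2 + B\<^sup>2" by (simp add: power2_eq_square algebra_simps)
    then show ?thesis using B[OF that] unfolding J_def by linarith
  qed
  have 0: "0 \<in> V" using V(1) by (rule subspace_0)
  define j where "j = (INF x\<in>V. J x)"
  have bb: "bdd_below (J ` V)" using lower by (auto intro!: bdd_belowI2)
  have jle: "j \<le> J x" if "x \<in> V" for x
    unfolding j_def using bb that by (rule cINF_lower)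
  have "\<exists>x\<in>V. J x < j + 1 / Suc n" for n
  proof -
    have "Inf (J ` V) < j + 1 / Suc n" unfolding j_def by simp
    then show ?thesis using 0 cINF_less_iff[OF _ bb] by auto
  qed
  then obtain s where s: "\<And>n. s n \<in> V" "\<And>n. J (s n) < j + 1 / Suc n" by metis
  \<comment> \<open>the midpoint of two almost minimisers cannot do better than \<open>j\<close>, which forces them to be close\<close>
  have par: "(norm (x - y))\<^sup>2 \<le> 2 * (J x - j) + 2 * (J y - j)" if "x \<in> V" "y \<in> V" for x y
  proof -
    let ?m = "(1/2) *\<^sub>R (x + y)"
    have m: "?m \<in> V" using that V(1) by (intro subspace_scale subspace_add)
    have "\<phi> ?m = (\<phi> x + \<phi> y) / 2"
      using that V(1) by (simp add: scale add subspace_add del: scaleR_add_right)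
    moreover have "4 * (norm ?m)\<^sup>2 + (norm (x - y))\<^sup>2 = 2 * (norm x)\<^sup>2 + 2 * (norm y)\<^sup>2"
      by (simp add: power2_norm_eq_inner inner_add_left inner_add_right inner_diff_left
          inner_diff_right inner_commute field_simps)
    ultimately show ?thesis using jle[OF m] unfolding J_def by (simp add: field_simps)
  qed
  have "Cauchy s"
  proof (rule metric_CauchyI)
    fix e :: real assume "e > 0"
    then obtain N where N: "1 / Suc N < e\<^sup>2 / 4" using nat_approx_posE[of "e\<^sup>2/4"] by (auto simp: field_simps)
    have "dist (s m) (s n) < e" if "m \<ge> N" "n \<ge> N" for m n
    proof -
      have a: "J (s k) - j < 1 / Suc N" if "k \<ge> N" for k
        using s(2)[of k] that frac_le[of 1 1 "Suc N" "Suc k"] by fastforce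
      define \<delta> where "\<delta> = 1 / real (Suc N)"
      have "(norm (s m - s n))\<^sup>2 < e\<^sup>2"
        using par[OF s(1) s(1), of m n] a[OF \<open>m \<ge> N\<close>] a[OF \<open>n \<ge> N\<close>] N
        unfolding \<delta>_def[symmetric] by argo
      then show ?thesis using \<open>e > 0\<close> by (simp add: dist_norm power2_less_imp_less)
    qed
    then show "\<exists>N. \<forall>m\<ge>N. \<forall>n\<ge>N. dist (s m) (s n) < e" by blast
  qed
  then obtain m where lim: "s \<longlonglongrightarrow> m" using Cauchy_convergent convergent_def by blast
  have mV: "m \<in> V" using V(2) s(1) lim by (auto simp: closed_sequential_limits)
  have diff: "\<phi> (x - y) = \<phi> x - \<phi> y" if "x \<in> V" "y \<in> V" for x y
    using add[of "x - y" y] that V(1) by (simp add: subspace_diff)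
  have "(\<lambda>n. \<phi> (s n)) \<longlonglongrightarrow> \<phi> m"
  proof (rule LIM_zero_cancel, rule Lim_null_comparison)
    show "\<forall>\<^sub>F n in sequentially. norm (\<phi> (s n) - \<phi> m) \<le> B * norm (s n - m)"
      using bdd s(1) mV V(1) by (simp add: diff[symmetric] subspace_diff)
    show "(\<lambda>n. B * norm (s n - m)) \<longlonglongrightarrow> 0"
      using lim by (auto intro!: tendsto_eq_intros simp: LIM_zero_iff tendsto_norm_zero_iff)
  qed
  then have "(\<lambda>n. J (s n)) \<longlonglongrightarrow> J m" unfolding J_def by (intro tendsto_intros lim)
  moreover have "(\<lambda>n. j + 1 / Suc n) \<longlonglongrightarrow> j + 0"
    by (intro tendsto_intros) (use LIMSEQ_inverse_real_of_nat in \<open>simp add: inverse_eq_divide\<close>)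
  ultimately have Jm: "J m \<le> j"
    using s(2) by (intro LIMSEQ_le) (auto intro: less_imp_le)
  have "\<phi> x = m \<bullet> x" if x: "x \<in> V" for x
  proof -
    define a where "a = m \<bullet> x - \<phi> x"
    have "2 * a = 0"
    proof (rule quadratic_nonneg_imp_linear_zero)
      fix t
      have "m + t *\<^sub>R x \<in> V" using mV x V(1) by (intro subspace_add subspace_scale)
      then have "J m \<le> J (m + t *\<^sub>R x)" using Jm jle by fastforce
      also have "\<phi> (m + t *\<^sub>R x) = \<phi> m + t * \<phi> x"
        using mV x V(1) by (simp add: add scale subspace_scale)
      then have "J (m + t *\<^sub>R x) = J m + t * (2 * a) + t\<^sup>2 * (norm x)\<^sup>2"
        unfolding J_def a_def power2_norm_eq_inner
        by (simp add: inner_add_left inner_add_right inner_commute algebra_simps power2_eq_square)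
      finally show "0 \<le> t * (2 * a) + t\<^sup>2 * (norm x)\<^sup>2" by linarith
    qed
    then show ?thesis unfolding a_def by simp
  qed
  then show ?thesis using mV by blast
qed

lemma projection_closed_subspace:
  fixes V :: "'a::{real_inner,complete_space} set"
  assumes "subspace V" "closed V"
  shows "\<exists>m\<in>V. \<forall>x\<in>V. f \<bullet> x = m \<bullet> x"
  using assms by (rule Riesz_closed_subspace[where B = "norm f"])
    (auto simp: inner_add_right Cauchy_Schwarz_ineq2)

lemma subspace_closure:
  fixes S :: "'a::real_normed_vector set"
  assumes "subspace S"
  shows "subspace (closure S)"
  unfolding subspace_def
proof (intro conjI ballI allI)
  show "0 \<in> closure S" using subspace_0[OF assms] closure_subset by blast
next
  fix x y assume "x \<in> closure S" "y \<in> closure S"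
  then obtain s t where "\<And>n. s n \<in> S" "s \<longlonglongrightarrow> x" "\<And>n. t n \<in> S" "t \<longlonglongrightarrow> y"
    unfolding closure_sequential by metis
  then show "x + y \<in> closure S"
    unfolding closure_sequential using assms
    by (intro exI[of _ "\<lambda>n. s n + t n"]) (auto intro: tendsto_add subspace_add)
next
  fix c :: real and x assume "x \<in> closure S"
  then obtain s where "\<And>n. s n \<in> S" "s \<longlonglongrightarrow> x" unfolding closure_sequential by metis
  then show "c *\<^sub>R x \<in> closure S"
    unfolding closure_sequential using assms
    by (intro exI[of _ "\<lambda>n. c *\<^sub>R s n"]) (auto intro: tendsto_scaleR subspace_scale)
qed

text \<open>Density by duality: the difference between a vector of \<open>V\<close> and its projection to \<open>closure S\<close> is
  orthogonal to \<open>S\<close>.\<close>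

lemma closure_subspace_eq_of_orthogonal:
  fixes S V :: "'a::{real_inner,complete_space} set"
  assumes S: "subspace S" and V: "subspace V" "closed V" and SV: "S \<subseteq> V"
    and orth: "\<And>m. m \<in> V \<Longrightarrow> (\<And>x. x \<in> S \<Longrightarrow> m \<bullet> x = 0) \<Longrightarrow> m = 0"
  shows "closure S = V"
proof
  show "closure S \<subseteq> V" using SV V(2) by (rule closure_minimal)
  show "V \<subseteq> closure S"
  proof
    fix v assume v: "v \<in> V"
    obtain m where m: "m \<in> closure S" "\<And>x. x \<in> closure S \<Longrightarrow> v \<bullet> x = m \<bullet> x"
      using projection_closed_subspace[of "closure S" v] S subspace_closure[OF S] by auto
    have "m \<in> V" using m(1) SV V(2) closure_minimal by blast
    then have "v - m = 0"
      using orth[of "v - m"] v V(1) m(2) closure_subset[of S] by (auto simp: subspace_diff inner_diff_left)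
    then show "v \<in> closure S" using m(1) by simp
  qed
qed

section \<open>Mixed problems in Hilbert spaces\<close>

text \<open>The abstract form of the mixed formulation. A state is a pair \<open>(w, x)\<close> whose first component is
  the observation and whose second component is the residual of the constraint, so that the
  bilinear form \<open>a\<close> acts on first components only and \<open>b\<close> on second components only.\<close>

definition mixed_solution :: "('h::real_inner \<times> 'x::real_inner) set \<Rightarrow> 'x set \<Rightarrow> 'h \<Rightarrow> 'h \<times> 'x \<Rightarrow> 'x \<Rightarrow> bool" where
  "mixed_solution V M f u m \<longleftrightarrow> u \<in> V \<and> m \<in> M \<and>
     (\<forall>v\<in>V. fst u \<bullet> fst v + snd v \<bullet> m = f \<bullet> fst v) \<and> (\<forall>k\<in>M. snd u \<bullet> k = 0)"

definition mixed_lagrangian :: "'h::real_inner \<Rightarrow> 'h \<times> 'x::real_inner \<Rightarrow> 'x \<Rightarrow> real" where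
  "mixed_lagrangian f u m = 1/2 * (fst u \<bullet> fst u) + snd u \<bullet> m - f \<bullet> fst u"

definition mixed_saddle :: "('h::real_inner \<times> 'x::real_inner) set \<Rightarrow> 'x set \<Rightarrow> 'h \<Rightarrow> 'h \<times> 'x \<Rightarrow> 'x \<Rightarrow> bool" where
  "mixed_saddle V M f u m \<longleftrightarrow> u \<in> V \<and> m \<in> M \<and>
     (\<forall>k\<in>M. mixed_lagrangian f u k \<le> mixed_lagrangian f u m) \<and>
     (\<forall>v\<in>V. mixed_lagrangian f u m \<le> mixed_lagrangian f v m)"

lemma mixed_solution_diff:
  assumes "subspace V" "subspace M" "mixed_solution V M f u m" "mixed_solution V M f' u' m'"
  shows "mixed_solution V M (f' - f) (u' - u) (m' - m)"
  using assms unfolding mixed_solution_def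
  by (auto simp: subspace_diff inner_diff_left inner_diff_right algebra_simps)

text \<open>Testing with \<open>v = u\<close> gives \<open>\<parallel>fst u\<parallel>\<^sup>2 = f \<bullet> fst u\<close>, which bounds \<open>fst u\<close> and also shows
  \<open>\<parallel>f - fst u\<parallel> \<le> \<parallel>f\<parallel>\<close>. Testing with the lift \<open>(w, m)\<close> of the multiplier then gives
  \<open>\<parallel>m\<parallel>\<^sup>2 = (f - fst u) \<bullet> w\<close>. Applied to a difference of two solutions the same bounds yield uniqueness and stability.\<close>

lemma mixed_solution_bounds:
  assumes infsup: "\<And>x. x \<in> M \<Longrightarrow> \<exists>w. (w, x) \<in> V \<and> norm w \<le> \<beta> * norm x"
    and \<beta>: "\<beta> \<ge> 0" and VM: "snd ` V \<subseteq> M" and sol: "mixed_solution V M f u m"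
  shows "snd u = 0" "norm (fst u) \<le> norm f" "norm m \<le> \<beta> * norm f"
proof -
  have uV: "u \<in> V" and mM: "m \<in> M"
    and eq: "\<And>v. v \<in> V \<Longrightarrow> fst u \<bullet> fst v + snd v \<bullet> m = f \<bullet> fst v"
    and con: "\<And>k. k \<in> M \<Longrightarrow> snd u \<bullet> k = 0"
    using sol unfolding mixed_solution_def by auto
  have "snd u \<bullet> snd u = 0" using con VM uV by blast
  then show s0: "snd u = 0" by simp
  have uu: "fst u \<bullet> fst u = f \<bullet> fst u" using eq[OF uV] s0 by simp
  then have "norm (fst u) * norm (fst u) \<le> norm f * norm (fst u)"
    by (metis norm_cauchy_schwarz power2_eq_square power2_norm_eq_inner)
  then show "norm (fst u) \<le> norm f"
    by (metis mult_right_le_imp_le norm_ge_zero order_le_less)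
  have "(norm (f - fst u))\<^sup>2 = (norm f)\<^sup>2 - (norm (fst u))\<^sup>2"
    using uu by (simp add: power2_norm_eq_inner inner_diff_left inner_diff_right inner_commute)
  then have fu: "norm (f - fst u) \<le> norm f"
    by (metis diff_ge_0_iff_ge le_add_diff_inverse2 norm_ge_zero power2_le_imp_le zero_le_power2
        add_increasing2 order_refl diff_add_cancel)
  obtain w where w: "(w, m) \<in> V" "norm w \<le> \<beta> * norm m" using infsup[OF mM] by blast
  have "(norm m)\<^sup>2 = (f - fst u) \<bullet> w"
    using eq[OF w(1)] by (simp add: inner_diff_left power2_norm_eq_inner)
  also have "\<dots> \<le> norm (f - fst u) * norm w" by (rule norm_cauchy_schwarz)
  also have "\<dots> \<le> norm f * (\<beta> * norm m)" using fu w(2) by (intro mult_mono) auto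
  finally have "norm m * norm m \<le> (\<beta> * norm f) * norm m" by (simp add: power2_eq_square mult_ac)
  moreover have "0 \<le> \<beta> * norm f" using \<beta> by simp
  ultimately show "norm m \<le> \<beta> * norm f"
    by (metis mult_right_le_imp_le norm_ge_zero norm_eq_zero order_le_less)
qed

text \<open>Elements of \<open>V\<close> with vanishing residual form a closed subspace \<open>K\<close>, and the observation must be
  the projection \<open>p\<close> of \<open>f\<close> to it. The remaining part \<open>r = f - p\<close> is orthogonal to \<open>K\<close>, so \<open>r \<bullet> w\<close>
  depends on \<open>(w, x) \<in> V\<close> only through \<open>x\<close>. The inf-sup condition makes this a bounded functional of \<open>x\<close>,
  and its Riesz vector is the multiplier.\<close>

lemma mixed_solution_exists:
  fixes V :: "('h::{real_inner,complete_space} \<times> 'x::{real_inner,complete_space}) set"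
  assumes V: "subspace V" "closed V" and M: "subspace M" "closed M" and VM: "snd ` V \<subseteq> M"
    and infsup: "\<And>x. x \<in> M \<Longrightarrow> \<exists>w. (w, x) \<in> V \<and> norm w \<le> \<beta> * norm x"
  shows "\<exists>u m. mixed_solution V M f u m"
proof -
  define K where "K = {w. (w, 0) \<in> V}"
  have "subspace K"
    using subspace_add[OF V(1), of "(_, 0)" "(_, 0)"] subspace_scale[OF V(1), of "(_, 0)"] subspace_0[OF V(1)]
    unfolding subspace_def K_def by (auto simp: zero_prod_def)
  moreover have "closed ((\<lambda>w::'h. (w, 0::'x)) -` V)"
    by (intro continuous_closed_vimage V continuous_intros)
  then have "closed K" by (simp add: K_def vimage_def)
  ultimately obtain p where p: "p \<in> K" "\<And>w. w \<in> K \<Longrightarrow> f \<bullet> w = p \<bullet> w"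
    using projection_closed_subspace by blast
  define r where "r = f - p"
  have rK: "r \<bullet> w = 0" if "w \<in> K" for w using p(2)[OF that] by (simp add: r_def inner_diff_left)
  obtain W where W: "\<And>x. x \<in> M \<Longrightarrow> (W x, x) \<in> V" "\<And>x. x \<in> M \<Longrightarrow> norm (W x) \<le> \<beta> * norm x"
    using infsup by metis
  define \<phi> where "\<phi> x = r \<bullet> W x" for x
  \<comment> \<open>two lifts of \<open>x\<close> differ by an element of \<open>K\<close>\<close>
  have well: "\<phi> x = r \<bullet> w" if "(w, x) \<in> V" for w x
  proof -
    have "x \<in> M" using VM that by force
    then have "(w - W x, 0) \<in> V" using subspace_diff[OF V(1) that W(1)[of x]] by simp
    then show ?thesis using rK[of "w - W x"] by (simp add: K_def \<phi>_def inner_diff_right)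
  qed
  have "\<exists>m\<in>M. \<forall>x\<in>M. \<phi> x = m \<bullet> x"
  proof (rule Riesz_closed_subspace[OF M, where B = "norm r * \<beta>"])
    fix x y assume "x \<in> M" "y \<in> M"
    then have "(W x + W y, x + y) \<in> V" using subspace_add[OF V(1) W(1) W(1)] by simp
    then show "\<phi> (x + y) = \<phi> x + \<phi> y" using well by (simp add: \<phi>_def inner_add_right)
  next
    fix x and c :: real assume "x \<in> M"
    then have "(c *\<^sub>R W x, c *\<^sub>R x) \<in> V" using subspace_scale[OF V(1) W(1)] by simp
    then show "\<phi> (c *\<^sub>R x) = c * \<phi> x" using well by (simp add: \<phi>_def)
  next
    fix x assume x: "x \<in> M"
    have "\<bar>\<phi> x\<bar> \<le> norm r * norm (W x)" unfolding \<phi>_def by (rule Cauchy_Schwarz_ineq2)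
    also have "\<dots> \<le> norm r * (\<beta> * norm x)" by (intro mult_left_mono W x) simp
    finally show "\<bar>\<phi> x\<bar> \<le> norm r * \<beta> * norm x" by simp
  qed
  then obtain m where m: "m \<in> M" "\<And>x. x \<in> M \<Longrightarrow> \<phi> x = m \<bullet> x" by blast
  have "p \<bullet> fst v + snd v \<bullet> m = f \<bullet> fst v" if "v \<in> V" for v
  proof -
    have "snd v \<in> M" using VM that by blast
    then have "snd v \<bullet> m = r \<bullet> fst v"
      using m(2) well[of "fst v" "snd v"] that by (simp add: inner_commute)
    then show ?thesis by (simp add: r_def inner_diff_left)
  qed
  then have "mixed_solution V M f (p, 0) m"
    using p(1) m(1) by (simp add: mixed_solution_def K_def)
  then show ?thesis by blast
qed

text \<open>The Lagrangian is affine in the multiplier, so maximality in \<open>m\<close> forces the constraint. It is convex and quadratic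
  in the state, so minimality in \<open>u\<close> is equivalent to the vanishing of its first variation.\<close>

lemma mixed_saddle_iff_solution:
  assumes V: "subspace V" and M: "subspace M"
  shows "mixed_saddle V M f u m \<longleftrightarrow> mixed_solution V M f u m"
proof
  assume sad: "mixed_saddle V M f u m"
  then have uV: "u \<in> V" and mM: "m \<in> M" by (auto simp: mixed_saddle_def)
  have con: "snd u \<bullet> k = 0" if "k \<in> M" for k
  proof -
    have "m + k \<in> M" "m - k \<in> M" using that mM M by (auto simp: subspace_add subspace_diff)
    then have "mixed_lagrangian f u (m + k) \<le> mixed_lagrangian f u m"
      "mixed_lagrangian f u (m - k) \<le> mixed_lagrangian f u m"
      using sad by (auto simp: mixed_saddle_def)
    then show ?thesis by (simp add: mixed_lagrangian_def inner_add_right inner_diff_right)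
  qed
  have "fst u \<bullet> fst v + snd v \<bullet> m - f \<bullet> fst v = 0" if v: "v \<in> V" for v
  proof (rule quadratic_nonneg_imp_linear_zero)
    fix t :: real
    have "u + t *\<^sub>R v \<in> V" using uV v V by (auto intro: subspace_add subspace_scale)
    then have "mixed_lagrangian f u m \<le> mixed_lagrangian f (u + t *\<^sub>R v) m"
      using sad by (auto simp: mixed_saddle_def)
    then show "0 \<le> t * (fst u \<bullet> fst v + snd v \<bullet> m - f \<bullet> fst v) + t\<^sup>2 * (1/2 * (fst v \<bullet> fst v))"
      by (simp add: mixed_lagrangian_def inner_add_right inner_add_left inner_commute
          power2_eq_square algebra_simps)
  qed
  then show "mixed_solution V M f u m"
    using uV mM con unfolding mixed_solution_def by fastforce
next
  assume sol: "mixed_solution V M f u m"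
  have "mixed_lagrangian f u m \<le> mixed_lagrangian f v m" if v: "v \<in> V" for v
  proof -
    have "fst u \<bullet> fst v + snd v \<bullet> m = f \<bullet> fst v" "fst u \<bullet> fst u + snd u \<bullet> m = f \<bullet> fst u"
      using sol v by (auto simp: mixed_solution_def)
    then have "mixed_lagrangian f v m - mixed_lagrangian f u m
        = 1/2 * ((fst v - fst u) \<bullet> (fst v - fst u))"
      by (simp add: mixed_lagrangian_def inner_diff_left inner_diff_right inner_commute algebra_simps)
    moreover have "0 \<le> (fst v - fst u) \<bullet> (fst v - fst u)" by simp
    ultimately show ?thesis by linarith
  qed
  then show "mixed_saddle V M f u m"
    using sol by (auto simp: mixed_saddle_def mixed_solution_def mixed_lagrangian_def)
qed

text \<open>The bound makes the first component a Lipschitz function of the second one, so it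
  extends from \<open>snd ` S\<close> to the closure. This turns density and an a priori estimate into the inf-sup condition.\<close>

lemma bounded_lift_of_dense_range:
  fixes S :: "('h::{real_inner,complete_space} \<times> 'x::{real_inner,complete_space}) set"
  assumes S: "subspace S" and dense: "x \<in> closure (snd ` S)"
    and bdd: "\<And>v. v \<in> S \<Longrightarrow> norm (fst v) \<le> \<beta> * norm (snd v)"
  shows "\<exists>w. (w, x) \<in> closure S \<and> norm w \<le> \<beta> * norm x"
proof -
  obtain s where s: "\<And>n. s n \<in> S" "(\<lambda>n. snd (s n)) \<longlonglongrightarrow> x"
  proof -
    obtain z where z: "\<forall>n. z n \<in> snd ` S" "z \<longlonglongrightarrow> x" using dense unfolding closure_sequential by blast
    then have "\<forall>n. \<exists>v\<in>S. z n = snd v" by auto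
    then obtain s where "\<And>n. s n \<in> S" "\<And>n. z n = snd (s n)" by metis
    moreover from this(2) have "z = (\<lambda>n. snd (s n))" by (rule ext)
    with z(2) have "(\<lambda>n. snd (s n)) \<longlonglongrightarrow> x" by simp
    ultimately show ?thesis using that by blast
  qed
  have "Cauchy (\<lambda>n. fst (s n))"
  proof (rule metric_CauchyI)
    fix e :: real assume e: "e > 0"
    define b where "b = \<bar>\<beta>\<bar> + 1"
    have b: "b > 0" "\<beta> \<le> b" unfolding b_def by auto
    obtain N where N: "\<And>m n. m \<ge> N \<Longrightarrow> n \<ge> N \<Longrightarrow> dist (snd (s m)) (snd (s n)) < e / b"
      using metric_CauchyD[OF LIMSEQ_imp_Cauchy[OF s(2)], of "e / b"] e b by auto
    have "dist (fst (s m)) (fst (s n)) < e" if "m \<ge> N" "n \<ge> N" for m n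
    proof -
      have "dist (fst (s m)) (fst (s n)) = norm (fst (s m - s n))" by (simp add: dist_norm)
      also have "\<dots> \<le> \<beta> * norm (snd (s m - s n))" using S s(1) by (intro bdd) (simp add: subspace_diff)
      also have "\<dots> \<le> b * norm (snd (s m - s n))" by (intro mult_right_mono b) simp
      also have "\<dots> < e" using N[OF that] b by (simp add: dist_norm field_simps)
      finally show ?thesis .
    qed
    then show "\<exists>N. \<forall>m\<ge>N. \<forall>n\<ge>N. dist (fst (s m)) (fst (s n)) < e" by blast
  qed
  then obtain w where w: "(\<lambda>n. fst (s n)) \<longlonglongrightarrow> w" using Cauchy_convergent convergent_def by blast
  have "(\<lambda>n. (fst (s n), snd (s n))) \<longlonglongrightarrow> (w, x)" by (intro tendsto_Pair w s)
  then have "(w, x) \<in> closure S" using s(1) unfolding closure_sequential by auto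
  moreover have "norm w \<le> \<beta> * norm x"
    by (rule LIMSEQ_le[OF tendsto_norm[OF w] tendsto_mult_left[OF tendsto_norm[OF s(2)]]])
      (use bdd s(1) in auto)
  ultimately show ?thesis by blast
qed

section \<open>The Hilbert space of square integrable functions\<close>

text \<open>Representatives are Borel functions on the whole space with respect to \<open>lborel\<close>: convolutions and
  translations then stay measurable without passing through null sets.\<close>

definition sq_integrable :: "('a::euclidean_space \<Rightarrow> 'b::euclidean_space) \<Rightarrow> bool" where
  "sq_integrable f \<longleftrightarrow> f \<in> borel_measurable borel \<and> integrable lborel (\<lambda>z. (norm (f z))\<^sup>2)"

lemma sq_integrable_bound:
  assumes "sq_integrable f" "g \<in> borel_measurable borel"
    "AE z in lborel. norm (g z) \<le> c * norm (f z)"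
  shows "sq_integrable g"
proof -
  have "AE z in lborel. norm ((norm (g z))\<^sup>2) \<le> norm (c\<^sup>2 * (norm (f z))\<^sup>2)"
    using assms(3)
  proof eventually_elim
    case (elim z)
    then have "(norm (g z))\<^sup>2 \<le> (c * norm (f z))\<^sup>2" by (intro power_mono) auto
    then show ?case by (simp add: power_mult_distrib)
  qed
  moreover have "integrable lborel (\<lambda>z. c\<^sup>2 * (norm (f z))\<^sup>2)"
    using assms(1) by (simp add: sq_integrable_def)
  moreover have "(\<lambda>z. (norm (g z))\<^sup>2) \<in> borel_measurable lborel" using assms(2) by simp
  ultimately have "integrable lborel (\<lambda>z. (norm (g z))\<^sup>2)"
    by (rule Bochner_Integration.integrable_bound[rotated 2])
  then show ?thesis using assms(2) by (simp add: sq_integrable_def)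
qed

lemma sq_integrable_inner:
  assumes "sq_integrable f" "sq_integrable g"
  shows "integrable lborel (\<lambda>z. f z \<bullet> g z)"
proof (rule Bochner_Integration.integrable_bound)
  show "integrable lborel (\<lambda>z. (norm (f z))\<^sup>2 + (norm (g z))\<^sup>2)"
    using assms by (auto simp: sq_integrable_def)
  show "(\<lambda>z. f z \<bullet> g z) \<in> borel_measurable lborel"
    using assms by (auto simp: sq_integrable_def)
  show "AE z in lborel. norm (f z \<bullet> g z) \<le> norm ((norm (f z))\<^sup>2 + (norm (g z))\<^sup>2)"
  proof (rule AE_I2)
    fix z
    have "\<bar>f z \<bullet> g z\<bar> \<le> norm (f z) * norm (g z)" by (rule Cauchy_Schwarz_ineq2)
    moreover have "2 * (norm (f z) * norm (g z)) \<le> (norm (f z))\<^sup>2 + (norm (g z))\<^sup>2"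
      using sum_squares_bound[of "norm (f z)" "norm (g z)"] by (simp add: mult_ac)
    moreover have "0 \<le> norm (f z) * norm (g z)" by simp
    ultimately show "norm (f z \<bullet> g z) \<le> norm ((norm (f z))\<^sup>2 + (norm (g z))\<^sup>2)" by simp
  qed
qed

lemma sq_integrable_zero [simp]: "sq_integrable (\<lambda>z. 0)"
  by (simp add: sq_integrable_def)

lemma sq_integrable_scaleR: "sq_integrable f \<Longrightarrow> sq_integrable (\<lambda>z. c *\<^sub>R f z)"
  by (rule sq_integrable_bound[where c = "\<bar>c\<bar>"]) (auto simp: sq_integrable_def)

lemma sq_integrable_add:
  assumes "sq_integrable f" "sq_integrable g"
  shows "sq_integrable (\<lambda>z. f z + g z)"
proof -
  have "integrable lborel (\<lambda>z. (norm (f z))\<^sup>2 + 2 * (f z \<bullet> g z) + (norm (g z))\<^sup>2)"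
    using assms sq_integrable_inner[OF assms] by (auto simp: sq_integrable_def)
  moreover have "(norm (f z))\<^sup>2 + 2 * (f z \<bullet> g z) + (norm (g z))\<^sup>2 = (norm (f z + g z))\<^sup>2" for z
    by (simp add: power2_norm_eq_inner inner_add_left inner_add_right inner_commute)
  ultimately show ?thesis using assms by (auto simp: sq_integrable_def)
qed

lemma sq_integrable_minus: "sq_integrable f \<Longrightarrow> sq_integrable (\<lambda>z. - f z)"
  using sq_integrable_scaleR[of f "-1"] by simp

lemma sq_integrable_diff:
  "sq_integrable f \<Longrightarrow> sq_integrable g \<Longrightarrow> sq_integrable (\<lambda>z. f z - g z)"
  using sq_integrable_add[of f "\<lambda>z. - g z"] by (simp add: sq_integrable_minus)

lemma AE_eq_trans:
  assumes "AE z in M. f z = g z" "AE z in M. g z = h z"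
  shows "AE z in M. f z = h z"
  using assms by eventually_elim simp

quotient_type (overloaded) ('a, 'b) lsq = "'a::euclidean_space \<Rightarrow> 'b::euclidean_space" /
  partial: "\<lambda>f g. sq_integrable f \<and> sq_integrable g \<and> (AE z in lborel. f z = g z)"
proof (rule part_equivpI)
  show "\<exists>f. sq_integrable f \<and> sq_integrable f \<and> (AE z in lborel. f z = f z)"
    by (rule exI[of _ "\<lambda>z. 0"]) simp
next
  show "symp (\<lambda>f g. sq_integrable f \<and> sq_integrable g \<and> (AE z in lborel. f z = g z))"
    by (rule sympI) (simp add: eq_commute)
  show "transp (\<lambda>f g. sq_integrable f \<and> sq_integrable g \<and> (AE z in lborel. f z = g z))"
    by (rule transpI) (auto intro: AE_eq_trans)
qed

definition lsq_of :: "('a::euclidean_space \<Rightarrow> 'b::euclidean_space) \<Rightarrow> ('a, 'b) lsq" where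
  "lsq_of = abs_lsq"

lemma lsq_of_eq_iff:
  "sq_integrable f \<Longrightarrow> sq_integrable g \<Longrightarrow> lsq_of f = lsq_of g \<longleftrightarrow> (AE z in lborel. f z = g z)"
  using Quotient_rel[OF Quotient_lsq, of f g] by (auto simp: lsq_of_def)

definition lsq_fun :: "('a::euclidean_space, 'b::euclidean_space) lsq \<Rightarrow> 'a \<Rightarrow> 'b" where
  "lsq_fun = rep_lsq"

lemma sq_integrable_lsq_fun [simp]: "sq_integrable (lsq_fun x)"
  using Quotient_rep_reflp[OF Quotient_lsq, of x] by (simp add: lsq_fun_def)

lemma lsq_of_fun [simp]: "lsq_of (lsq_fun x) = x"
  using Quotient_abs_rep[OF Quotient_lsq, of x] by (simp add: lsq_fun_def lsq_of_def)

lemma AE_lsq_fun: "sq_integrable f \<Longrightarrow> AE z in lborel. lsq_fun (lsq_of f) z = f z"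
  using lsq_of_eq_iff[of "lsq_fun (lsq_of f)" f] by simp

lemma lsq_fun_measurable [measurable]: "lsq_fun x \<in> borel_measurable borel"
  using sq_integrable_lsq_fun[of x] by (simp add: sq_integrable_def)

instantiation lsq :: (euclidean_space, euclidean_space) real_vector
begin

definition "x + y = lsq_of (\<lambda>z. lsq_fun x z + lsq_fun y z)"
definition "x - y = lsq_of (\<lambda>z. lsq_fun x z - lsq_fun y z)"
definition "- x = lsq_of (\<lambda>z. - lsq_fun x z)"
definition "(0 :: ('a, 'b) lsq) = lsq_of (\<lambda>z. 0)"
definition "c *\<^sub>R x = lsq_of (\<lambda>z. c *\<^sub>R lsq_fun x z)"

lemma lsq_of_add:
  assumes "sq_integrable f" "sq_integrable g"
  shows "lsq_of (\<lambda>z. f z + g z) = lsq_of f + lsq_of g"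
  unfolding plus_lsq_def using assms AE_lsq_fun[OF assms(1)] AE_lsq_fun[OF assms(2)]
  by (subst lsq_of_eq_iff) (auto intro: sq_integrable_add)

lemma lsq_of_diff:
  assumes "sq_integrable f" "sq_integrable g"
  shows "lsq_of (\<lambda>z. f z - g z) = lsq_of f - lsq_of g"
  unfolding minus_lsq_def using assms AE_lsq_fun[OF assms(1)] AE_lsq_fun[OF assms(2)]
  by (subst lsq_of_eq_iff) (auto intro: sq_integrable_diff)

lemma lsq_of_minus:
  assumes "sq_integrable f"
  shows "lsq_of (\<lambda>z. - f z) = - lsq_of f"
  unfolding uminus_lsq_def using assms AE_lsq_fun[OF assms(1)]
  by (subst lsq_of_eq_iff) (auto intro: sq_integrable_minus)

lemma lsq_of_scaleR:
  assumes "sq_integrable f"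
  shows "lsq_of (\<lambda>z. c *\<^sub>R f z) = c *\<^sub>R lsq_of f"
  unfolding scaleR_lsq_def using assms AE_lsq_fun[OF assms(1)]
  by (subst lsq_of_eq_iff) (auto intro: sq_integrable_scaleR)

lemma lsq_cases:
  obtains f where "sq_integrable f" "x = lsq_of f"
  by (rule that[of "lsq_fun x"]) simp_all

instance
proof
  fix x y z :: "('a, 'b) lsq" and c d :: real
  obtain f where f: "sq_integrable f" "x = lsq_of f" by (rule lsq_cases)
  obtain g where g: "sq_integrable g" "y = lsq_of g" by (rule lsq_cases)
  obtain h where h: "sq_integrable h" "z = lsq_of h" by (rule lsq_cases)
  note fold = zero_lsq_def lsq_of_add[symmetric] lsq_of_diff[symmetric] lsq_of_minus[symmetric] lsq_of_scaleR[symmetric]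
    sq_integrable_add sq_integrable_diff sq_integrable_minus sq_integrable_scaleR f g h
  show "x + y + z = x + (y + z)" by (simp add: fold add.assoc)
  show "x + y = y + x" by (simp add: fold add.commute)
  show "0 + x = x" "- x + x = 0" "x - y = x + - y" by (simp_all add: fold)
  show "c *\<^sub>R (x + y) = c *\<^sub>R x + c *\<^sub>R y" "(c + d) *\<^sub>R x = c *\<^sub>R x + d *\<^sub>R x"
    "c *\<^sub>R d *\<^sub>R x = (c * d) *\<^sub>R x" "1 *\<^sub>R x = x"
    by (simp_all add: fold scaleR_add_right scaleR_add_left)
qed

end

instantiation lsq :: (euclidean_space, euclidean_space) real_inner
begin

definition "x \<bullet> y = (LINT z|lborel. lsq_fun x z \<bullet> lsq_fun y z)"

lemma inner_lsq_of:
  assumes "sq_integrable f" "sq_integrable g"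
  shows "lsq_of f \<bullet> lsq_of g = (LINT z|lborel. f z \<bullet> g z)"
  unfolding inner_lsq_def
proof (rule integral_cong_AE)
  show "(\<lambda>z. f z \<bullet> g z) \<in> borel_measurable lborel" using assms by (auto simp: sq_integrable_def)
  show "AE z in lborel. lsq_fun (lsq_of f) z \<bullet> lsq_fun (lsq_of g) z = f z \<bullet> g z"
    using AE_lsq_fun[OF assms(1)] AE_lsq_fun[OF assms(2)] by eventually_elim simp
qed simp

definition norm_lsq :: "('a, 'b) lsq \<Rightarrow> real" where
  "norm_lsq x = sqrt (x \<bullet> x)"
definition dist_lsq :: "('a, 'b) lsq \<Rightarrow> ('a, 'b) lsq \<Rightarrow> real" where
  "dist_lsq x y = norm (x - y)"
definition sgn_lsq :: "('a, 'b) lsq \<Rightarrow> ('a, 'b) lsq" where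
  "sgn_lsq x = x /\<^sub>R norm x"
definition uniformity_lsq :: "(('a, 'b) lsq \<times> ('a, 'b) lsq) filter" where
  "uniformity_lsq = (INF e\<in>{0<..}. principal {(x, y). dist x y < e})"
definition open_lsq :: "('a, 'b) lsq set \<Rightarrow> bool" where
  "open_lsq V \<longleftrightarrow> (\<forall>x\<in>V. eventually (\<lambda>(x', y). x' = x \<longrightarrow> y \<in> V) uniformity)"

instance
proof
  fix x y z :: "('a, 'b) lsq" and r :: real
  show "dist x y = norm (x - y)" by (rule dist_lsq_def)
  show "sgn x = x /\<^sub>R norm x" by (rule sgn_lsq_def)
  show "norm x = sqrt (x \<bullet> x)" by (rule norm_lsq_def)
  show "uniformity = (INF e\<in>{0<..}. principal {(x, y::('a, 'b) lsq). dist x y < e})"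
    by (rule uniformity_lsq_def)
  show "open V \<longleftrightarrow> (\<forall>x\<in>V. \<forall>\<^sub>F (x', y) in uniformity. x' = x \<longrightarrow> y \<in> V)" for V :: "('a, 'b) lsq set"
    by (rule open_lsq_def)
  obtain f where f: "sq_integrable f" "x = lsq_of f" by (rule lsq_cases)
  obtain g where g: "sq_integrable g" "y = lsq_of g" by (rule lsq_cases)
  obtain h where h: "sq_integrable h" "z = lsq_of h" by (rule lsq_cases)
  note fold = lsq_of_add[symmetric] lsq_of_scaleR[symmetric] inner_lsq_of
    sq_integrable_add sq_integrable_scaleR sq_integrable_inner f g h
  show "x \<bullet> y = y \<bullet> x" by (simp add: fold inner_commute)
  show "(x + y) \<bullet> z = x \<bullet> z + y \<bullet> z" by (simp add: fold inner_add_left)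
  show "r *\<^sub>R x \<bullet> y = r * (x \<bullet> y)" by (simp add: fold)
  show "0 \<le> x \<bullet> x" by (simp add: fold)
  have "x \<bullet> x = 0 \<longleftrightarrow> (AE w in lborel. f w \<bullet> f w = 0)"
    by (simp add: fold integral_nonneg_eq_0_iff_AE)
  also have "\<dots> \<longleftrightarrow> x = 0" by (simp add: f zero_lsq_def lsq_of_eq_iff)
  finally show "x \<bullet> x = 0 \<longleftrightarrow> x = 0" .
qed

end

lemma norm_lsq_of:
  "sq_integrable f \<Longrightarrow> (norm (lsq_of f))\<^sup>2 = (LINT z|lborel. (norm (f z))\<^sup>2)"
  by (simp add: power2_norm_eq_inner inner_lsq_of)

lemma nn_integral_lsq_of:
  "sq_integrable f \<Longrightarrow> (\<integral>\<^sup>+z. ennreal ((norm (f z))\<^sup>2) \<partial>lborel) = ennreal ((norm (lsq_of f))\<^sup>2)"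
  by (simp add: norm_lsq_of nn_integral_eq_integral sq_integrable_def)

lemma sq_integrableI_nn_integral:
  assumes "f \<in> borel_measurable borel" "(\<integral>\<^sup>+z. ennreal ((norm (f z))\<^sup>2) \<partial>lborel) < \<infinity>"
  shows "sq_integrable f"
  using assms by (simp add: sq_integrable_def integrable_iff_bounded)

text \<open>The weights \<open>4 ^ k\<close> still leave a convergent geometric series, so \<open>\<Sum>k. 4 ^ k * \<parallel>f\<^sub>k\<^sub>+\<^sub>1 - f\<^sub>k\<parallel>\<^sup>2\<close> is
  finite almost everywhere. There the increments are at most \<open>2 ^ (-k)\<close> times a factor that does not depend on \<open>k\<close>, hence summable.\<close>

lemma AE_Cauchy_of_summable_squares:
  fixes f :: "nat \<Rightarrow> 'a::euclidean_space \<Rightarrow> 'b::euclidean_space"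
  assumes f: "\<And>k. sq_integrable (f k)"
    and small: "\<And>k. (norm (lsq_of (f (Suc k)) - lsq_of (f k)))\<^sup>2 \<le> (1/8) ^ k"
  shows "AE z in lborel. Cauchy (\<lambda>k. f k z)"
proof -
  define \<Delta> where "\<Delta> k z = f (Suc k) z - f k z" for k z
  have sq: "sq_integrable (\<Delta> k)" for k unfolding \<Delta>_def by (intro sq_integrable_diff f)
  have [measurable]: "\<Delta> k \<in> borel_measurable borel" for k using sq by (simp add: sq_integrable_def)
  have n: "(\<integral>\<^sup>+z. ennreal (4 ^ k * (norm (\<Delta> k z))\<^sup>2) \<partial>lborel) \<le> ennreal ((1/2) ^ k)" for k
  proof -
    have "(\<integral>\<^sup>+z. ennreal (4 ^ k * (norm (\<Delta> k z))\<^sup>2) \<partial>lborel)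
        = ennreal (4 ^ k) * (\<integral>\<^sup>+z. ennreal ((norm (\<Delta> k z))\<^sup>2) \<partial>lborel)"
      by (subst nn_integral_cmult[symmetric]) (simp_all add: ennreal_mult)
    also have "\<dots> = ennreal (4 ^ k * (norm (lsq_of (f (Suc k)) - lsq_of (f k)))\<^sup>2)"
      unfolding nn_integral_lsq_of[OF sq] by (simp add: \<Delta>_def[abs_def] lsq_of_diff f ennreal_mult)
    also have "\<dots> \<le> ennreal (4 ^ k * (1/8) ^ k)"
      by (intro ennreal_leI mult_left_mono small) simp
    also have "4 ^ k * (1/8) ^ k = (1/2 :: real) ^ k"
      by (simp flip: power_mult_distrib)
    finally show ?thesis .
  qed
  have "(\<integral>\<^sup>+z. (\<Sum>k. ennreal (4 ^ k * (norm (\<Delta> k z))\<^sup>2)) \<partial>lborel)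
      = (\<Sum>k. \<integral>\<^sup>+z. ennreal (4 ^ k * (norm (\<Delta> k z))\<^sup>2) \<partial>lborel)"
    by (rule nn_integral_suminf) simp
  also have "\<dots> \<le> (\<Sum>k. ennreal ((1/2) ^ k))" by (intro suminf_le n) auto
  also have "\<dots> < \<infinity>" by (subst suminf_ennreal2) (auto intro: summable_geometric)
  finally have "AE z in lborel. (\<Sum>k. ennreal (4 ^ k * (norm (\<Delta> k z))\<^sup>2)) \<noteq> \<infinity>"
    by (intro nn_integral_PInf_AE) (auto simp: less_top)
  then show ?thesis
  proof eventually_elim
    case (elim z)
    define S where "S = enn2real (\<Sum>k. ennreal (4 ^ k * (norm (\<Delta> k z))\<^sup>2))"
    have S: "ennreal S = (\<Sum>k. ennreal (4 ^ k * (norm (\<Delta> k z))\<^sup>2))" "S \<ge> 0"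
      using elim unfolding S_def by (auto simp: less_top ennreal_enn2real_if)
    have "norm (\<Delta> k z) \<le> sqrt S * (1/2) ^ k" for k
    proof -
      have "(\<Sum>i\<in>{k}. ennreal (4 ^ i * (norm (\<Delta> i z))\<^sup>2)) \<le> ennreal S"
        unfolding S(1) by (rule sum_le_suminf) auto
      then have "ennreal (4 ^ k * (norm (\<Delta> k z))\<^sup>2) \<le> ennreal S"
        by (simp only: sum.empty finite.emptyI add_0_right empty_iff sum.insert not_False_eq_True)
      then have "4 ^ k * (norm (\<Delta> k z))\<^sup>2 \<le> S" using S(2) by (simp add: ennreal_le_iff)
      moreover have "(4::real) ^ k = (2 ^ k)\<^sup>2" by (simp add: power2_eq_square flip: power_mult_distrib)
      ultimately have "(2 ^ k * norm (\<Delta> k z))\<^sup>2 \<le> S" by (simp add: power_mult_distrib)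
      then have "2 ^ k * norm (\<Delta> k z) \<le> sqrt S" by (rule real_le_rsqrt)
      then show ?thesis by (simp add: field_simps power_one_over)
    qed
    then have "summable (\<lambda>k. norm (\<Delta> k z))"
      by (intro summable_comparison_test'[where g = "\<lambda>k. sqrt S * (1/2) ^ k" and N = 0 and f = "\<lambda>k. norm (\<Delta> k z)"]
          summable_mult summable_geometric) simp_all
    then have "summable (\<lambda>k. \<Delta> k z)" by (rule summable_norm_cancel)
    then have "convergent (\<lambda>n. \<Sum>k<n. \<Delta> k z)" by (simp add: summable_iff_convergent)
    then have "Cauchy (\<lambda>n. (\<Sum>k<n. \<Delta> k z) + f 0 z)"
      by (intro convergent_Cauchy convergent_add convergent_const)
    moreover have "(\<Sum>k<n. \<Delta> k z) + f 0 z = f n z" for n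
      unfolding \<Delta>_def by (subst sum_lessThan_telescope) simp
    ultimately show ?case by simp
  qed
qed

text \<open>By Fatou's lemma the distance from the pointwise limit to the \<open>k\<close>-th term is at most the lower limit of the
  distances to the later terms.\<close>

lemma lsq_limit_of_AE_limit:
  fixes f :: "nat \<Rightarrow> 'a::euclidean_space \<Rightarrow> 'b::euclidean_space"
  assumes f: "\<And>k. sq_integrable (f k)" and Cau: "Cauchy (\<lambda>k. lsq_of (f k))"
    and ae: "AE z in lborel. Cauchy (\<lambda>k. f k z)"
  shows "\<exists>x. (\<lambda>k. lsq_of (f k)) \<longlonglongrightarrow> x"
proof -
  have [measurable]: "f k \<in> borel_measurable borel" for k using f by (simp add: sq_integrable_def)
  define g where "g z = lim (\<lambda>k. f k z)" for z
  have [measurable]: "g \<in> borel_measurable borel" unfolding g_def by measurable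
  have lim: "AE z in lborel. (\<lambda>k. f k z) \<longlonglongrightarrow> g z"
    using ae unfolding g_def by eventually_elim (metis Cauchy_convergent convergent_LIMSEQ_iff)
  have fatou: "(\<integral>\<^sup>+z. ennreal ((norm (g z - f k z))\<^sup>2) \<partial>lborel)
      \<le> liminf (\<lambda>n. ennreal ((norm (lsq_of (f n) - lsq_of (f k)))\<^sup>2))" for k
  proof -
    have "(\<integral>\<^sup>+z. ennreal ((norm (g z - f k z))\<^sup>2) \<partial>lborel)
        = (\<integral>\<^sup>+z. liminf (\<lambda>n. ennreal ((norm (f n z - f k z))\<^sup>2)) \<partial>lborel)"
    proof (rule nn_integral_cong_AE)
      show "AE z in lborel. ennreal ((norm (g z - f k z))\<^sup>2) = liminf (\<lambda>n. ennreal ((norm (f n z - f k z))\<^sup>2))"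
        using lim
      proof eventually_elim
        case (elim z)
        then have "(\<lambda>n. ennreal ((norm (f n z - f k z))\<^sup>2)) \<longlonglongrightarrow> ennreal ((norm (g z - f k z))\<^sup>2)"
          by (intro tendsto_intros)
        from lim_imp_Liminf[OF _ this] show ?case by simp
      qed
    qed
    also have "\<dots> \<le> liminf (\<lambda>n. \<integral>\<^sup>+z. ennreal ((norm (f n z - f k z))\<^sup>2) \<partial>lborel)"
      by (rule nn_integral_liminf) simp
    also have "\<dots> = liminf (\<lambda>n. ennreal ((norm (lsq_of (f n) - lsq_of (f k)))\<^sup>2))"
      using nn_integral_lsq_of[OF sq_integrable_diff[OF f f]] by (simp add: lsq_of_diff f)
    finally show ?thesis .
  qed
  have close: "\<exists>N. \<forall>k\<ge>N. (\<integral>\<^sup>+z. ennreal ((norm (g z - f k z))\<^sup>2) \<partial>lborel) \<le> ennreal (e\<^sup>2)" if e: "e > 0" for e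
  proof -
    obtain N where N: "\<And>m n. m \<ge> N \<Longrightarrow> n \<ge> N \<Longrightarrow> norm (lsq_of (f m) - lsq_of (f n)) < e"
      using metric_CauchyD[OF Cau e] by (auto simp: dist_norm)
    have "liminf (\<lambda>n. ennreal ((norm (lsq_of (f n) - lsq_of (f k)))\<^sup>2)) \<le> ennreal (e\<^sup>2)" if "k \<ge> N" for k
    proof -
      have "\<forall>\<^sub>F n in sequentially. ennreal ((norm (lsq_of (f n) - lsq_of (f k)))\<^sup>2) \<le> ennreal (e\<^sup>2)"
        using eventually_ge_at_top[of N]
        by eventually_elim (auto intro!: ennreal_leI power_mono less_imp_le[OF N] that)
      then have "liminf (\<lambda>n. ennreal ((norm (lsq_of (f n) - lsq_of (f k)))\<^sup>2)) \<le> liminf (\<lambda>n. ennreal (e\<^sup>2))"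
        by (rule Liminf_mono)
      then show ?thesis by (simp add: Liminf_const)
    qed
    then show ?thesis using fatou order_trans by blast
  qed
  obtain N where "(\<integral>\<^sup>+z. ennreal ((norm (g z - f N z))\<^sup>2) \<partial>lborel) \<le> ennreal (1\<^sup>2)"
    using close[of 1] by auto
  then have "(\<integral>\<^sup>+z. ennreal ((norm (g z - f N z))\<^sup>2) \<partial>lborel) < \<infinity>"
    by (rule order_le_less_trans) simp
  then have "sq_integrable (\<lambda>z. g z - f N z)"
    by (rule sq_integrableI_nn_integral[rotated]) measurable
  from sq_integrable_add[OF this f[of N]] have g: "sq_integrable g" by simp
  have "(\<lambda>k. lsq_of (f k)) \<longlonglongrightarrow> lsq_of g"
  proof (rule LIMSEQ_I)
    fix r :: real assume r: "r > 0"
    obtain N where N: "\<And>k. k \<ge> N \<Longrightarrow> (\<integral>\<^sup>+z. ennreal ((norm (g z - f k z))\<^sup>2) \<partial>lborel) \<le> ennreal ((r/2)\<^sup>2)"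
      using close[of "r/2"] r by auto
    have "norm (lsq_of (f k) - lsq_of g) < r" if "k \<ge> N" for k
    proof -
      have "ennreal ((norm (lsq_of g - lsq_of (f k)))\<^sup>2) \<le> ennreal ((r/2)\<^sup>2)"
        using N[OF that] nn_integral_lsq_of[OF sq_integrable_diff[OF g f]] by (simp add: lsq_of_diff f g)
      then have "norm (lsq_of g - lsq_of (f k)) \<le> r/2"
        using r by (auto simp: ennreal_le_iff intro: power2_le_imp_le)
      then show ?thesis using r by (simp add: norm_minus_commute)
    qed
    then show "\<exists>N. \<forall>k\<ge>N. norm (lsq_of (f k) - lsq_of g) < r" by blast
  qed
  then show ?thesis by blast
qed

instance lsq :: (euclidean_space, euclidean_space) complete_space
proof
  fix s :: "nat \<Rightarrow> ('a, 'b) lsq" assume s: "Cauchy s"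
  have "\<exists>N. \<forall>m\<ge>N. \<forall>n\<ge>N. norm (s m - s n) < sqrt ((1/8) ^ k)" for k
    using metric_CauchyD[OF s, of "sqrt ((1/8) ^ k)"] by (simp add: dist_norm)
  then obtain N where N: "\<And>k m n. m \<ge> N k \<Longrightarrow> n \<ge> N k \<Longrightarrow> norm (s m - s n) < sqrt ((1/8) ^ k)" by metis
  \<comment> \<open>a strictly increasing sequence of indices with \<open>r k \<ge> N k\<close>\<close>
  define r where "r k = k + (\<Sum>j\<le>k. N j)" for k
  have r: "strict_mono r" unfolding strict_mono_Suc_iff r_def by simp
  have rN: "N k \<le> r k" for k unfolding r_def by (simp add: trans_le_add2 member_le_sum)
  have rs: "r k \<le> r (Suc k)" for k using r by (simp add: strict_mono_Suc_iff less_imp_le)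
  have "\<exists>f. sq_integrable f \<and> s (r k) = lsq_of f" for k using lsq_cases by metis
  then obtain f where f: "\<And>k. sq_integrable (f k)" "\<And>k. s (r k) = lsq_of (f k)" by metis
  have "(norm (lsq_of (f (Suc k)) - lsq_of (f k)))\<^sup>2 \<le> (1/8) ^ k" for k
  proof -
    have "norm (s (r (Suc k)) - s (r k)) \<le> sqrt ((1/8) ^ k)"
      by (intro less_imp_le N rN order_trans[OF rN rs])
    then have "(norm (s (r (Suc k)) - s (r k)))\<^sup>2 \<le> (sqrt ((1/8) ^ k))\<^sup>2" by (rule power_mono) simp
    then show ?thesis by (simp add: f(2))
  qed
  then have "AE z in lborel. Cauchy (\<lambda>k. f k z)" by (intro AE_Cauchy_of_summable_squares f)
  moreover have "Cauchy (\<lambda>k. lsq_of (f k))"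
    using Cauchy_subseq_Cauchy[OF s r] by (simp add: o_def f(2))
  ultimately obtain x where x: "(\<lambda>k. lsq_of (f k)) \<longlonglongrightarrow> x" using lsq_limit_of_AE_limit f(1) by blast
  then have "(s \<circ> r) \<longlonglongrightarrow> x" by (simp add: o_def f(2))
  with s r show "convergent s" by (meson Cauchy_converges_subseq convergentI)
qed

section \<open>Square integrable functions on a Borel set\<close>

lemma AE_lebesgue_on_iff:
  assumes "S \<in> sets borel"
  shows "(AE z in lebesgue_on S. P z) \<longleftrightarrow> (AE z in lborel. z \<in> S \<longrightarrow> P z)"
  using assms by (subst AE_restrict_space_iff) (auto simp: AE_completion_iff)

text \<open>This bridges the two measure spaces in use: a Lebesgue measurable function on \<open>S\<close>, whose values
  elsewhere are arbitrary, and a Borel function on the whole space vanishing off \<open>S\<close>.\<close>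

lemma borel_representative:
  fixes f :: "'a::euclidean_space \<Rightarrow> 'b::euclidean_space"
  assumes S: "S \<in> sets borel" and f: "f \<in> borel_measurable (lebesgue_on S)"
  shows "\<exists>h. h \<in> borel_measurable borel \<and> (\<forall>z. z \<notin> S \<longrightarrow> h z = 0) \<and> (AE z in lebesgue_on S. h z = f z)"
proof -
  define f0 where "f0 z = (if z \<in> S then f z else 0)" for z
  have f0: "f0 \<in> borel_measurable lebesgue"
    unfolding f0_def using f S by (intro borel_measurable_if_I) auto
  have "\<exists>h. h \<in> borel_measurable lborel \<and> (AE z in lborel. f0 z \<bullet> b = h z)" for b
  proof -
    have "(\<lambda>z. f0 z \<bullet> b) \<in> borel_measurable lebesgue" using f0 by simp
    from completion_ex_borel_measurable_real[OF this] show ?thesis by auto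
  qed
  then obtain h where h: "\<And>b. h b \<in> borel_measurable lborel" "\<And>b. AE z in lborel. f0 z \<bullet> b = h b z"
    by metis
  define g where "g z = (\<Sum>b\<in>Basis. (indicator S z * h b z) *\<^sub>R b)" for z
  have [measurable]: "h b \<in> borel_measurable borel" "S \<in> sets borel" for b using h(1) S by auto
  have "g \<in> borel_measurable borel" unfolding g_def by measurable
  moreover have "\<forall>z. z \<notin> S \<longrightarrow> g z = 0" by (simp add: g_def)
  moreover have "AE z in lborel. z \<in> S \<longrightarrow> g z = f z"
  proof -
    have "AE z in lborel. \<forall>b\<in>Basis. f0 z \<bullet> b = h b z"
      using h(2) by (subst AE_ball_countable) (auto intro: countable_finite)
    then show ?thesis
    proof eventually_elim
      case (elim z)
      show ?case
      proof
        assume z: "z \<in> S"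
        have "g z = (\<Sum>b\<in>Basis. (f0 z \<bullet> b) *\<^sub>R b)"
          unfolding g_def using elim z by (intro sum.cong) auto
        also have "\<dots> = f z" using z by (simp add: euclidean_representation f0_def)
        finally show "g z = f z" .
      qed
    qed
  qed
  ultimately show ?thesis using AE_lebesgue_on_iff[OF S] by blast
qed

lemma integral_borel_representative:
  fixes f h :: "'a::euclidean_space \<Rightarrow> 'b::euclidean_space"
  assumes S: "S \<in> sets borel" and f: "f \<in> borel_measurable (lebesgue_on S)"
    and h: "h \<in> borel_measurable borel" "\<And>z. z \<notin> S \<Longrightarrow> h z = 0"
    and eq: "AE z in lebesgue_on S. h z = f z"
  shows "integrable (lebesgue_on S) f \<longleftrightarrow> integrable lborel h"
    and "(LINT z|lebesgue_on S. f z) = (LINT z|lborel. h z)"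
proof -
  have SL: "S \<inter> space lebesgue \<in> sets lebesgue" using S by auto
  have m: "(\<lambda>z. indicator S z *\<^sub>R f z) \<in> borel_measurable lebesgue"
    using f borel_measurable_restrict_space_iff[OF SL, of f] by simp
  have hm: "h \<in> borel_measurable lebesgue" using h(1) by (intro measurable_completion) simp
  have ae: "AE z in lebesgue. indicator S z *\<^sub>R f z = h z"
    using eq h(2) unfolding AE_lebesgue_on_iff[OF S] AE_completion_iff
    by (auto elim!: eventually_mono split: split_indicator)
  show "integrable (lebesgue_on S) f \<longleftrightarrow> integrable lborel h"
    unfolding integrable_restrict_space[OF SL] using h(1)
    by (subst integrable_cong_AE[OF m hm ae]) (simp add: integrable_completion)
  show "(LINT z|lebesgue_on S. f z) = (LINT z|lborel. h z)"
    unfolding integral_restrict_space[OF SL] using h(1)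
    by (subst integral_cong_AE[OF m hm ae]) (simp add: integral_completion)
qed

lemma L2_representative:
  fixes f :: "'a::euclidean_space \<Rightarrow> 'b::euclidean_space"
  assumes S: "S \<in> sets borel" and f: "f \<in> L2 S"
  shows "\<exists>h. sq_integrable h \<and> (\<forall>z. z \<notin> S \<longrightarrow> h z = 0) \<and> (AE z in lebesgue_on S. h z = f z)"
proof -
  have fm: "f \<in> borel_measurable (lebesgue_on S)" and fi: "integrable (lebesgue_on S) (\<lambda>z. (norm (f z))\<^sup>2)"
    using f by (auto simp: L2_def)
  obtain h where h: "h \<in> borel_measurable borel" "\<And>z. z \<notin> S \<Longrightarrow> h z = 0" "AE z in lebesgue_on S. h z = f z"
    using borel_representative[OF S fm] by blast
  have "integrable (lebesgue_on S) (\<lambda>z. (norm (f z))\<^sup>2) \<longleftrightarrow> integrable lborel (\<lambda>z. (norm (h z))\<^sup>2)"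
    by (rule integral_borel_representative(1)[OF S]) (use fm h in \<open>auto elim!: eventually_mono\<close>)
  then show ?thesis using h fi by (auto simp: sq_integrable_def)
qed

text \<open>The extension by zero from \<open>S\<close>, on classes of functions. A Borel representative has to be chosen because
  elements of \<open>L\<^sup>2(S)\<close> are only Lebesgue measurable.\<close>

definition lsq_on :: "'a::euclidean_space set \<Rightarrow> ('a \<Rightarrow> 'b::euclidean_space) \<Rightarrow> ('a, 'b) lsq" where
  "lsq_on S f = lsq_of (SOME h. sq_integrable h \<and> (\<forall>z. z \<notin> S \<longrightarrow> h z = 0) \<and> (AE z in lebesgue_on S. h z = f z))"

lemma lsq_on_cases:
  assumes "S \<in> sets borel" "f \<in> L2 S"
  obtains h where "sq_integrable h" "\<And>z. z \<notin> S \<Longrightarrow> h z = 0" "AE z in lebesgue_on S. h z = f z" "lsq_on S f = lsq_of h"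
  using someI_ex[OF L2_representative[OF assms]] unfolding lsq_on_def by blast

lemma lsq_on_eq:
  assumes S: "S \<in> sets borel" and f: "f \<in> L2 S"
    and h: "sq_integrable h" "\<And>z. z \<notin> S \<Longrightarrow> h z = 0" "AE z in lebesgue_on S. h z = f z"
  shows "lsq_on S f = lsq_of h"
proof -
  obtain k where k: "sq_integrable k" "\<And>z. z \<notin> S \<Longrightarrow> k z = 0" "AE z in lebesgue_on S. k z = f z" "lsq_on S f = lsq_of k"
    using lsq_on_cases[OF S f] by blast
  have "AE z in lborel. k z = h z"
    using h(3) k(3) unfolding AE_lebesgue_on_iff[OF S]
    by eventually_elim (use h(2) k(2) in metis)
  then show ?thesis using k(1,4) h(1) by (simp add: lsq_of_eq_iff)
qed

lemma L2_I_representative: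
  fixes f :: "'a::euclidean_space \<Rightarrow> 'b::euclidean_space"
  assumes S: "S \<in> sets borel" and f: "f \<in> borel_measurable (lebesgue_on S)"
    and h: "sq_integrable h" "\<And>z. z \<notin> S \<Longrightarrow> h z = 0" "AE z in lebesgue_on S. h z = f z"
  shows "f \<in> L2 S"
proof -
  have "integrable (lebesgue_on S) (\<lambda>z. (norm (f z))\<^sup>2) \<longleftrightarrow> integrable lborel (\<lambda>z. (norm (h z))\<^sup>2)"
    by (rule integral_borel_representative(1)[OF S])
      (use f h in \<open>auto elim!: eventually_mono simp: sq_integrable_def\<close>)
  then show ?thesis using h f by (simp add: L2_def sq_integrable_def)
qed

lemma lsq_on_add:
  assumes S: "S \<in> sets borel" and f: "f \<in> L2 S" and g: "g \<in> L2 S"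
  shows "(\<lambda>z. f z + g z) \<in> L2 S" "lsq_on S (\<lambda>z. f z + g z) = lsq_on S f + lsq_on S g"
proof -
  obtain h where h: "sq_integrable h" "\<And>z. z \<notin> S \<Longrightarrow> h z = 0" "AE z in lebesgue_on S. h z = f z" "lsq_on S f = lsq_of h"
    using lsq_on_cases[OF S f] by blast
  obtain k where k: "sq_integrable k" "\<And>z. z \<notin> S \<Longrightarrow> k z = 0" "AE z in lebesgue_on S. k z = g z" "lsq_on S g = lsq_of k"
    using lsq_on_cases[OF S g] by blast
  have hk: "AE z in lebesgue_on S. h z + k z = f z + g z"
    using h(3) k(3) by eventually_elim simp
  show L: "(\<lambda>z. f z + g z) \<in> L2 S"
    by (rule L2_I_representative[OF S _ sq_integrable_add[OF h(1) k(1)] _ hk])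
      (use f g h(2) k(2) in \<open>auto simp: L2_def\<close>)
  have "lsq_on S (\<lambda>z. f z + g z) = lsq_of (\<lambda>z. h z + k z)"
    by (rule lsq_on_eq[OF S L sq_integrable_add[OF h(1) k(1)] _ hk]) (simp add: h(2) k(2))
  then show "lsq_on S (\<lambda>z. f z + g z) = lsq_on S f + lsq_on S g"
    by (simp add: lsq_of_add h k)
qed

lemma lsq_on_scaleR:
  assumes S: "S \<in> sets borel" and f: "f \<in> L2 S"
  shows "(\<lambda>z. c *\<^sub>R f z) \<in> L2 S" "lsq_on S (\<lambda>z. c *\<^sub>R f z) = c *\<^sub>R lsq_on S f"
proof -
  obtain h where h: "sq_integrable h" "\<And>z. z \<notin> S \<Longrightarrow> h z = 0" "AE z in lebesgue_on S. h z = f z" "lsq_on S f = lsq_of h"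
    using lsq_on_cases[OF S f] by blast
  have hk: "AE z in lebesgue_on S. c *\<^sub>R h z = c *\<^sub>R f z"
    using h(3) by eventually_elim simp
  show L: "(\<lambda>z. c *\<^sub>R f z) \<in> L2 S"
    by (rule L2_I_representative[OF S _ sq_integrable_scaleR[OF h(1)] _ hk])
      (use f h(2) in \<open>auto simp: L2_def\<close>)
  have "lsq_on S (\<lambda>z. c *\<^sub>R f z) = lsq_of (\<lambda>z. c *\<^sub>R h z)"
    by (rule lsq_on_eq[OF S L sq_integrable_scaleR[OF h(1)] _ hk]) (simp add: h(2))
  then show "lsq_on S (\<lambda>z. c *\<^sub>R f z) = c *\<^sub>R lsq_on S f"
    by (simp add: lsq_of_scaleR h)
qed

lemma lsq_on_diff:
  assumes S: "S \<in> sets borel" and f: "f \<in> L2 S" and g: "g \<in> L2 S"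
  shows "(\<lambda>z. f z - g z) \<in> L2 S" "lsq_on S (\<lambda>z. f z - g z) = lsq_on S f - lsq_on S g"
  using lsq_on_add[OF S f lsq_on_scaleR(1)[OF S g, of "-1"]] lsq_on_scaleR(2)[OF S g, of "-1"] by simp_all

lemma inner_lsq_on:
  assumes S: "S \<in> sets borel" and f: "f \<in> L2 S" and g: "g \<in> L2 S"
  shows "lsq_on S f \<bullet> lsq_on S g = (LINT z|lebesgue_on S. f z \<bullet> g z)"
    and "integrable (lebesgue_on S) (\<lambda>z. f z \<bullet> g z)"
proof -
  obtain h where h: "sq_integrable h" "\<And>z. z \<notin> S \<Longrightarrow> h z = 0" "AE z in lebesgue_on S. h z = f z" "lsq_on S f = lsq_of h"
    using lsq_on_cases[OF S f] by blast
  obtain k where k: "sq_integrable k" "\<And>z. z \<notin> S \<Longrightarrow> k z = 0" "AE z in lebesgue_on S. k z = g z" "lsq_on S g = lsq_of k"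
    using lsq_on_cases[OF S g] by blast
  have ae: "AE z in lebesgue_on S. h z \<bullet> k z = f z \<bullet> g z" using h(3) k(3) by eventually_elim simp
  have m: "(\<lambda>z. f z \<bullet> g z) \<in> borel_measurable (lebesgue_on S)" using f g by (auto simp: L2_def)
  have hk: "(\<lambda>z. h z \<bullet> k z) \<in> borel_measurable borel" using h(1) k(1) by (auto simp: sq_integrable_def)
  note rep = integral_borel_representative[OF S m hk _ ae]
  show "integrable (lebesgue_on S) (\<lambda>z. f z \<bullet> g z)"
    using rep(1) sq_integrable_inner[OF h(1) k(1)] by (simp add: h(2))
  show "lsq_on S f \<bullet> lsq_on S g = (LINT z|lebesgue_on S. f z \<bullet> g z)"
    using rep(2) by (simp add: h k inner_lsq_of)
qed

lemma norm_lsq_on: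
  assumes "S \<in> sets borel" "f \<in> L2 S"
  shows "norm (lsq_on S f) = L2_norm S f"
  using inner_lsq_on(1)[OF assms(1,2,2)] by (simp add: norm_eq_sqrt_inner L2_norm_def power2_norm_eq_inner)

lemma lsq_on_eq_iff:
  assumes S: "S \<in> sets borel" and f: "f \<in> L2 S" and g: "g \<in> L2 S"
  shows "lsq_on S f = lsq_on S g \<longleftrightarrow> (AE z in lebesgue_on S. f z = g z)"
proof
  obtain h where h: "sq_integrable h" "\<And>z. z \<notin> S \<Longrightarrow> h z = 0" "AE z in lebesgue_on S. h z = f z" "lsq_on S f = lsq_of h"
    using lsq_on_cases[OF S f] by blast
  obtain k where k: "sq_integrable k" "\<And>z. z \<notin> S \<Longrightarrow> k z = 0" "AE z in lebesgue_on S. k z = g z" "lsq_on S g = lsq_of k"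
    using lsq_on_cases[OF S g] by blast
  show "AE z in lebesgue_on S. f z = g z" if "lsq_on S f = lsq_on S g"
  proof -
    have "AE z in lborel. h z = k z" using that h k by (simp add: lsq_of_eq_iff)
    then have "AE z in lebesgue_on S. h z = k z" unfolding AE_lebesgue_on_iff[OF S] by eventually_elim simp
    with h(3) k(3) show ?thesis by eventually_elim simp
  qed
  show "lsq_on S f = lsq_on S g" if "AE z in lebesgue_on S. f z = g z"
  proof -
    from k(3) that have "AE z in lebesgue_on S. k z = f z" by eventually_elim simp
    with lsq_on_eq[OF S f k(1,2)] k(4) show ?thesis by simp
  qed
qed

lemma lsq_on_of_supported:
  assumes S: "S \<in> sets borel" and h: "sq_integrable h" "\<And>z. z \<notin> S \<Longrightarrow> h z = 0"
  shows "h \<in> L2 S" "lsq_on S h = lsq_of h"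
proof -
  have "h \<in> borel_measurable (lebesgue_on S)"
    using h(1) by (intro measurable_restrict_space1 measurable_completion) (simp add: sq_integrable_def)
  then show "h \<in> L2 S" using L2_I_representative[OF S _ h] by simp
  from lsq_on_eq[OF S this h] show "lsq_on S h = lsq_of h" by simp
qed

lemma L2_bound:
  fixes f :: "'a::euclidean_space \<Rightarrow> 'b::euclidean_space" and g :: "'a \<Rightarrow> 'c::euclidean_space"
  assumes f: "f \<in> L2 S" and g: "g \<in> borel_measurable (lebesgue_on S)"
    and le: "AE z in lebesgue_on S. norm (g z) \<le> c * norm (f z)" and c: "c \<ge> 0"
  shows "g \<in> L2 S" "L2_norm S g \<le> c * L2_norm S f"
proof -
  have fi: "integrable (lebesgue_on S) (\<lambda>z. c\<^sup>2 * (norm (f z))\<^sup>2)" using f by (simp add: L2_def)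
  have le2: "AE z in lebesgue_on S. (norm (g z))\<^sup>2 \<le> c\<^sup>2 * (norm (f z))\<^sup>2"
    using le
  proof eventually_elim
    case (elim z)
    then have "(norm (g z))\<^sup>2 \<le> (c * norm (f z))\<^sup>2" by (rule power_mono) simp
    then show ?case by (simp add: power_mult_distrib)
  qed
  have gi: "integrable (lebesgue_on S) (\<lambda>z. (norm (g z))\<^sup>2)"
    by (rule Bochner_Integration.integrable_bound[OF fi]) (use g le2 in \<open>auto elim!: eventually_mono\<close>)
  then show "g \<in> L2 S" using g by (simp add: L2_def)
  have "(LINT z|lebesgue_on S. (norm (g z))\<^sup>2) \<le> (LINT z|lebesgue_on S. c\<^sup>2 * (norm (f z))\<^sup>2)"
    by (rule integral_mono_AE[OF gi fi le2])
  also have "\<dots> = c\<^sup>2 * (LINT z|lebesgue_on S. (norm (f z))\<^sup>2)" by simp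
  finally have "L2_norm S g \<le> sqrt (c\<^sup>2 * (LINT z|lebesgue_on S. (norm (f z))\<^sup>2))"
    unfolding L2_norm_def by (rule real_sqrt_le_mono)
  then show "L2_norm S g \<le> c * L2_norm S f" using c by (simp add: L2_norm_def real_sqrt_mult)
qed

section \<open>Continuity of translations in the mean\<close>

lemma integral_translate:
  fixes f :: "'a::euclidean_space \<Rightarrow> 'b::{banach, second_countable_topology}"
  assumes [measurable]: "f \<in> borel_measurable borel"
  shows "(LINT z|lborel. f (z - s)) = (LINT z|lborel. f z)"
    and "integrable lborel (\<lambda>z. f (z - s)) \<longleftrightarrow> integrable lborel f"
proof -
  have "(LINT z|distr lborel borel ((+) (- s)). f z) = (LINT z|lborel. f (- s + z))"
    by (rule integral_distr) auto
  then show "(LINT z|lborel. f (z - s)) = (LINT z|lborel. f z)"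
    by (simp add: lborel_distr_plus)
  have "integrable (distr lborel borel ((+) (- s))) f \<longleftrightarrow> integrable lborel (\<lambda>z. f (- s + z))"
    by (rule integrable_distr_eq) auto
  then show "integrable lborel (\<lambda>z. f (z - s)) \<longleftrightarrow> integrable lborel f"
    by (simp add: lborel_distr_plus)
qed

lemma sq_integrable_translate:
  assumes "sq_integrable f"
  shows "sq_integrable (\<lambda>z. f (z - s))"
proof -
  have [measurable]: "f \<in> borel_measurable borel" using assms by (simp add: sq_integrable_def)
  show ?thesis
    using assms integral_translate(2)[of "\<lambda>z. (norm (f z))\<^sup>2" s] by (simp add: sq_integrable_def)
qed

definition translate :: "'a::euclidean_space \<Rightarrow> ('a, 'b::euclidean_space) lsq \<Rightarrow> ('a, 'b) lsq" where
  "translate s x = lsq_of (\<lambda>z. lsq_fun x (z - s))"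

lemma translate_inner_self: "translate s x \<bullet> translate s x = x \<bullet> x"
  unfolding translate_def
  by (subst inner_lsq_of) (auto intro!: sq_integrable_translate simp: inner_lsq_def
      integral_translate(1)[of "\<lambda>z. lsq_fun x z \<bullet> lsq_fun x z"])

lemma translate_norm: "norm (translate s x) = norm x"
  by (simp add: norm_eq_sqrt_inner translate_inner_self)

lemma AE_translate:
  fixes P :: "'a::euclidean_space \<Rightarrow> bool"
  assumes "AE z in lborel. P z"
  shows "AE z in lborel. P (z - s)"
proof -
  have "AE z in distr lborel borel ((+) (- s)). P z" unfolding lborel_distr_plus by (rule assms)
  from AE_distrD[OF _ this] have "AE z in lborel. P (- s + z)" by simp
  then show ?thesis by simp
qed

lemma translate_lsq_of:
  assumes "sq_integrable f"
  shows "translate s (lsq_of f) = lsq_of (\<lambda>z. f (z - s))"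
  unfolding translate_def using AE_translate[OF AE_lsq_fun[OF assms], of s]
  by (subst lsq_of_eq_iff) (auto intro: sq_integrable_translate assms)

lemma translate_add: "translate s (x + y) = translate s x + translate s y"
proof -
  obtain f where f: "sq_integrable f" "x = lsq_of f" by (rule lsq_cases)
  obtain g where g: "sq_integrable g" "y = lsq_of g" by (rule lsq_cases)
  show ?thesis unfolding f(2) g(2) lsq_of_add[OF f(1) g(1), symmetric]
    by (subst translate_lsq_of) (simp_all add: f g sq_integrable_add sq_integrable_translate translate_lsq_of lsq_of_add)
qed

lemma translate_scaleR: "translate s (c *\<^sub>R x) = c *\<^sub>R translate s x"
proof -
  obtain f where f: "sq_integrable f" "x = lsq_of f" by (rule lsq_cases)
  show ?thesis unfolding f(2) lsq_of_scaleR[OF f(1), symmetric]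
    by (subst translate_lsq_of) (simp_all add: f sq_integrable_scaleR sq_integrable_translate translate_lsq_of lsq_of_scaleR)
qed

lemma translate_diff: "translate s (x - y) = translate s x - translate s y"
  using translate_add[of s x "(-1) *\<^sub>R y"] by (simp only: translate_scaleR) simp

lemma translate_translate: "translate s (translate t x) = translate (s + t) x"
proof -
  obtain f where f: "sq_integrable f" "x = lsq_of f" by (rule lsq_cases)
  show ?thesis by (simp add: f translate_lsq_of sq_integrable_translate algebra_simps)
qed

text \<open>The vectors on which translation is continuous in the mean. They are collected in a set in order to show that
  it is a closed subspace with trivial orthogonal complement.\<close>

definition transl_cont :: "('a::euclidean_space, 'b::euclidean_space) lsq set" where
  "transl_cont = {x. ((\<lambda>s. translate s x) \<longlongrightarrow> x) (at 0)}"

lemma subspace_transl_cont: "subspace (transl_cont :: ('a::euclidean_space, 'b::euclidean_space) lsq set)"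
proof -
  have "translate s (0 :: ('a, 'b) lsq) = 0" for s
    using translate_scaleR[of s 0 "0 :: ('a, 'b) lsq"] by simp
  then show ?thesis
    unfolding subspace_def transl_cont_def
    by (auto simp: translate_add translate_scaleR intro!: tendsto_eq_intros)
qed

text \<open>Translations are isometries, so continuity passes to limits by the three-epsilon argument.\<close>

lemma closed_transl_cont: "closed transl_cont"
  unfolding closed_sequential_limits
proof (intro allI impI, elim conjE)
  fix x :: "nat \<Rightarrow> ('a, 'b) lsq" and l
  assume x: "\<forall>n. x n \<in> transl_cont" and l: "x \<longlonglongrightarrow> l"
  have "((\<lambda>s. translate s l) \<longlongrightarrow> l) (at 0)"
  proof (rule tendstoI)
    fix e :: real assume "e > 0"
    then obtain n where n: "dist (x n) l < e / 3"
      using LIMSEQ_D[OF l, of "e / 3"] by (auto simp: dist_norm)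
    have "((\<lambda>s. translate s (x n)) \<longlongrightarrow> x n) (at 0)" using x by (simp add: transl_cont_def)
    then have "\<forall>\<^sub>F s in at 0. dist (translate s (x n)) (x n) < e / 3" using \<open>e > 0\<close> by (intro tendstoD) auto
    then show "\<forall>\<^sub>F s in at 0. dist (translate s l) l < e"
    proof eventually_elim
      case (elim s)
      have "dist (translate s l) (translate s (x n)) = dist (x n) l"
        by (simp add: dist_norm translate_diff[symmetric] translate_norm norm_minus_commute)
      then show ?case
        using elim n dist_triangle[of "translate s l" l "translate s (x n)"] dist_triangle[of "translate s (x n)" l "x n"]
        by linarith
    qed
  qed
  then show "l \<in> transl_cont" by (simp add: transl_cont_def)
qed

lemma sq_integrable_indicator:
  assumes "A \<in> sets borel" "emeasure lborel A < \<infinity>"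
  shows "sq_integrable (\<lambda>z. indicator A z *\<^sub>R e)"
proof -
  have "integrable lborel (\<lambda>z. indicator A z * (norm e)\<^sup>2)"
    using assms by (intro integrable_mult_left) (auto simp: integrable_indicator_iff)
  moreover have "(norm (indicator A z *\<^sub>R e))\<^sup>2 = indicator A z * (norm e)\<^sup>2" for z
    by (simp split: split_indicator)
  ultimately show ?thesis using assms by (simp add: sq_integrable_def)
qed

text \<open>In the expansion of \<open>\<parallel>f s - x\<parallel>\<^sup>2\<close> the norms are constant and only the mixed term depends on \<open>s\<close>.\<close>

lemma tendsto_of_norm_inner:
  fixes f :: "'c \<Rightarrow> 'a::real_inner"
  assumes "\<And>s. norm (f s) = norm x" and "((\<lambda>s. f s \<bullet> x) \<longlongrightarrow> x \<bullet> x) F"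
  shows "(f \<longlongrightarrow> x) F"
proof -
  have eq: "(norm (f s - x))\<^sup>2 = 2 * (x \<bullet> x) - 2 * (f s \<bullet> x)" for s
  proof -
    have "f s \<bullet> f s = x \<bullet> x" using assms(1)[of s] by (simp add: norm_eq_sqrt_inner)
    then show ?thesis by (simp add: power2_norm_eq_inner inner_diff_left inner_diff_right inner_commute)
  qed
  have "((\<lambda>s. sqrt (2 * (x \<bullet> x) - 2 * (f s \<bullet> x))) \<longlongrightarrow> sqrt (2 * (x \<bullet> x) - 2 * (x \<bullet> x))) F"
    by (intro tendsto_intros assms)
  then have "((\<lambda>s. norm (f s - x)) \<longlongrightarrow> 0) F" by (simp flip: eq)
  then show ?thesis by (simp add: LIM_zero_iff tendsto_norm_zero_iff)
qed

text \<open>For an open set the product of the shifted and the unshifted indicator converges pointwise to the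
  indicator, and it is dominated by it. Since translation preserves the norm, convergence of these inner products is enough.\<close>

lemma indicator_open_transl_cont:
  fixes V :: "'a::euclidean_space set" and e :: "'b::euclidean_space"
  assumes V: "open V" and fin: "emeasure lborel V < \<infinity>"
  shows "lsq_of (\<lambda>z. indicator V z *\<^sub>R e) \<in> transl_cont"
proof -
  let ?f = "\<lambda>z. indicator V z *\<^sub>R e"
  have [measurable]: "V \<in> sets borel" using V by simp
  have sq: "sq_integrable ?f" using fin by (intro sq_integrable_indicator) auto
  have int: "integrable lborel (\<lambda>z. indicator V z * (norm e)\<^sup>2)"
    using fin by (intro integrable_mult_left) (auto simp: integrable_indicator_iff)
  have "((\<lambda>s. translate s (lsq_of ?f)) \<longlongrightarrow> lsq_of ?f) (at 0)"
  proof (rule tendsto_of_norm_inner)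
    have eq: "translate s (lsq_of ?f) \<bullet> lsq_of ?f = (LINT z|lborel. ?f (z - s) \<bullet> ?f z)" for s
      using sq_integrable_translate[OF sq, of s] by (simp add: translate_lsq_of sq inner_lsq_of)
    have "((\<lambda>s. LINT z|lborel. ?f (z - s) \<bullet> ?f z) \<longlongrightarrow> (LINT z|lborel. ?f z \<bullet> ?f z)) (at 0)"
      unfolding tendsto_at_iff_sequentially o_def
    proof (intro allI impI)
      fix S :: "nat \<Rightarrow> 'a" assume S: "S \<longlonglongrightarrow> 0"
      show "(\<lambda>n. LINT z|lborel. ?f (z - S n) \<bullet> ?f z) \<longlonglongrightarrow> (LINT z|lborel. ?f z \<bullet> ?f z)"
      proof (rule integral_dominated_convergence[where w = "\<lambda>z. indicator V z * (norm e)\<^sup>2"])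
        show "AE z in lborel. (\<lambda>n. ?f (z - S n) \<bullet> ?f z) \<longlonglongrightarrow> ?f z \<bullet> ?f z"
        proof (rule AE_I2)
          fix z
          show "(\<lambda>n. ?f (z - S n) \<bullet> ?f z) \<longlonglongrightarrow> ?f z \<bullet> ?f z"
          proof (cases "z \<in> V")
            case True
            have "(\<lambda>n. z - S n) \<longlonglongrightarrow> z - 0" by (intro tendsto_intros S)
            then have "\<forall>\<^sub>F n in sequentially. z - S n \<in> V" using V True by (auto simp: tendsto_def)
            then have "\<forall>\<^sub>F n in sequentially. ?f (z - S n) \<bullet> ?f z = ?f z \<bullet> ?f z"
              by eventually_elim (simp add: True)
            then show ?thesis by (rule tendsto_eventually)
          qed simp
        qed
        show "AE z in lborel. norm (?f (z - S n) \<bullet> ?f z) \<le> indicator V z * (norm e)\<^sup>2" for n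
          by (rule AE_I2) (auto simp: power2_norm_eq_inner split: split_indicator)
      qed (use int in measurable)
    qed
    then show "((\<lambda>s. translate s (lsq_of ?f) \<bullet> lsq_of ?f) \<longlongrightarrow> lsq_of ?f \<bullet> lsq_of ?f) (at 0)"
      using sq by (simp add: eq inner_lsq_of)
  qed (rule translate_norm)
  then show ?thesis by (simp add: transl_cont_def)
qed

text \<open>By outer regularity the indicator is a mean square limit of indicators of open sets.\<close>

lemma indicator_transl_cont:
  fixes A :: "'a::euclidean_space set" and e :: "'b::euclidean_space"
  assumes A: "A \<in> sets borel" and fin: "emeasure lborel A < \<infinity>"
  shows "lsq_of (\<lambda>z. indicator A z *\<^sub>R e) \<in> transl_cont"
proof -
  have "lsq_of (\<lambda>z. indicator A z *\<^sub>R e) \<in> closure transl_cont"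
    unfolding closure_approachable
  proof (intro allI impI)
    fix r :: real assume r: "r > 0"
    define \<delta> where "\<delta> = r\<^sup>2 / ((norm e)\<^sup>2 + 1)"
    have den: "(norm e)\<^sup>2 + 1 > 0" by (simp add: add_nonneg_pos)
    have \<delta>: "\<delta> > 0" unfolding \<delta>_def using r den by (intro divide_pos_pos) auto
    obtain V where V: "open V" "A \<subseteq> V" "emeasure lborel (V - A) < ennreal \<delta>"
      using outer_regular_lborel[OF A \<delta>] by blast
    have fV: "emeasure lborel (V - A) < \<infinity>" using V(3) by (rule less_trans) simp
    have "emeasure lborel V \<le> emeasure lborel A + emeasure lborel (V - A)"
      using emeasure_subadditive[of A lborel "V - A"] A V(1,2) by (simp add: Un_absorb1)
    also have "\<dots> < \<infinity>" using fin fV by (simp add: less_top)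
    finally have finV: "emeasure lborel V < \<infinity>" .
    have sq: "sq_integrable (\<lambda>z. indicator V z *\<^sub>R e)" "sq_integrable (\<lambda>z. indicator A z *\<^sub>R e)"
      by (intro sq_integrable_indicator borel_open V(1) A fin finV)+
    have "(dist (lsq_of (\<lambda>z. indicator V z *\<^sub>R e)) (lsq_of (\<lambda>z. indicator A z *\<^sub>R e)))\<^sup>2
        = (LINT z|lborel. (norm (indicator V z *\<^sub>R e - indicator A z *\<^sub>R e))\<^sup>2)"
      unfolding dist_norm lsq_of_diff[OF sq, symmetric] by (rule norm_lsq_of[OF sq_integrable_diff[OF sq]])
    also have "\<dots> = (LINT z|lborel. indicator (V - A) z * (norm e)\<^sup>2)"
      by (intro Bochner_Integration.integral_cong) (use V(2) in \<open>auto split: split_indicator\<close>)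
    also have "\<dots> = measure lborel (V - A) * (norm e)\<^sup>2" by simp
    also have "\<dots> \<le> \<delta> * (norm e)\<^sup>2"
    proof (rule mult_right_mono)
      have "emeasure lborel (V - A) = ennreal (measure lborel (V - A))"
        using fV by (intro emeasure_eq_ennreal_measure) simp
      then show "measure lborel (V - A) \<le> \<delta>" using V(3) by (simp add: ennreal_less_iff)
    qed simp
    also have "\<dots> < \<delta> * ((norm e)\<^sup>2 + 1)" using \<delta> by (intro mult_strict_left_mono) auto
    also have "\<dots> = r\<^sup>2" using den unfolding \<delta>_def by simp
    finally have "dist (lsq_of (\<lambda>z. indicator V z *\<^sub>R e)) (lsq_of (\<lambda>z. indicator A z *\<^sub>R e)) < r"
      by (rule power2_less_imp_less) (use r in simp)
    then show "\<exists>y\<in>transl_cont. dist y (lsq_of (\<lambda>z. indicator A z *\<^sub>R e)) < r"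
      using indicator_open_transl_cont[OF V(1) finV] by blast
  qed
  then show ?thesis by (simp only: closure_closed[OF closed_transl_cont])
qed

text \<open>A vector orthogonal to all indicators of Borel sets of finite measure is zero: test with the set
  where \<open>f \<bullet> e\<close> is positive, cut off by a ball.\<close>

lemma transl_cont_UNIV: "transl_cont = UNIV"
proof -
  have "closure transl_cont = (UNIV :: ('a::euclidean_space, 'b::euclidean_space) lsq set)"
  proof (rule closure_subspace_eq_of_orthogonal)
    fix m :: "('a, 'b) lsq" assume orth: "\<And>x. x \<in> transl_cont \<Longrightarrow> m \<bullet> x = 0"
    obtain f where f: "sq_integrable f" "m = lsq_of f" by (rule lsq_cases)
    have [measurable]: "f \<in> borel_measurable borel" using f(1) by (simp add: sq_integrable_def)
    have half: "AE z in lborel. f z \<bullet> e \<le> 0" for e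
    proof -
      have "AE z in lborel. z \<in> ball 0 (real n) \<longrightarrow> f z \<bullet> e \<le> 0" for n
      proof -
        define A where "A = {z. f z \<bullet> e > 0} \<inter> ball 0 (real n)"
        have [measurable]: "A \<in> sets borel" unfolding A_def by measurable
        have "emeasure lborel A \<le> emeasure lborel (ball (0::'a) (real n))"
          unfolding A_def by (intro emeasure_mono) auto
        then have fin: "emeasure lborel A < \<infinity>"
          by (rule order_le_less_trans[OF _ emeasure_lborel_ball_finite])
        have sq: "sq_integrable (\<lambda>z. indicator A z *\<^sub>R e)" using fin by (intro sq_integrable_indicator) auto
        have "(LINT z|lborel. f z \<bullet> (indicator A z *\<^sub>R e)) = 0"
          using orth[OF indicator_transl_cont[of A e]] fin by (simp add: f inner_lsq_of sq)
        moreover have "integrable lborel (\<lambda>z. f z \<bullet> (indicator A z *\<^sub>R e))"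
          by (rule sq_integrable_inner[OF f(1) sq])
        moreover have "AE z in lborel. 0 \<le> f z \<bullet> (indicator A z *\<^sub>R e)"
          by (auto simp: A_def split: split_indicator)
        ultimately have "AE z in lborel. f z \<bullet> (indicator A z *\<^sub>R e) = 0"
          using integral_nonneg_eq_0_iff_AE by blast
        then show ?thesis by eventually_elim (auto simp: A_def split: split_indicator_asm)
      qed
      then have "AE z in lborel. \<forall>n. z \<in> ball 0 (real n) \<longrightarrow> f z \<bullet> e \<le> 0" by (subst AE_all_countable) blast
      then show ?thesis
      proof eventually_elim
        case (elim z)
        obtain n where "norm z < real n" using reals_Archimedean2 by blast
        with elim show ?case by auto
      qed
    qed
    have "AE z in lborel. f z \<bullet> e = 0" for e
      using half[of e] half[of "- e"] by eventually_elim simp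
    then have "AE z in lborel. \<forall>e\<in>Basis. f z \<bullet> e = 0"
      by (subst AE_ball_countable) (blast intro: countable_finite finite_Basis)+
    then have "AE z in lborel. f z = 0"
      by eventually_elim (simp add: euclidean_all_zero_iff)
    then show "m = 0" using f lsq_of_eq_iff[OF f(1) sq_integrable_zero] by (simp add: zero_lsq_def)
  qed (auto simp: subspace_transl_cont)
  then show ?thesis by (simp only: closure_closed[OF closed_transl_cont])
qed

definition corr :: "('a::euclidean_space \<Rightarrow> 'b::euclidean_space) \<Rightarrow> ('a \<Rightarrow> 'b) \<Rightarrow> 'a \<Rightarrow> real" where
  "corr u v s = (LINT z|lborel. u z \<bullet> v (z - s))"

text \<open>Continuity of translations in the mean, paired with a fixed function. This replaces all smoothness of the
  solution in the uniqueness proof, where the terms of the equation are correlations evaluated at small shifts.\<close>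

lemma continuous_on_corr:
  assumes u: "sq_integrable u" and v: "sq_integrable v"
  shows "continuous_on UNIV (corr u v)"
proof -
  have eq: "corr u v s = lsq_of u \<bullet> translate s (lsq_of v)" for s
    unfolding corr_def translate_lsq_of[OF v]
    by (rule inner_lsq_of[OF u sq_integrable_translate[OF v], symmetric])
  have "isCont (\<lambda>s. translate s (lsq_of v)) s" for s
  proof -
    have "((\<lambda>h. translate h (lsq_of v)) \<longlongrightarrow> lsq_of v) (at 0)"
    proof -
      have "lsq_of v \<in> transl_cont" by (simp add: transl_cont_UNIV)
      then show ?thesis by (simp add: transl_cont_def)
    qed
    note lim = this
    have "((\<lambda>h. translate (s + h) (lsq_of v)) \<longlongrightarrow> translate s (lsq_of v)) (at 0)"
    proof (rule tendstoI)
      fix e :: real assume "e > 0"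
      with lim have "\<forall>\<^sub>F h in at 0. dist (translate h (lsq_of v)) (lsq_of v) < e" by (rule tendstoD)
      then show "\<forall>\<^sub>F h in at 0. dist (translate (s + h) (lsq_of v)) (translate s (lsq_of v)) < e"
      proof eventually_elim
        case (elim h)
        have "dist (translate (s + h) (lsq_of v)) (translate s (lsq_of v)) = norm (translate s (translate h (lsq_of v) - lsq_of v))"
          by (simp only: dist_norm translate_diff translate_translate)
        with elim show ?case by (simp only: translate_norm dist_norm)
      qed
    qed
    then show ?thesis unfolding isCont_iff .
  qed
  then show ?thesis
    unfolding eq[abs_def] continuous_on_eq_continuous_at[OF open_UNIV]
    by (intro ballI continuous_inner continuous_const)
qed

section \<open>Mollification\<close>

lemma integral_reflect:
  fixes f :: "'a::euclidean_space \<Rightarrow> 'b::{banach, second_countable_topology}"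
  assumes [measurable]: "f \<in> borel_measurable borel"
  shows "(LINT z|lborel. f (s - z)) = (LINT z|lborel. f z)"
    and "integrable lborel (\<lambda>z. f (s - z)) \<longleftrightarrow> integrable lborel f"
proof -
  have eq: "lborel = distr lborel borel (\<lambda>z::'a. s + (-1) *\<^sub>R z)"
    using lborel_affine[of "-1::real" s] by (simp add: density_1)
  have "(LINT z|distr lborel borel (\<lambda>z::'a. s + (-1) *\<^sub>R z). f z) = (LINT z|lborel. f (s + (-1) *\<^sub>R z))"
    by (rule integral_distr) auto
  then show "(LINT z|lborel. f (s - z)) = (LINT z|lborel. f z)"
    unfolding eq[symmetric] by simp
  have "integrable (distr lborel borel (\<lambda>z::'a. s + (-1) *\<^sub>R z)) f \<longleftrightarrow> integrable lborel (\<lambda>z. f (s + (-1) *\<^sub>R z))"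
    by (rule integrable_distr_eq) auto
  then show "integrable lborel (\<lambda>z. f (s - z)) \<longleftrightarrow> integrable lborel f"
    unfolding eq[symmetric] by simp
qed

text \<open>The gradient is a parameter and is represented by a vector, so that product and convolution
  rules can be written as identities between functions.\<close>

definition C1_with :: "('a::real_inner \<Rightarrow> real) \<Rightarrow> ('a \<Rightarrow> 'a) \<Rightarrow> bool" where
  "C1_with y Dy \<longleftrightarrow> (\<forall>z. (y has_derivative (\<lambda>v. Dy z \<bullet> v)) (at z)) \<and> continuous_on UNIV Dy"

text \<open>A uniform second order Taylor bound is the smoothness class used for mollification, since it passes through
  convolution with an integrable function by integrating one inequality.\<close>

definition kernel :: "('a::real_inner \<Rightarrow> real) \<Rightarrow> ('a \<Rightarrow> 'a) \<Rightarrow> bool" where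
  "kernel k Dk \<longleftrightarrow> continuous_on UNIV k \<and> bounded (range k) \<and> continuous_on UNIV Dk \<and> bounded (range Dk) \<and>
     (\<exists>L. \<forall>z v. norm v \<le> 1 \<longrightarrow> \<bar>k (z + v) - k z - Dk z \<bullet> v\<bar> \<le> L * (norm v)\<^sup>2)"

lemma kernel_C1:
  assumes "kernel k Dk"
  shows "C1_with k Dk"
proof -
  obtain L where L: "\<And>z v. norm v \<le> 1 \<Longrightarrow> \<bar>k (z + v) - k z - Dk z \<bullet> v\<bar> \<le> L * (norm v)\<^sup>2"
    using assms unfolding kernel_def by blast
  have "(k has_derivative (\<lambda>v. Dk z \<bullet> v)) (at z)" for z
    unfolding has_derivative_at
  proof
    show "bounded_linear (\<lambda>v. Dk z \<bullet> v)" by (rule bounded_linear_inner_right)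
    show "(\<lambda>h. norm (k (z + h) - k z - Dk z \<bullet> h) / norm h) \<midarrow>0\<rightarrow> 0"
    proof (rule Lim_null_comparison)
      have "\<forall>\<^sub>F h in at (0::'a). dist h 0 < 1" unfolding eventually_at by (rule exI[of _ 1]) simp
      then show "\<forall>\<^sub>F h in at 0. norm (norm (k (z + h) - k z - Dk z \<bullet> h) / norm h) \<le> L * norm h"
      proof eventually_elim
        case (elim h)
        then have "\<bar>k (z + h) - k z - Dk z \<bullet> h\<bar> \<le> L * norm h * norm h"
          using L[of h z] by (simp add: power2_eq_square)
        then show ?case by (cases "h = 0") (simp_all add: divide_le_eq)
      qed
      show "(\<lambda>h. L * norm h) \<midarrow>0\<rightarrow> 0" by (auto intro!: tendsto_eq_intros)
    qed
  qed
  then show ?thesis using assms by (simp add: C1_with_def kernel_def)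
qed

lemma C1_with_continuous:
  assumes "C1_with y Dy"
  shows "continuous_on UNIV y"
  using assms unfolding C1_with_def
  by (intro differentiable_imp_continuous_on) (auto simp: differentiable_on_def differentiable_def)

lemma kernel_translate:
  assumes "kernel k Dk"
  shows "kernel (\<lambda>z. k (z - s)) (\<lambda>z. Dk (z - s))"
proof -
  obtain L where L: "\<And>z v. norm v \<le> 1 \<Longrightarrow> \<bar>k (z + v) - k z - Dk z \<bullet> v\<bar> \<le> L * (norm v)\<^sup>2"
    using assms unfolding kernel_def by blast
  have c: "continuous_on UNIV k" "continuous_on UNIV Dk" "bounded (range k)" "bounded (range Dk)"
    using assms by (auto simp: kernel_def)
  have "\<bar>k (z + v - s) - k (z - s) - Dk (z - s) \<bullet> v\<bar> \<le> L * (norm v)\<^sup>2" if "norm v \<le> 1" for z v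
    using L[OF that, of "z - s"] by (simp add: algebra_simps)
  moreover have "continuous_on UNIV (\<lambda>z. k (z - s))" "continuous_on UNIV (\<lambda>z. Dk (z - s))"
    by (auto intro!: continuous_on_compose2[OF c(1)] continuous_on_compose2[OF c(2)] continuous_intros)
  moreover have "bounded (range (\<lambda>z. k (z - s)))" "bounded (range (\<lambda>z. Dk (z - s)))"
    by (auto intro: bounded_subset[OF c(3)] bounded_subset[OF c(4)])
  ultimately show ?thesis unfolding kernel_def by blast
qed

lemma kernel_reflect:
  assumes "kernel k Dk"
  shows "kernel (\<lambda>z. k (- z)) (\<lambda>z. - Dk (- z))"
proof -
  obtain L where L: "\<And>z v. norm v \<le> 1 \<Longrightarrow> \<bar>k (z + v) - k z - Dk z \<bullet> v\<bar> \<le> L * (norm v)\<^sup>2"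
    using assms unfolding kernel_def by blast
  have c: "continuous_on UNIV k" "continuous_on UNIV Dk" "bounded (range k)" "bounded (range Dk)"
    using assms by (auto simp: kernel_def)
  have "\<bar>k (- (z + v)) - k (- z) - (- Dk (- z)) \<bullet> v\<bar> \<le> L * (norm v)\<^sup>2" if "norm v \<le> 1" for z v
    using L[of "- v" "- z"] that by simp
  moreover have "continuous_on UNIV (\<lambda>z. k (- z))" "continuous_on UNIV (\<lambda>z. - Dk (- z))"
    by (auto intro!: continuous_on_compose2[OF c(1)] continuous_on_compose2[OF c(2)] continuous_intros)
  moreover have "bounded (range (\<lambda>z. k (- z)))" "bounded (range (\<lambda>z. - Dk (- z)))"
    using c(3,4) by (auto simp: bounded_iff)
  ultimately show ?thesis unfolding kernel_def by blast
qed

text \<open>Being the square of a positive part, this is \<open>C\<^sup>1\<close> with Lipschitz gradient and explicit bounds. It serves as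
  cut-off and, unnormalised, as mollifier; its total mass cancels wherever it is used as an average.\<close>

definition bump :: "'a::real_inner \<Rightarrow> real \<Rightarrow> 'a \<Rightarrow> real" where
  "bump c r z = (max 0 (r\<^sup>2 - (norm (z - c))\<^sup>2))\<^sup>2"

definition bump_grad :: "'a::real_inner \<Rightarrow> real \<Rightarrow> 'a \<Rightarrow> 'a" where
  "bump_grad c r z = (- 4 * max 0 (r\<^sup>2 - (norm (z - c))\<^sup>2)) *\<^sub>R (z - c)"

lemma bump_nonneg [simp]: "0 \<le> bump c r z"
  by (simp add: bump_def)

lemma bump_pos_iff: "r > 0 \<Longrightarrow> 0 < bump c r z \<longleftrightarrow> norm (z - c) < r"
  by (auto simp: bump_def max_def abs_less_iff dest: power_mono[of r "norm (z - c)" 2]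
      intro: power_strict_mono)

lemma bump_eq_0: "r > 0 \<Longrightarrow> r \<le> norm (z - c) \<Longrightarrow> bump c r z = 0"
  using bump_pos_iff[of r c z] bump_nonneg[of c r z] by linarith

lemma bump_grad_eq_0:
  assumes "r > 0" "r \<le> norm (z - c)"
  shows "bump_grad c r z = 0"
  using power_mono[OF assms(2), of 2] assms(1) by (simp add: bump_grad_def)

lemma bump_le: "bump c r z \<le> r ^ 4"
proof -
  have "bump c r z \<le> (r\<^sup>2)\<^sup>2" unfolding bump_def by (intro power_mono) auto
  then show ?thesis by simp
qed

text \<open>The function \<open>(max 0 u)\<^sup>2\<close> has derivative \<open>2 max 0 u\<close>, which is Lipschitz with constant \<open>2\<close>.\<close>

lemma square_pos_part_taylor:
  fixes u \<delta> :: real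
  shows "\<bar>(max 0 (u + \<delta>))\<^sup>2 - (max 0 u)\<^sup>2 - 2 * max 0 u * \<delta>\<bar> \<le> \<delta>\<^sup>2"
proof (cases "u \<ge> 0"; cases "u + \<delta> \<ge> 0")
  assume "u \<ge> 0" "\<not> u + \<delta> \<ge> 0"
  then have "0 \<le> u" "u \<le> - \<delta>" by auto
  then have "u * (u + \<delta>) \<le> 0" "u * \<delta> \<le> 0"
    by (auto intro: mult_nonneg_nonpos)
  moreover have "0 \<le> (u + \<delta>)\<^sup>2" "0 \<le> \<delta>\<^sup>2" by simp_all
  ultimately have "\<bar>0 - u\<^sup>2 - 2 * u * \<delta>\<bar> \<le> \<delta>\<^sup>2"
    unfolding abs_le_iff by (simp add: power2_eq_square algebra_simps)
  then show ?thesis using \<open>u \<ge> 0\<close> \<open>\<not> u + \<delta> \<ge> 0\<close> by simp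
next
  assume "\<not> u \<ge> 0" "u + \<delta> \<ge> 0"
  then have "(u + \<delta>)\<^sup>2 \<le> \<delta>\<^sup>2" by (intro power_mono) auto
  then show ?thesis using \<open>\<not> u \<ge> 0\<close> \<open>u + \<delta> \<ge> 0\<close> by simp
qed (auto simp: power2_eq_square algebra_simps)

text \<open>Inserting \<open>u = r\<^sup>2 - \<parallel>z - c\<parallel>\<^sup>2\<close> into the scalar Taylor bound leaves only terms of second order in \<open>v\<close>,
  and they are bounded because the bump vanishes far from \<open>c\<close>.\<close>

lemma bump_kernel:
  assumes r: "r > 0"
  shows "kernel (bump c r) (bump_grad c r)"
proof -
  have cont: "continuous_on UNIV (bump c r)" "continuous_on UNIV (bump_grad c r)"
    unfolding bump_def[abs_def] bump_grad_def[abs_def] by (intro continuous_intros)+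
  have b1: "bounded (range (bump c r))"
    by (rule boundedI[of _ "r ^ 4"]) (auto simp: bump_le)
  have "norm (bump_grad c r z) \<le> 4 * r\<^sup>2 * r" for z
  proof (cases "norm (z - c) < r")
    case True
    have "norm (bump_grad c r z) = 4 * max 0 (r\<^sup>2 - (norm (z - c))\<^sup>2) * norm (z - c)"
      by (simp add: bump_grad_def)
    also have "\<dots> \<le> 4 * r\<^sup>2 * r" using True r by (intro mult_mono) auto
    finally show ?thesis .
  qed (use r in \<open>simp add: bump_grad_eq_0\<close>)
  then have b2: "bounded (range (bump_grad c r))" by (auto intro: boundedI)
  define L where "L = (2 * (r + 1) + 1)\<^sup>2 + 2 * r\<^sup>2"
  have "\<bar>bump c r (z + v) - bump c r z - bump_grad c r z \<bullet> v\<bar> \<le> L * (norm v)\<^sup>2" if v: "norm v \<le> 1" for z v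
  proof (cases "norm (z - c) \<le> r + 1")
    case True
    define u where "u = r\<^sup>2 - (norm (z - c))\<^sup>2"
    define \<delta> where "\<delta> = - 2 * ((z - c) \<bullet> v) - (norm v)\<^sup>2"
    have "(norm (z + v - c))\<^sup>2 = (norm (z - c))\<^sup>2 + 2 * ((z - c) \<bullet> v) + (norm v)\<^sup>2"
      by (simp add: power2_norm_eq_inner inner_diff_left inner_diff_right inner_add_left inner_add_right inner_commute)
    then have e1: "bump c r (z + v) = (max 0 (u + \<delta>))\<^sup>2" by (simp add: bump_def u_def \<delta>_def algebra_simps)
    have e2: "bump c r z = (max 0 u)\<^sup>2" by (simp add: bump_def u_def)
    have e3: "bump_grad c r z \<bullet> v = 2 * max 0 u * \<delta> + 2 * max 0 u * (norm v)\<^sup>2"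
      by (simp add: bump_grad_def u_def \<delta>_def algebra_simps)
    have "\<bar>\<delta>\<bar> \<le> 2 * \<bar>(z - c) \<bullet> v\<bar> + (norm v)\<^sup>2" unfolding \<delta>_def by (simp add: abs_if)
    also have "\<dots> \<le> 2 * ((r + 1) * norm v) + 1 * norm v"
    proof (intro add_mono mult_left_mono)
      show "\<bar>(z - c) \<bullet> v\<bar> \<le> (r + 1) * norm v"
        using Cauchy_Schwarz_ineq2[of "z - c" v] mult_right_mono[OF True norm_ge_zero[of v]] by linarith
      show "(norm v)\<^sup>2 \<le> 1 * norm v" using v unfolding power2_eq_square by (intro mult_right_mono) auto
    qed simp
    finally have "\<bar>\<delta>\<bar> \<le> (2 * (r + 1) + 1) * norm v" by (simp add: algebra_simps)
    then have "\<delta>\<^sup>2 \<le> ((2 * (r + 1) + 1) * norm v)\<^sup>2" using r by (intro abs_le_square_iff[THEN iffD1]) simp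
    then have d2: "\<delta>\<^sup>2 \<le> (2 * (r + 1) + 1)\<^sup>2 * (norm v)\<^sup>2" by (simp only: power_mult_distrib)
    have "2 * max 0 u * (norm v)\<^sup>2 \<le> 2 * r\<^sup>2 * (norm v)\<^sup>2"
      unfolding u_def by (intro mult_right_mono mult_left_mono) auto
    moreover have "0 \<le> 2 * max 0 u * (norm v)\<^sup>2" by simp
    ultimately show ?thesis
      using square_pos_part_taylor[of u \<delta>] d2 unfolding e1 e2 e3 L_def distrib_right abs_le_iff by linarith
  next
    case False
    have "norm (z - c) \<le> norm (z + v - c) + norm v"
      using norm_triangle_ineq4[of "z + v - c" v] by (simp add: algebra_simps)
    then have "r \<le> norm (z + v - c)" "r \<le> norm (z - c)" using False v by auto
    then have "bump c r (z + v) = 0" "bump c r z = 0" "bump_grad c r z = 0"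
      using r by (auto intro: bump_eq_0 bump_grad_eq_0)
    then show ?thesis by (simp add: L_def)
  qed
  then show ?thesis using cont b1 b2 unfolding kernel_def by blast
qed

lemma integrable_bounded_support:
  fixes f :: "'a::euclidean_space \<Rightarrow> 'b::euclidean_space"
  assumes f: "f \<in> borel_measurable borel" and b: "\<And>z. norm (f z) \<le> B" and s: "\<And>z. R < norm z \<Longrightarrow> f z = 0"
  shows "integrable lborel f"
proof (rule Bochner_Integration.integrable_bound)
  show "integrable lborel (\<lambda>z::'a. indicator (cball 0 R) z * B)"
    using emeasure_lborel_cball_finite[of "0::'a" R]
    by (intro integrable_mult_left) (simp add: integrable_indicator_iff)
  have "norm (f z) \<le> norm (indicator (cball 0 R) z * B)" for z
    using b[of z] s[of z] by (cases "norm z \<le> R") (auto simp: abs_if dest: order_trans[OF norm_ge_zero])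
  then show "AE z in lborel. norm (f z) \<le> norm (indicator (cball 0 R) z * B)" by simp
qed (use f in simp)

lemma bump_measurable [measurable]:
  fixes c :: "'a::euclidean_space"
  shows "bump c r \<in> borel_measurable borel"
  unfolding bump_def[abs_def] by measurable

lemma bump_integrable:
  fixes c :: "'a::euclidean_space"
  assumes r: "r > 0"
  shows "integrable lborel (bump c r)"
proof (rule integrable_bounded_support[where R = "norm c + r" and B = "r ^ 4"])
  fix z :: 'a assume "norm c + r < norm z"
  then have "r \<le> norm (z - c)" using norm_triangle_ineq2[of z c] by linarith
  then show "bump c r z = 0" using r by (rule bump_eq_0[rotated])
qed (auto simp: bump_le)

lemma bump_integral_pos:
  fixes c :: "'a::euclidean_space"
  assumes r: "r > 0"
  shows "0 < (LINT z|lborel. bump c r z)"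
proof -
  have "(LINT z|lborel. bump c r z) \<noteq> 0"
  proof
    assume "(LINT z|lborel. bump c r z) = 0"
    then have "AE z in lborel. bump c r z = 0"
      using integral_nonneg_eq_0_iff_AE[OF bump_integrable[OF r, of c]] by simp
    then have "AE z in lborel. z \<notin> ball c r"
    proof eventually_elim
      case (elim z)
      then show ?case using bump_pos_iff[OF r, of c z] by (auto simp: dist_norm norm_minus_commute)
    qed
    then have "emeasure lborel (ball c r) = 0"
      using emeasure_eq_0_AE[of "\<lambda>z. z \<in> ball c r" lborel] by (simp del: mem_ball)
    then have "measure lborel (ball c r) = 0" by (simp add: measure_def)
    then show False using content_ball_pos[OF r, of c] by simp
  qed
  moreover have "0 \<le> (LINT z|lborel. bump c r z)" by simp
  ultimately show ?thesis by linarith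
qed

lemma bump_average_bounds:
  fixes A :: "'a::euclidean_space \<Rightarrow> real"
  assumes r: "r > 0" and A: "A \<in> borel_measurable borel"
    and lo: "\<And>w. norm w < r \<Longrightarrow> l \<le> A w" and hi: "\<And>w. norm w < r \<Longrightarrow> A w \<le> h"
  shows "(LINT w|lborel. bump (0::'a) r w) * l \<le> (LINT w|lborel. bump 0 r w * A w)"
    and "(LINT w|lborel. bump 0 r w * A w) \<le> (LINT w|lborel. bump (0::'a) r w) * h"
proof -
  have i: "integrable lborel (\<lambda>w::'a. bump 0 r w * c)" for c :: real
    using bump_integrable[OF r, of "0::'a"] by simp
  have out: "bump 0 r w = 0" if "\<not> norm w < r" for w :: 'a using bump_eq_0[OF r, of w 0] that by simp
  have iA: "integrable lborel (\<lambda>w. bump 0 r w * A w)"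
  proof (rule Bochner_Integration.integrable_bound[OF i[of "\<bar>l\<bar> + \<bar>h\<bar>"]])
    show "(\<lambda>w. bump 0 r w * A w) \<in> borel_measurable lborel" using A by simp
    have "norm (bump 0 r w * A w) \<le> norm (bump 0 r w * (\<bar>l\<bar> + \<bar>h\<bar>))" for w
    proof (cases "norm w < r")
      case True
      then have "\<bar>A w\<bar> \<le> \<bar>l\<bar> + \<bar>h\<bar>" using lo[OF True] hi[OF True] by linarith
      then show ?thesis by (simp add: abs_mult mult_left_mono)
    qed (simp add: out)
    then show "AE w in lborel. norm (bump 0 r w * A w) \<le> norm (bump 0 r w * (\<bar>l\<bar> + \<bar>h\<bar>))" by simp
  qed
  have "bump 0 r w * l \<le> bump 0 r w * A w \<and> bump 0 r w * A w \<le> bump 0 r w * h" for w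
    using lo[of w] hi[of w] out[of w] by (cases "norm w < r") (auto intro: mult_left_mono)
  then show "(LINT w|lborel. bump (0::'a) r w) * l \<le> (LINT w|lborel. bump 0 r w * A w)"
    "(LINT w|lborel. bump 0 r w * A w) \<le> (LINT w|lborel. bump (0::'a) r w) * h"
    using integral_mono[OF i[of l] iA] integral_mono[OF iA i[of h]] by simp_all
qed

text \<open>The scalar factor is the function and the kernel may be vector valued, so that a convolution and
  its gradient are instances of the same operation.\<close>

definition conv :: "('a::euclidean_space \<Rightarrow> 'b::euclidean_space) \<Rightarrow> ('a \<Rightarrow> real) \<Rightarrow> 'a \<Rightarrow> 'b" where
  "conv k f z = (LINT w|lborel. f w *\<^sub>R k (z - w))"

lemma conv_integrable:
  fixes k :: "'a::euclidean_space \<Rightarrow> 'b::euclidean_space"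
  assumes f: "integrable lborel f" and k: "continuous_on UNIV k" and b: "\<And>z. norm (k z) \<le> B"
  shows "integrable lborel (\<lambda>w. f w *\<^sub>R k (z - w))"
proof (rule Bochner_Integration.integrable_bound)
  show "integrable lborel (\<lambda>w. \<bar>f w\<bar> * B)" using f by simp
  have [measurable]: "k \<in> borel_measurable borel" using k by (rule borel_measurable_continuous_onI)
  have [measurable]: "f \<in> borel_measurable borel" using borel_measurable_integrable[OF f] by simp
  show "(\<lambda>w. f w *\<^sub>R k (z - w)) \<in> borel_measurable lborel" by measurable
  have "norm (f w *\<^sub>R k (z - w)) \<le> norm (\<bar>f w\<bar> * B)" for w
    using mult_left_mono[OF b[of "z - w"], of "\<bar>f w\<bar>"] by (simp add: abs_mult) (smt (verit) abs_ge_self abs_ge_zero mult_left_mono)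
  then show "AE w in lborel. norm (f w *\<^sub>R k (z - w)) \<le> norm (\<bar>f w\<bar> * B)" by simp
qed

lemma conv_bound:
  fixes k :: "'a::euclidean_space \<Rightarrow> 'b::euclidean_space"
  assumes f: "integrable lborel f" and k: "continuous_on UNIV k" and b: "\<And>z. norm (k z) \<le> B"
  shows "norm (conv k f z) \<le> (LINT w|lborel. \<bar>f w\<bar>) * B"
proof -
  have "norm (conv k f z) \<le> (LINT w|lborel. \<bar>f w\<bar> * B)"
    unfolding conv_def
    by (rule Bochner_Integration.integral_norm_bound_integral[OF conv_integrable[OF f k b]])
      (use f b in \<open>auto intro: mult_left_mono\<close>)
  then show ?thesis by simp
qed

lemma conv_continuous:
  fixes k :: "'a::euclidean_space \<Rightarrow> 'b::euclidean_space"
  assumes f: "integrable lborel f" and k: "continuous_on UNIV k" and b: "\<And>z. norm (k z) \<le> B"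
  shows "continuous_on UNIV (conv k f)"
  unfolding continuous_on_sequentially
proof (intro ballI allI impI)
  fix s :: "nat \<Rightarrow> 'a" and z assume "(\<forall>n. s n \<in> UNIV) \<and> s \<longlonglongrightarrow> z"
  then have s: "s \<longlonglongrightarrow> z" by simp
  have [measurable]: "k \<in> borel_measurable borel" using k by (rule borel_measurable_continuous_onI)
  have [measurable]: "f \<in> borel_measurable borel" using borel_measurable_integrable[OF f] by simp
  show "(conv k f \<circ> s) \<longlonglongrightarrow> conv k f z"
    unfolding conv_def o_def
  proof (rule integral_dominated_convergence[where w = "\<lambda>w. \<bar>f w\<bar> * B"])
    show "integrable lborel (\<lambda>w. \<bar>f w\<bar> * B)" using f by simp
    show "AE w in lborel. (\<lambda>n. f w *\<^sub>R k (s n - w)) \<longlonglongrightarrow> f w *\<^sub>R k (z - w)"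
    proof (rule AE_I2)
      fix w
      have "isCont k (z - w)" using k by (simp add: continuous_on_eq_continuous_at)
      moreover have "(\<lambda>n. s n - w) \<longlonglongrightarrow> z - w" by (intro tendsto_intros s)
      ultimately show "(\<lambda>n. f w *\<^sub>R k (s n - w)) \<longlonglongrightarrow> f w *\<^sub>R k (z - w)"
        by (intro tendsto_intros) (rule isCont_tendsto_compose)
    qed
    show "AE w in lborel. norm (f w *\<^sub>R k (s n - w)) \<le> \<bar>f w\<bar> * B" for n
      by (rule AE_I2) (simp add: b mult_left_mono)
  qed measurable
qed

lemma kernel_conv:
  fixes k :: "'a::euclidean_space \<Rightarrow> real"
  assumes f: "integrable lborel f" and k: "kernel k Dk"
  shows "kernel (conv k f) (conv Dk f)"
proof -
  obtain L where L: "\<And>z v. norm v \<le> 1 \<Longrightarrow> \<bar>k (z + v) - k z - Dk z \<bullet> v\<bar> \<le> L * (norm v)\<^sup>2"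
    using k unfolding kernel_def by blast
  have c: "continuous_on UNIV k" "continuous_on UNIV Dk" using k by (auto simp: kernel_def)
  obtain B where B: "\<And>z. norm (k z) \<le> B" using k by (auto simp: kernel_def bounded_iff)
  obtain B' where B': "\<And>z. norm (Dk z) \<le> B'" using k by (auto simp: kernel_def bounded_iff)
  note i1 = conv_integrable[OF f c(1) B] and i2 = conv_integrable[OF f c(2) B']
  have "\<bar>conv k f (z + v) - conv k f z - conv Dk f z \<bullet> v\<bar> \<le> ((LINT w|lborel. \<bar>f w\<bar>) * L) * (norm v)\<^sup>2"
    if v: "norm v \<le> 1" for z v
  proof -
    have i3: "integrable lborel (\<lambda>w. (f w *\<^sub>R Dk (z - w)) \<bullet> v)" using i2 by (rule integrable_inner_left)
    have "conv k f (z + v) - conv k f z - conv Dk f z \<bullet> v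
        = (LINT w|lborel. f w *\<^sub>R k (z + v - w) - f w *\<^sub>R k (z - w) - (f w *\<^sub>R Dk (z - w)) \<bullet> v)"
    proof -
      have "conv Dk f z \<bullet> v = (LINT w|lborel. (f w *\<^sub>R Dk (z - w)) \<bullet> v)"
        unfolding conv_def by (rule integral_inner_left[symmetric]) (rule i2)
      then show ?thesis
        unfolding conv_def[of k]
        by (simp only: Bochner_Integration.integral_diff[OF Bochner_Integration.integrable_diff[OF i1[of "z + v"] i1[of z]] i3]
            Bochner_Integration.integral_diff[OF i1[of "z + v"] i1[of z]])
    qed
    also have "norm \<dots> \<le> (LINT w|lborel. \<bar>f w\<bar> * (L * (norm v)\<^sup>2))"
    proof (rule Bochner_Integration.integral_norm_bound_integral)
      show "integrable lborel (\<lambda>w. f w *\<^sub>R k (z + v - w) - f w *\<^sub>R k (z - w) - (f w *\<^sub>R Dk (z - w)) \<bullet> v)"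
        using i1[of "z + v"] i1[of z] i3 by (intro Bochner_Integration.integrable_diff)
      fix w
      have "f w *\<^sub>R k (z + v - w) - f w *\<^sub>R k (z - w) - (f w *\<^sub>R Dk (z - w)) \<bullet> v
          = f w * (k ((z - w) + v) - k (z - w) - Dk (z - w) \<bullet> v)"
        by (simp add: algebra_simps)
      then show "norm (f w *\<^sub>R k (z + v - w) - f w *\<^sub>R k (z - w) - (f w *\<^sub>R Dk (z - w)) \<bullet> v) \<le> \<bar>f w\<bar> * (L * (norm v)\<^sup>2)"
        using L[OF v, of "z - w"] by (simp add: abs_mult mult_left_mono)
    qed (use f in simp)
    finally show ?thesis by (simp add: mult_ac)
  qed
  moreover have "bounded (range (conv k f))" "bounded (range (conv Dk f))"
    using conv_bound[OF f c(1) B] conv_bound[OF f c(2) B'] by (auto intro!: boundedI)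
  ultimately show ?thesis
    using conv_continuous[OF f c(1) B] conv_continuous[OF f c(2) B'] unfolding kernel_def by blast
qed

lemma sq_integrable_imp_integrable:
  assumes f: "sq_integrable f" and s: "\<And>z. R < norm z \<Longrightarrow> f z = 0"
  shows "integrable lborel f"
proof (rule Bochner_Integration.integrable_bound)
  show "integrable lborel (\<lambda>z. indicator (cball 0 R) z + (norm (f z))\<^sup>2 :: real)"
    using f emeasure_lborel_cball_finite[of "0::'a" R]
    by (intro Bochner_Integration.integrable_add) (simp_all add: sq_integrable_def integrable_indicator_iff)
  show "f \<in> borel_measurable lborel" using f by (simp add: sq_integrable_def)
  have "norm (f z) \<le> indicator (cball 0 R) z + (norm (f z))\<^sup>2" for z
  proof (cases "norm z \<le> R")
    case True
    have "0 \<le> (norm (f z) - 1)\<^sup>2" by simp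
    then have "2 * norm (f z) \<le> 1 + (norm (f z))\<^sup>2" by (simp add: power2_eq_square algebra_simps)
    moreover have "0 \<le> norm (f z)" by simp
    ultimately have "norm (f z) \<le> 1 + (norm (f z))\<^sup>2" by linarith
    then show ?thesis using True by simp
  qed (simp add: s)
  then show "AE z in lborel. norm (f z) \<le> norm (indicator (cball 0 R) z + (norm (f z))\<^sup>2 :: real)"
    by (intro AE_I2) (auto intro: order_trans[OF _ abs_ge_self])
qed

text \<open>Here the kernel is scalar and the function may be vector valued, as is the case for the flux.\<close>

definition mollify :: "('a::euclidean_space \<Rightarrow> real) \<Rightarrow> ('a \<Rightarrow> 'b::euclidean_space) \<Rightarrow> 'a \<Rightarrow> 'b" where
  "mollify k f z = (LINT w|lborel. k (z - w) *\<^sub>R f w)"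

lemma mollify_real: "mollify k f = conv k f"
  by (simp add: mollify_def conv_def fun_eq_iff mult.commute)

text \<open>By Fubini's theorem, pairing with a shifted mollification is an average of correlations over shifts
  close to \<open>s\<close>.\<close>

lemma mollify_correlation:
  fixes u F :: "'a::euclidean_space \<Rightarrow> 'b::euclidean_space"
  assumes u: "sq_integrable u" and F: "sq_integrable F" "integrable lborel F" and r: "r > 0"
  shows "(LINT z|lborel. u z \<bullet> mollify (bump 0 r) F (z - s)) = (LINT w|lborel. bump 0 r w * corr u F (s + w))"
proof -
  have [measurable]: "u \<in> borel_measurable borel" "F \<in> borel_measurable borel"
    using u F by (auto simp: sq_integrable_def)
  define h where "h w z = bump 0 r w * (u z \<bullet> F (z - (s + w)))" for w z
  have hm [measurable]: "case_prod h \<in> borel_measurable (lborel \<Otimes>\<^sub>M lborel)"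
    unfolding h_def by measurable
  have hz: "integrable lborel (\<lambda>z. h w z)" for w
    unfolding h_def by (intro integrable_mult_right sq_integrable_inner u sq_integrable_translate F)
  \<comment> \<open>a bound for the inner integral that does not depend on \<open>w\<close>, as translations preserve the norm\<close>
  define C where "C = (LINT z|lborel. (norm (u z))\<^sup>2) + (LINT z|lborel. (norm (F z))\<^sup>2)"
  have bnd: "(LINT z|lborel. norm (h w z)) \<le> bump 0 r w * C" for w
  proof -
    have "(LINT z|lborel. norm (h w z)) \<le> (LINT z|lborel. bump 0 r w * ((norm (u z))\<^sup>2 + (norm (F (z - (s + w))))\<^sup>2))"
    proof (rule integral_mono)
      show "integrable lborel (\<lambda>z. norm (h w z))" using hz by (rule integrable_norm)
      show "integrable lborel (\<lambda>z. bump 0 r w * ((norm (u z))\<^sup>2 + (norm (F (z - (s + w))))\<^sup>2))"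
        using u sq_integrable_translate[OF F(1), of "s + w"]
        by (intro integrable_mult_right Bochner_Integration.integrable_add) (simp_all add: sq_integrable_def)
      fix z
      define a b where "a = norm (u z)" and "b = norm (F (z - (s + w)))"
      have "\<bar>u z \<bullet> F (z - (s + w))\<bar> \<le> a * b" unfolding a_def b_def by (rule Cauchy_Schwarz_ineq2)
      moreover have "2 * (a * b) \<le> a\<^sup>2 + b\<^sup>2" using sum_squares_bound[of a b] by (simp add: mult_ac)
      moreover have "0 \<le> a * b" by (simp add: a_def b_def)
      ultimately have "\<bar>u z \<bullet> F (z - (s + w))\<bar> \<le> a\<^sup>2 + b\<^sup>2" by linarith
      then show "norm (h w z) \<le> bump 0 r w * ((norm (u z))\<^sup>2 + (norm (F (z - (s + w))))\<^sup>2)"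
        unfolding h_def a_def b_def by (simp add: abs_mult mult_left_mono)
    qed
    also have "\<dots> = bump 0 r w * C"
      using u F(1) sq_integrable_translate[OF F(1), of "s + w"] integral_translate(1)[of "\<lambda>z. (norm (F z))\<^sup>2" "s + w"]
      by (simp add: C_def sq_integrable_def)
    finally show ?thesis .
  qed
  have int: "integrable (lborel \<Otimes>\<^sub>M lborel) (case_prod h)"
  proof (rule lborel_pair.Fubini_integrable)
    show "integrable lborel (\<lambda>w. LINT z|lborel. norm (case_prod h (w, z)))"
    proof (rule Bochner_Integration.integrable_bound)
      show "integrable lborel (\<lambda>w::'a. bump 0 r w * C)" using bump_integrable[OF r, of "0::'a"] by simp
      have "(\<lambda>w. LINT z|lborel. norm (h w z)) \<in> borel_measurable lborel"
        unfolding h_def by measurable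
      then show "(\<lambda>w. LINT z|lborel. norm (case_prod h (w, z))) \<in> borel_measurable lborel" by simp
      have "norm (LINT z|lborel. norm (h w z)) \<le> norm (bump 0 r w * C)" for w
      proof -
        have "0 \<le> (LINT z|lborel. norm (h w z))" by simp
        then show ?thesis using bnd[of w] unfolding real_norm_def by linarith
      qed
      then show "AE w in lborel. norm (LINT z|lborel. norm (case_prod h (w, z))) \<le> norm (bump 0 r w * C)"
        by simp
    qed
    show "AE w in lborel. integrable lborel (\<lambda>z. case_prod h (w, z))" using hz by simp
  qed (rule hm)
  have "u z \<bullet> mollify (bump 0 r) F (z - s) = (LINT w|lborel. h w z)" for z
  proof -
    have m: "(\<lambda>w. bump 0 r w *\<^sub>R F (z - s - w)) \<in> borel_measurable borel" by measurable
    have "mollify (bump 0 r) F (z - s) = (LINT w|lborel. bump 0 r w *\<^sub>R F (z - s - w))"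
      unfolding mollify_def using integral_reflect(1)[OF m, of "z - s"] by simp
    moreover have "integrable lborel (\<lambda>w. bump 0 r w *\<^sub>R F (z - s - w))"
    proof (rule Bochner_Integration.integrable_bound)
      show "integrable lborel (\<lambda>w. r ^ 4 *\<^sub>R F (z - s - w))"
        using integral_reflect(2)[of F "z - s"] F(2) by simp
      have "norm (bump 0 r w *\<^sub>R F (z - s - w)) \<le> norm (r ^ 4 *\<^sub>R F (z - s - w))" for w
        using bump_le[of 0 r w] by (simp add: mult_right_mono)
      then show "AE w in lborel. norm (bump 0 r w *\<^sub>R F (z - s - w)) \<le> norm (r ^ 4 *\<^sub>R F (z - s - w))" by simp
    qed (use m in simp)
    ultimately have "u z \<bullet> mollify (bump 0 r) F (z - s) = (LINT w|lborel. u z \<bullet> (bump 0 r w *\<^sub>R F (z - s - w)))"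
      by (simp only: integral_inner_right)
    then show ?thesis by (simp add: h_def algebra_simps)
  qed
  then have "(LINT z|lborel. u z \<bullet> mollify (bump 0 r) F (z - s)) = (LINT z|lborel. LINT w|lborel. h w z)" by simp
  also have "\<dots> = (LINT w|lborel. LINT z|lborel. h w z)" by (rule lborel_pair.Fubini_integral[OF int])
  also have "\<dots> = (LINT w|lborel. bump 0 r w * corr u F (s + w))" by (simp add: h_def corr_def)
  finally show ?thesis .
qed

text \<open>The time derivative of mollified \<open>R\<close> is mollified \<open>A\<close>, but only along lines displaced by \<open>\<epsilon> e\<close> and
  for times larger than the radius \<open>r\<close> of the mollifier. If \<open>A (0, 0)\<close> were positive, then \<open>A\<close> would be bounded below near the
  origin, and the mean value theorem along such a line would make \<open>R\<close> increase by a definite amount between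
  a time close to \<open>0\<close> and the time \<open>h\<close>. Choosing \<open>\<epsilon>\<close> and \<open>r\<close> small
  transfers this by continuity to \<open>R (0, h) > R (0, 0)\<close>, against the hypothesis.\<close>

lemma one_sided_rate_nonpos:
  fixes R A :: "'x::euclidean_space \<times> real \<Rightarrow> real" and e :: 'x
  assumes R: "continuous_on UNIV R" and A: "continuous_on UNIV A" and \<epsilon>0: "\<epsilon>0 > 0"
    and deriv: "\<And>\<epsilon>. 0 < \<epsilon> \<Longrightarrow> \<epsilon> < \<epsilon>0 \<Longrightarrow> \<exists>r0>0. \<forall>r t. 0 < r \<and> r < r0 \<and> r < t \<longrightarrow>
        ((\<lambda>t. LINT w|lborel. bump 0 r w * R ((\<epsilon> *\<^sub>R e, t) + w)) has_real_derivative
          (LINT w|lborel. bump 0 r w * A ((\<epsilon> *\<^sub>R e, t) + w))) (at t)"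
    and le: "\<And>h. h > 0 \<Longrightarrow> R (0, h) \<le> R (0, 0)"
  shows "A (0, 0) \<le> 0"
proof (rule ccontr)
  assume "\<not> A (0, 0) \<le> 0"
  define a where "a = A (0, 0)"
  have a: "a > 0" using \<open>\<not> A (0, 0) \<le> 0\<close> by (simp add: a_def)
  have "isCont A (0, 0)" using A by (simp add: continuous_on_eq_continuous_at)
  then obtain \<rho> where \<rho>: "\<rho> > 0" "\<And>s. dist s (0, 0) < \<rho> \<Longrightarrow> dist (A s) a < a / 2"
    using a unfolding continuous_at_eps_delta a_def by (metis half_gt_zero)
  have Alow: "a / 2 \<le> A s" if "norm s < \<rho>" for s
    using \<rho>(2)[of s] that by (simp add: dist_norm zero_prod_def[symmetric] abs_if split: if_splits)
  \<comment> \<open>the whole segment up to time \<open>h\<close>, enlarged by the shift and the mollifier, lies in the ball where \<open>A \<ge> a / 2\<close>\<close>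
  define h where "h = \<rho> / 4"
  have h: "h > 0" using \<rho> by (simp add: h_def)
  \<comment> \<open>the gain is at least \<open>h / 2 * a / 2 = 4 \<eta>\<close>, the errors at the two ends are \<open>\<eta>\<close> each\<close>
  define \<eta> where "\<eta> = a * h / 16"
  have \<eta>: "\<eta> > 0" using a h by (simp add: \<eta>_def)
  have "isCont R (0, h)" "isCont R (0, 0)" using R by (simp_all add: continuous_on_eq_continuous_at)
  then obtain \<delta>1 \<delta>0 where \<delta>1: "\<delta>1 > 0" "\<And>s. dist s (0, h) < \<delta>1 \<Longrightarrow> dist (R s) (R (0, h)) < \<eta>"
    and \<delta>0: "\<delta>0 > 0" "\<And>s. dist s (0, 0) < \<delta>0 \<Longrightarrow> dist (R s) (R (0, 0)) < \<eta>"
    using \<eta> unfolding continuous_at_eps_delta by metis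
  define \<delta> where "\<delta> = Min {\<rho> / 4, \<delta>0, \<delta>1}"
  have \<delta>: "\<delta> > 0" "\<delta> \<le> \<rho> / 4" "\<delta> \<le> \<delta>0" "\<delta> \<le> \<delta>1"
    using \<rho>(1) \<delta>0(1) \<delta>1(1) by (auto simp: \<delta>_def)
  define \<epsilon> where "\<epsilon> = min (\<epsilon>0 / 2) (\<delta> / (4 * (norm e + 1)))"
  have ne: "norm e + 1 > 0" by (simp add: add_nonneg_pos)
  have \<epsilon>: "\<epsilon> > 0" "\<epsilon> < \<epsilon>0" using \<epsilon>0 \<delta>(1) ne by (auto simp: \<epsilon>_def)
  have "norm (\<epsilon> *\<^sub>R e) = \<epsilon> * norm e" using \<epsilon> by simp
  also have "\<dots> \<le> \<epsilon> * (norm e + 1)" using \<epsilon> by simp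
  also have "\<dots> \<le> \<delta> / (4 * (norm e + 1)) * (norm e + 1)" using ne by (intro mult_right_mono) (auto simp: \<epsilon>_def)
  also have "\<dots> = \<delta> / 4" using ne by (simp add: field_simps)
  finally have \<epsilon>e: "norm (\<epsilon> *\<^sub>R e) \<le> \<delta> / 4" .
  obtain r0 where r0: "r0 > 0" and D: "\<And>r t. 0 < r \<Longrightarrow> r < r0 \<Longrightarrow> r < t \<Longrightarrow>
        ((\<lambda>t. LINT w|lborel. bump 0 r w * R ((\<epsilon> *\<^sub>R e, t) + w)) has_real_derivative
          (LINT w|lborel. bump 0 r w * A ((\<epsilon> *\<^sub>R e, t) + w))) (at t)"
    using deriv[OF \<epsilon>] by blast
  define r where "r = min (r0 / 2) (\<delta> / 8)"
  have r: "r > 0" "r < r0" "r \<le> \<delta> / 8" using r0 \<delta>(1) by (auto simp: r_def)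
  define t1 where "t1 = \<delta> / 4"
  have t1: "r < t1" "t1 < h / 2" using r \<delta> h_def by (auto simp: t1_def)
  define H where "H t = (LINT w|lborel. bump 0 r w * R ((\<epsilon> *\<^sub>R e, t) + w))" for t
  define H' where "H' t = (LINT w|lborel. bump 0 r w * A ((\<epsilon> *\<^sub>R e, t) + w))" for t
  define m where "m = (LINT w|lborel. bump (0::'x \<times> real) r w)"
  have m: "m > 0" unfolding m_def by (rule bump_integral_pos[OF r(1)])
  have meas: "(\<lambda>w. R (s + w)) \<in> borel_measurable borel" "(\<lambda>w. A (s + w)) \<in> borel_measurable borel" for s
    by (auto intro!: borel_measurable_continuous_onI continuous_on_compose2[OF R] continuous_on_compose2[OF A] continuous_intros)
  have nrm: "norm ((\<epsilon> *\<^sub>R e, t) + w) \<le> \<delta> / 4 + \<bar>t\<bar> + norm w" for t w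
    using norm_triangle_ineq[of "(\<epsilon> *\<^sub>R e, t)" w] norm_Pair_le[of "\<epsilon> *\<^sub>R e" t] \<epsilon>e by simp
  have "\<exists>t>t1. t < h \<and> H h - H t1 = (h - t1) * H' t"
    by (rule MVT2) (use t1 h r D in \<open>auto simp: H_def[abs_def] H'_def\<close>)
  then obtain t where t: "t1 < t" "t < h" "H h - H t1 = (h - t1) * H' t" by blast
  have "m * (a / 2) \<le> H' t"
    unfolding m_def H'_def
  proof (rule bump_average_bounds(1)[OF r(1) meas(2), where h = "SUP w\<in>cball 0 r. A ((\<epsilon> *\<^sub>R e, t) + w)"])
    fix w :: "'x \<times> real" assume w: "norm w < r"
    have "norm ((\<epsilon> *\<^sub>R e, t) + w) < \<rho>" using nrm[of t w] w t t1 r \<delta> h_def \<rho>(1) by (auto simp: t1_def)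
    then show "a / 2 \<le> A ((\<epsilon> *\<^sub>R e, t) + w)" by (rule Alow)
    have "compact ((\<lambda>w. A ((\<epsilon> *\<^sub>R e, t) + w)) ` cball 0 r)"
      by (intro compact_continuous_image continuous_on_compose2[OF A] continuous_intros) auto
    then show "A ((\<epsilon> *\<^sub>R e, t) + w) \<le> (SUP w\<in>cball 0 r. A ((\<epsilon> *\<^sub>R e, t) + w))"
      using w by (intro cSUP_upper bounded_imp_bdd_above compact_imp_bounded) auto
  qed
  then have "(h - t1) * (m * (a / 2)) \<le> H h - H t1"
    unfolding t(3) using t1 h by (intro mult_left_mono) auto
  moreover have "h / 2 * (m * (a / 2)) \<le> (h - t1) * (m * (a / 2))"
    using t1 h m a by (intro mult_right_mono) auto
  moreover have "H h \<le> m * (R (0, h) + \<eta>)"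
    unfolding m_def H_def
  proof (rule bump_average_bounds(2)[OF r(1) meas(1), where l = "R (0, h) - \<eta>"])
    fix w :: "'x \<times> real" assume w: "norm w < r"
    have eq: "(\<epsilon> *\<^sub>R e, h) + w - (0, h) = (\<epsilon> *\<^sub>R e, 0) + w" by (simp add: prod_eq_iff)
    have "dist ((\<epsilon> *\<^sub>R e, h) + w) (0, h) < \<delta>1"
      using nrm[of 0 w] w r \<delta> unfolding dist_norm eq by simp
    from \<delta>1(2)[OF this] show "R (0, h) - \<eta> \<le> R ((\<epsilon> *\<^sub>R e, h) + w)" "R ((\<epsilon> *\<^sub>R e, h) + w) \<le> R (0, h) + \<eta>"
      by (auto simp: dist_real_def abs_less_iff)
  qed
  moreover have "m * (R (0, 0) - \<eta>) \<le> H t1"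
    unfolding m_def H_def
  proof (rule bump_average_bounds(1)[OF r(1) meas(1), where h = "R (0, 0) + \<eta>"])
    fix w :: "'x \<times> real" assume w: "norm w < r"
    have "dist ((\<epsilon> *\<^sub>R e, t1) + w) (0, 0) < \<delta>0"
      using nrm[of t1 w] w r \<delta> unfolding dist_norm zero_prod_def[symmetric] by (simp add: t1_def)
    from \<delta>0(2)[OF this] show "R (0, 0) - \<eta> \<le> R ((\<epsilon> *\<^sub>R e, t1) + w)" "R ((\<epsilon> *\<^sub>R e, t1) + w) \<le> R (0, 0) + \<eta>"
      by (auto simp: dist_real_def abs_less_iff)
  qed
  moreover have "m * R (0, h) \<le> m * R (0, 0)" using le[OF h] m by simp
  moreover have "h / 2 * (m * (a / 2)) = 4 * (m * \<eta>)" by (simp add: \<eta>_def)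
  moreover have "m * \<eta> > 0" using m \<eta> by simp
  ultimately show False unfolding distrib_left right_diff_distrib by linarith
qed

section \<open>Uniqueness for the dual problem\<close>

lemma C1_with_mult:
  assumes "C1_with f Df" "C1_with g Dg"
  shows "C1_with (\<lambda>z. f z * g z) (\<lambda>z. f z *\<^sub>R Dg z + g z *\<^sub>R Df z)"
proof -
  have "((\<lambda>z. f z * g z) has_derivative (\<lambda>v. (f z *\<^sub>R Dg z + g z *\<^sub>R Df z) \<bullet> v)) (at z)" for z
    using assms unfolding C1_with_def
    by (auto intro!: derivative_eq_intros simp: inner_add_left algebra_simps)
  moreover have "continuous_on UNIV (\<lambda>z. f z *\<^sub>R Dg z + g z *\<^sub>R Df z)"
    using assms C1_with_continuous[OF assms(1)] C1_with_continuous[OF assms(2)]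
    by (intro continuous_intros) (auto simp: C1_with_def)
  ultimately show ?thesis by (simp add: C1_with_def)
qed

lemma C1_with_fst:
  assumes "C1_with f Df"
  shows "C1_with (\<lambda>z. f (fst z)) (\<lambda>z. (Df (fst z), 0))"
proof -
  have "((\<lambda>z. f (fst z)) has_derivative (\<lambda>v. (Df (fst z), 0) \<bullet> v)) (at z)" for z :: "'a \<times> 'b"
  proof -
    have "(f has_derivative (\<lambda>v. Df (fst z) \<bullet> v)) (at (fst z))" using assms by (simp add: C1_with_def)
    from has_derivative_compose[OF has_derivative_fst[OF has_derivative_ident] this]
    show ?thesis by (simp add: inner_prod_def)
  qed
  moreover have "continuous_on UNIV (\<lambda>z::'a \<times> 'b. (Df (fst z), 0::'b))"
  proof -
    have "continuous_on UNIV Df" using assms by (simp add: C1_with_def)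
    from continuous_on_compose2[OF this continuous_on_fst[OF continuous_on_id]]
    show ?thesis by (intro continuous_on_Pair continuous_on_const) simp
  qed
  ultimately show ?thesis by (simp add: C1_with_def)
qed

text \<open>No condition at large times is imposed, although the equation is posed up to a time \<open>T\<close>: this encodes the
  final condition of the backward equation tested with such functions.\<close>

definition interior_test :: "'x::euclidean_space set \<Rightarrow> ('x \<times> real \<Rightarrow> real) \<Rightarrow> ('x \<times> real \<Rightarrow> 'x \<times> real) \<Rightarrow> bool" where
  "interior_test \<Omega> y Dy \<longleftrightarrow> C1_with y Dy \<and>
     (\<exists>K. compact K \<and> K \<subseteq> \<Omega> \<and> (\<forall>x t. x \<notin> K \<or> t \<le> 0 \<longrightarrow> y (x, t) = 0))"

lemma kernel_bounds:
  assumes "kernel k Dk"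
  shows "\<exists>B. \<forall>z. norm (k z) \<le> B" "\<exists>B. \<forall>z. norm (Dk z) \<le> B"
  using assms unfolding kernel_def bounded_iff by blast+

lemma sq_integrable_le:
  assumes "sq_integrable f" "g \<in> borel_measurable borel" "\<And>z. norm (g z) \<le> c * norm (f z)"
  shows "sq_integrable g"
  by (rule sq_integrable_bound[OF assms(1,2) AE_I2]) (rule assms(3))

text \<open>The inequality \<open>2 l(x, t) l(x, t - h) \<le> l(x, t)\<^sup>2 + l(x, t - h)\<^sup>2\<close> is integrated against \<open>p\<close>. As \<open>p\<close>
  does not depend on time, both squares have the same integral.\<close>

lemma correlation_nonincreasing:
  fixes l :: "'x::euclidean_space \<times> real \<Rightarrow> real" and p :: "'x \<Rightarrow> real"
  assumes l: "sq_integrable l" and p: "p \<in> borel_measurable borel" "\<And>x. 0 \<le> p x" "\<And>x. p x \<le> B"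
  shows "corr l (\<lambda>z. p (fst z) * l z) (0, h) \<le> corr l (\<lambda>z. p (fst z) * l z) (0, 0)"
proof -
  have [measurable]: "l \<in> borel_measurable borel" using l by (simp add: sq_integrable_def)
  have [measurable]: "(\<lambda>z. p (fst z)) \<in> borel_measurable borel"
    by (rule measurable_compose[OF _ p(1)]) (intro borel_measurable_continuous_onI continuous_on_fst continuous_on_id)
  have B: "B \<ge> 0" using p(2,3) order_trans by blast
  have pl: "sq_integrable (\<lambda>z. p (fst z) * l z)"
    by (rule sq_integrable_le[OF l, where c = B]) (use p B in \<open>auto simp: abs_mult intro: mult_right_mono\<close>)
  define q where "q z = p (fst z) * (l z)\<^sup>2" for z
  have qm: "q \<in> borel_measurable borel" unfolding q_def by measurable
  have q: "integrable lborel q"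
    using sq_integrable_inner[OF l pl] unfolding q_def[abs_def] by (simp add: power2_eq_square mult_ac)
  have int: "integrable lborel (\<lambda>z. l z * (p (fst z) * l (z - (0, h))))"
    using sq_integrable_inner[OF l sq_integrable_translate[OF pl, of "(0, h)"]] by simp
  have "corr l (\<lambda>z. p (fst z) * l z) (0, h) = (LINT z|lborel. l z * (p (fst z) * l (z - (0, h))))"
    by (simp add: corr_def)
  also have "\<dots> \<le> (LINT z|lborel. (q z + q (z - (0, h))) / 2)"
  proof (rule integral_mono[OF int])
    show "integrable lborel (\<lambda>z. (q z + q (z - (0, h))) / 2)"
      using q integral_translate(2)[OF qm, of "(0, h)"] by simp
    fix z
    have "2 * l z * l (z - (0, h)) \<le> (l z)\<^sup>2 + (l (z - (0, h)))\<^sup>2" by (rule sum_squares_bound)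
    from mult_left_mono[OF this p(2)[of "fst z"]]
    show "l z * (p (fst z) * l (z - (0, h))) \<le> (q z + q (z - (0, h))) / 2"
      by (simp add: q_def algebra_simps)
  qed
  also have "\<dots> = (LINT z|lborel. q z)"
    using q integral_translate[OF qm, of "(0, h)"] by simp
  also have "\<dots> = corr l (\<lambda>z. p (fst z) * l z) (0, 0)"
    by (simp add: corr_def q_def power2_eq_square mult_ac zero_prod_def[symmetric])
  finally show ?thesis .
qed

text \<open>Formally one tests the backward equation with \<open>\<psi> l\<close>, where \<open>\<psi>\<close> is a bump around \<open>x0\<close>, and drops the
  time derivative, whose contribution \<open>\<integral> \<psi> l\<^sup>2 / 2\<close> at the initial time has a sign. The admissible substitute is
  \<open>Y (z - s)\<close>, where \<open>Y\<close> mollifies \<open>\<psi> l\<close> and the shift \<open>s = (\<epsilon> e, t)\<close> moves its support into \<open>\<Omega>\<close> by the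
  segment property and into positive times by \<open>t > r\<close>. The hypothesis \<open>grad\<close>, that \<open>m\<close> is the weak gradient
  of \<open>l\<close> across the boundary, turns the gradient of \<open>Y\<close> into a mollification of \<open>F = \<psi> m + l \<nabla>\<psi>\<close>. The
  equation then says that the time derivative of mollified \<open>corr l (\<psi> l)\<close> is mollified
  \<open>A = corr (d l) (\<psi> l) + corr B F\<close>, and \<open>A\<close> at shift zero is the left-hand side.\<close>

lemma local_energy_inequality:
  fixes \<Omega> :: "'x::euclidean_space set" and l :: "'x \<times> real \<Rightarrow> real" and m B :: "'x \<times> real \<Rightarrow> 'x"
  assumes \<Omega>: "open \<Omega>" "bounded \<Omega>" and r0: "r0 > 0"
    and seg: "\<And>x \<epsilon>. x \<in> closure \<Omega> \<Longrightarrow> norm (x - x0) \<le> r0 \<Longrightarrow> 0 < \<epsilon> \<Longrightarrow> \<epsilon> < r0 \<Longrightarrow> x + \<epsilon> *\<^sub>R e \<in> \<Omega>"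
    and l: "sq_integrable l" and m: "sq_integrable m" and B: "sq_integrable B"
    and supp: "\<And>z. z \<notin> \<Omega> \<times> {0<..<T} \<Longrightarrow> l z = 0" "\<And>z. z \<notin> \<Omega> \<times> {0<..<T} \<Longrightarrow> m z = 0"
      "\<And>z. z \<notin> \<Omega> \<times> {0<..<T} \<Longrightarrow> B z = 0"
    and d: "d \<in> borel_measurable borel" "\<And>z. \<bar>d z\<bar> \<le> D"
    and grad: "\<And>\<theta> D\<theta> w. C1_with \<theta> D\<theta> \<Longrightarrow> (LINT z|lborel. l z * (fst (D\<theta> z) \<bullet> w) + \<theta> z * (m z \<bullet> w)) = 0"
    and eqn: "\<And>y Dy. interior_test \<Omega> y Dy \<Longrightarrow>
        (LINT z|lborel. l z * (snd (Dy z) + d z * y z) + B z \<bullet> fst (Dy z)) = 0"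
  shows "(LINT z|lborel. (d z * l z) * (bump x0 r0 (fst z) * l z)
      + B z \<bullet> (bump x0 r0 (fst z) *\<^sub>R m z + l z *\<^sub>R bump_grad x0 r0 (fst z))) \<le> 0"
proof -
  let ?\<psi> = "\<lambda>z::'x \<times> real. bump x0 r0 (fst z)" and ?\<psi>' = "\<lambda>z::'x \<times> real. bump_grad x0 r0 (fst z)"
  define f where "f z = ?\<psi> z * l z" for z
  define F where "F z = ?\<psi> z *\<^sub>R m z + l z *\<^sub>R ?\<psi>' z" for z
  have [measurable]: "l \<in> borel_measurable borel" "m \<in> borel_measurable borel" "B \<in> borel_measurable borel"
    "d \<in> borel_measurable borel" using l m B d by (auto simp: sq_integrable_def)
  have K: "kernel (bump x0 r0) (bump_grad x0 r0)" by (rule bump_kernel[OF r0])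
  have [measurable]: "?\<psi> \<in> borel_measurable borel" "?\<psi>' \<in> borel_measurable borel"
  proof -
    have "continuous_on UNIV ?\<psi>" "continuous_on UNIV ?\<psi>'"
    proof -
      have k: "continuous_on UNIV (bump x0 r0)" "continuous_on UNIV (bump_grad x0 r0)"
        using K by (simp_all add: kernel_def)
      show "continuous_on UNIV ?\<psi>" "continuous_on UNIV ?\<psi>'"
        using continuous_on_compose2[OF k(1) continuous_on_fst[OF continuous_on_id]]
          continuous_on_compose2[OF k(2) continuous_on_fst[OF continuous_on_id]] by simp_all
    qed
    then show "?\<psi> \<in> borel_measurable borel" "?\<psi>' \<in> borel_measurable borel"
      by (auto intro: borel_measurable_continuous_onI)
  qed
  obtain G where G: "\<And>x. norm (bump_grad x0 r0 x) \<le> G" using K by (auto simp: kernel_def bounded_iff)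
  have fsq: "sq_integrable f"
    unfolding f_def by (rule sq_integrable_le[OF l, where c = "r0 ^ 4"])
      (auto simp: abs_mult bump_le intro: mult_right_mono)
  have F1: "sq_integrable (\<lambda>z. ?\<psi> z *\<^sub>R m z)"
    by (rule sq_integrable_le[OF m, where c = "r0 ^ 4"]) (auto simp: bump_le intro: mult_right_mono)
  have F2: "sq_integrable (\<lambda>z. l z *\<^sub>R ?\<psi>' z)"
    by (rule sq_integrable_le[OF l, where c = G]) (auto simp: G mult.commute[of G] intro: mult_left_mono)
  have Fsq: "sq_integrable F" unfolding F_def by (rule sq_integrable_add[OF F1 F2])
  obtain Rx where Rx: "\<And>x. x \<in> \<Omega> \<Longrightarrow> norm x \<le> Rx" using \<Omega>(2) by (auto simp: bounded_iff)
  have out: "z \<notin> \<Omega> \<times> {0<..<T}" if "\<bar>Rx\<bar> + \<bar>T\<bar> < norm z" for z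
  proof
    assume z: "z \<in> \<Omega> \<times> {0<..<T}"
    then have "norm (fst z) \<le> Rx" "\<bar>snd z\<bar> \<le> \<bar>T\<bar>" using Rx by auto
    then show False using norm_Pair_le[of "fst z" "snd z"] that by simp
  qed
  have lint: "integrable lborel l" 
    by (rule sq_integrable_imp_integrable[OF l, of "\<bar>Rx\<bar> + \<bar>T\<bar>"]) (simp add: out supp(1))
  have fint: "integrable lborel f"
    by (rule sq_integrable_imp_integrable[OF fsq, of "\<bar>Rx\<bar> + \<bar>T\<bar>"]) (simp add: f_def out supp(1))
  have Fint: "integrable lborel F"
    by (rule sq_integrable_imp_integrable[OF Fsq, of "\<bar>Rx\<bar> + \<bar>T\<bar>"]) (simp add: F_def out supp)
  have dl: "sq_integrable (\<lambda>z. d z * l z)"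
    by (rule sq_integrable_le[OF l, where c = D]) (auto simp: abs_mult intro: mult_right_mono d)
  define A where "A s = corr (\<lambda>z. d z * l z) f s + corr B F s" for s
  have gradY: "fst (conv (bump_grad 0 r) f z) = mollify (bump 0 r) F z" if r: "r > 0" for r z
  proof (rule vector_eq_ldot[THEN iffD1], rule allI)
    fix w :: 'x
    have Kz: "C1_with (bump z r) (bump_grad z r)" by (rule kernel_C1[OF bump_kernel[OF r]])
    \<comment> \<open>the weak gradient is tested with the mollifier around \<open>z\<close> times the cut-off; the product rule produces \<open>F\<close>\<close>
    note \<theta> = C1_with_mult[OF Kz C1_with_fst[OF kernel_C1[OF K], where ?'b = real]]
    define \<phi> \<phi>' where "\<phi> = bump (0::'x \<times> real) r" and "\<phi>' = bump_grad (0::'x \<times> real) r"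
    have b0: "bump z r z' = \<phi> (z - z')" "bump_grad z r z' = - \<phi>' (z - z')" for z' :: "'x \<times> real"
      unfolding \<phi>_def \<phi>'_def bump_def bump_grad_def by (simp_all add: norm_minus_commute scaleR_diff_right)
    have kr: "kernel (bump 0 r) (bump_grad (0::'x \<times> real) r)" by (rule bump_kernel[OF r])
    obtain Gr where Gr: "\<And>x. norm (bump_grad (0::'x \<times> real) r x) \<le> Gr" using kr by (auto simp: kernel_def bounded_iff)
    have i1: "integrable lborel (\<lambda>z'. f z' *\<^sub>R bump_grad 0 r (z - z'))"
      by (rule conv_integrable[OF fint _ Gr]) (use kr in \<open>simp add: kernel_def\<close>)
    have i2: "integrable lborel (\<lambda>z'. bump 0 r (z - z') *\<^sub>R F z')"
    proof (rule Bochner_Integration.integrable_bound)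
      show "integrable lborel (\<lambda>z'. r ^ 4 *\<^sub>R F z')" using Fint by simp
      show "(\<lambda>z'. bump 0 r (z - z') *\<^sub>R F z') \<in> borel_measurable lborel"
        using borel_measurable_integrable[OF Fint] by measurable
      have "norm (bump 0 r (z - z') *\<^sub>R F z') \<le> norm (r ^ 4 *\<^sub>R F z')" for z'
        using bump_le[of 0 r "z - z'"] by (simp add: mult_right_mono)
      then show "AE z' in lborel. norm (bump 0 r (z - z') *\<^sub>R F z') \<le> norm (r ^ 4 *\<^sub>R F z')" by simp
    qed
    have "(LINT z'|lborel. (\<phi> (z - z') *\<^sub>R F z') \<bullet> w - (f z' *\<^sub>R \<phi>' (z - z')) \<bullet> (w, 0)) = 0"
      by (rule trans[OF Bochner_Integration.integral_cong[OF refl] grad[OF \<theta>, of w]])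
        (simp add: b0 F_def f_def inner_add_left inner_prod_def algebra_simps)
    then have "0 = (LINT z'|lborel. (\<phi> (z - z') *\<^sub>R F z') \<bullet> w - (f z' *\<^sub>R \<phi>' (z - z')) \<bullet> (w, 0))"
      by (rule sym)
    also have "\<dots> = (LINT z'|lborel. (bump 0 r (z - z') *\<^sub>R F z') \<bullet> w) - (LINT z'|lborel. (f z' *\<^sub>R bump_grad 0 r (z - z')) \<bullet> (w, 0))"
      unfolding \<phi>_def \<phi>'_def
      by (rule Bochner_Integration.integral_diff[OF integrable_inner_left[OF i2] integrable_inner_left[OF i1]])
    also have "(LINT z'|lborel. (bump 0 r (z - z') *\<^sub>R F z') \<bullet> w) = mollify (bump 0 r) F z \<bullet> w"
      unfolding mollify_def by (rule integral_inner_left) (rule i2)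
    also have "(LINT z'|lborel. (f z' *\<^sub>R bump_grad 0 r (z - z')) \<bullet> (w, 0)) = conv (bump_grad 0 r) f z \<bullet> (w, 0)"
      unfolding conv_def by (rule integral_inner_left) (rule i1)
    finally show "w \<bullet> fst (conv (bump_grad 0 r) f z) = w \<bullet> mollify (bump 0 r) F z"
      by (simp add: inner_prod_def inner_commute)
  qed
  have key: "A (0, 0) \<le> 0"
  proof (rule one_sided_rate_nonpos[of "corr l f" A r0 e])
    show "continuous_on UNIV (corr l f)" by (rule continuous_on_corr[OF l fsq])
    show "continuous_on UNIV A"
      unfolding A_def[abs_def] by (intro continuous_intros continuous_on_corr dl fsq B Fsq)
    show "0 < r0" by (rule r0)
    show "corr l f (0, h) \<le> corr l f (0, 0)" for h
      unfolding f_def[abs_def] by (rule correlation_nonincreasing[OF l, where B = "r0 ^ 4"]) (auto simp: bump_le)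
    fix \<epsilon> assume \<epsilon>: "0 < \<epsilon>" "\<epsilon> < r0"
    \<comment> \<open>the shifted support of the cut-off is compact in \<open>\<Omega>\<close>, which leaves room for a mollifier of radius \<open>r < \<delta>\<close>\<close>
    define D where "D = (\<lambda>x. x + \<epsilon> *\<^sub>R e) ` (closure \<Omega> \<inter> cball x0 r0)"
    have "compact (closure \<Omega> \<inter> cball x0 r0)" using \<Omega>(2) by (auto intro: compact_Int_closed simp: compact_closure)
    then have cD: "compact D" unfolding D_def by (intro compact_continuous_image continuous_intros)
    have "D \<subseteq> \<Omega>" unfolding D_def using seg \<epsilon> by (auto simp: dist_norm norm_minus_commute)
    then obtain \<delta> where \<delta>: "\<delta> > 0" "(\<Union>x\<in>D. ball x \<delta>) \<subseteq> \<Omega>"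
      using compact_subset_open_imp_ball_epsilon_subset[OF cD \<Omega>(1)] by blast
    have "((\<lambda>t. LINT w|lborel. bump 0 r w * corr l f ((\<epsilon> *\<^sub>R e, t) + w)) has_real_derivative
          (LINT w|lborel. bump 0 r w * A ((\<epsilon> *\<^sub>R e, t) + w))) (at t)" if r: "0 < r" "r < \<delta>" "r < t" for r t
    proof -
      define Y where "Y = conv (bump (0::'x \<times> real) r) f"
      define DY where "DY = conv (bump_grad (0::'x \<times> real) r) f"
      have kY: "kernel Y DY" unfolding Y_def DY_def by (rule kernel_conv[OF fint bump_kernel[OF r(1)]])
      define s where "s = (\<epsilon> *\<^sub>R e, t)"
      have test: "interior_test \<Omega> (\<lambda>z. Y (z - s)) (\<lambda>z. DY (z - s))"
        unfolding interior_test_def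
      proof (intro conjI exI allI impI)
        show "C1_with (\<lambda>z. Y (z - s)) (\<lambda>z. DY (z - s))" by (rule kernel_C1[OF kernel_translate[OF kY]])
        define K where "K = {x + y | x y. x \<in> D \<and> y \<in> cball 0 r}"
        show "compact K" unfolding K_def by (rule compact_sums[OF cD compact_cball])
        show "K \<subseteq> \<Omega>"
        proof
          fix k assume "k \<in> K"
          then obtain x y where "k = x + y" "x \<in> D" "norm y \<le> r" unfolding K_def by auto
          then have "k \<in> ball x \<delta>" using r(2) by (simp add: dist_norm)
          then show "k \<in> \<Omega>" using \<delta>(2) \<open>x \<in> D\<close> by blast
        qed
        fix x' :: 'x and t' :: real assume xt: "x' \<notin> K \<or> t' \<le> 0"
        have "f w *\<^sub>R bump 0 r ((x', t') - s - w) = 0" for w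
        proof (rule ccontr)
          assume "f w *\<^sub>R bump 0 r ((x', t') - s - w) \<noteq> 0"
          then have fw: "f w \<noteq> 0" and "bump 0 r ((x', t') - s - w) \<noteq> 0" by auto
          then have near: "norm ((x', t') - s - w) < r"
            using bump_eq_0[OF r(1), of "(x', t') - s - w" 0] by force
          have w: "w \<in> \<Omega> \<times> {0<..<T}" using fw supp(1)[of w] unfolding f_def by force
          have "bump x0 r0 (fst w) \<noteq> 0" using fw by (auto simp: f_def)
          then have "norm (fst w - x0) \<le> r0" using bump_eq_0[OF r0, of "fst w" x0] by force
          moreover have "fst w \<in> closure \<Omega>" using w closure_subset[of \<Omega>] by auto
          ultimately have wD: "fst w + \<epsilon> *\<^sub>R e \<in> D" unfolding D_def by (auto simp: dist_norm norm_minus_commute)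
          define q where "q = (x', t') - s - w"
          have "norm (fst q) < r" "\<bar>snd q\<bar> < r"
            using near norm_fst_le[of "fst q" "snd q"] norm_snd_le[of "snd q" "fst q"]
            unfolding q_def[symmetric] by simp_all
          then have n1: "norm (x' - (fst w + \<epsilon> *\<^sub>R e)) < r" and n2: "\<bar>t' - t - snd w\<bar> < r"
            unfolding s_def q_def by (auto simp: algebra_simps)
          have "x' \<in> K"
            unfolding K_def mem_Collect_eq
            by (rule exI[of _ "fst w + \<epsilon> *\<^sub>R e"], rule exI[of _ "x' - (fst w + \<epsilon> *\<^sub>R e)"])
              (use wD n1 in simp)
          moreover have "t' > 0" using n2 r(3) w by auto
          ultimately show False using xt by auto
        qed
        then show "Y ((x', t') - s) = 0" unfolding Y_def conv_def by (simp only: Bochner_Integration.integral_zero)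
      qed
      have Ybd: "continuous_on UNIV Y" "continuous_on UNIV DY" using kY by (auto simp: kernel_def)
      have [measurable]: "Y \<in> borel_measurable borel" "DY \<in> borel_measurable borel"
        using Ybd by (auto intro: borel_measurable_continuous_onI)
      have kH: "kernel (conv (\<lambda>w. Y (- w)) l) (conv (\<lambda>w. - DY (- w)) l)"
        by (rule kernel_conv[OF lint kernel_reflect[OF kY]])
      \<comment> \<open>the mollified correlation is itself a convolution of \<open>l\<close> with the reflected \<open>Y\<close>, hence differentiable in the shift\<close>
      have H: "conv (\<lambda>w. Y (- w)) l s' = (LINT w|lborel. bump 0 r w * corr l f (s' + w))" for s'
        using mollify_correlation[OF l fsq fint r(1), of s']
        by (simp add: conv_def mollify_real Y_def)
      have kmY: "kernel (\<lambda>w. Y (- w)) (\<lambda>w. - DY (- w))" by (rule kernel_reflect[OF kY])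
      obtain G1 where G1: "\<And>w. norm (- DY (- w)) \<le> G1" using kernel_bounds(2)[OF kmY] by blast
      obtain G2 where G2: "\<And>w. norm (Y (- w)) \<le> G2" using kernel_bounds(1)[OF kmY] by blast
      have j1: "integrable lborel (\<lambda>z. l z *\<^sub>R - DY (- (s - z)))"
        by (rule conv_integrable[OF lint _ G1]) (use kmY in \<open>simp add: kernel_def\<close>)
      have dlint: "integrable lborel (\<lambda>z. d z * l z)"
        by (rule sq_integrable_imp_integrable[OF dl, of "\<bar>Rx\<bar> + \<bar>T\<bar>"]) (simp add: out supp(1))
      have j2: "integrable lborel (\<lambda>z. (d z * l z) *\<^sub>R Y (- (s - z)))"
        by (rule conv_integrable[OF dlint _ G2]) (use kmY in \<open>simp add: kernel_def\<close>)
      have DYF: "fst (DY z) = mollify (bump 0 r) F z" for z unfolding DY_def by (rule gradY[OF r(1)])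
      have cA: "integrable lborel (\<lambda>w. bump 0 r w * corr u v (s + w))"
        if "sq_integrable u" "sq_integrable v" for u v :: "'x \<times> real \<Rightarrow> 'c::euclidean_space"
      proof -
        have cc: "continuous_on UNIV (\<lambda>w. corr u v (s + w))"
          by (intro continuous_on_compose2[OF continuous_on_corr[OF that]] continuous_intros) auto
        have [measurable]: "(\<lambda>w. corr u v (s + w)) \<in> borel_measurable borel"
          by (rule borel_measurable_continuous_onI[OF cc])
        have "compact ((\<lambda>w. corr u v (s + w)) ` cball 0 r)"
          by (intro compact_continuous_image continuous_on_subset[OF cc]) auto
        then obtain b where b: "\<And>w. norm w \<le> r \<Longrightarrow> \<bar>corr u v (s + w)\<bar> \<le> b"
          using compact_imp_bounded by (fastforce simp: bounded_iff)
        show ?thesis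
        proof (rule integrable_bounded_support[where R = r and B = "r ^ 4 * \<bar>b\<bar>"])
          show "(\<lambda>w. bump 0 r w * corr u v (s + w)) \<in> borel_measurable borel" by measurable
          show "bump 0 r w * corr u v (s + w) = 0" if "r < norm w" for w
            using bump_eq_0[OF r(1), of w 0] that by simp
          show "norm (bump 0 r w * corr u v (s + w)) \<le> r ^ 4 * \<bar>b\<bar>" for w
          proof (cases "norm w \<le> r")
            case True
            then have "\<bar>corr u v (s + w)\<bar> \<le> \<bar>b\<bar>" using b[OF True] by linarith
            then show ?thesis using bump_le[of 0 r w] by (simp add: abs_mult mult_mono)
          next
            case False
            then show ?thesis using bump_eq_0[OF r(1), of w 0] by simp
          qed
        qed
      qed
      have Bint: "integrable lborel (\<lambda>z. B z \<bullet> fst (DY (z - s)))"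
      proof -
        have "integrable lborel B"
          by (rule sq_integrable_imp_integrable[OF B, of "\<bar>Rx\<bar> + \<bar>T\<bar>"]) (simp add: out supp(3))
        then have "integrable lborel (\<lambda>z. G1 * norm (B z))" by simp
        then show ?thesis
        proof (rule Bochner_Integration.integrable_bound)
          have "continuous_on UNIV (\<lambda>z. DY (z - s))"
            by (intro continuous_on_compose2[OF Ybd(2)] continuous_intros) auto
          then have [measurable]: "(\<lambda>z. fst (DY (z - s))) \<in> borel_measurable borel"
            by (intro borel_measurable_continuous_onI continuous_on_fst)
          show "(\<lambda>z. B z \<bullet> fst (DY (z - s))) \<in> borel_measurable lborel" by measurable
          have "norm (B z \<bullet> fst (DY (z - s))) \<le> norm (G1 * norm (B z))" for z
          proof -
            have "\<bar>B z \<bullet> fst (DY (z - s))\<bar> \<le> norm (B z) * norm (fst (DY (z - s)))" by (rule Cauchy_Schwarz_ineq2)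
            also have "\<dots> \<le> norm (B z) * G1"
              using G1[of "s - z"] norm_fst_le[of "fst (DY (z - s))" "snd (DY (z - s))"]
              by (intro mult_left_mono) auto
            finally show ?thesis by (simp add: mult.commute)
          qed
          then show "AE z in lborel. norm (B z \<bullet> fst (DY (z - s))) \<le> norm (G1 * norm (B z))" by simp
        qed
      qed
      \<comment> \<open>the derivative in time; the tested equation is subtracted to trade \<open>l Y\<^sub>t\<close> for terms without time derivative\<close>
      have "conv (\<lambda>w. - DY (- w)) l s \<bullet> (0, 1) = (LINT z|lborel. (l z *\<^sub>R - DY (- (s - z))) \<bullet> (0, 1))"
        unfolding conv_def by (rule integral_inner_left[symmetric]) (rule j1)
      also have "\<dots> = (LINT z|lborel. ((d z * l z) *\<^sub>R Y (- (s - z)) + B z \<bullet> fst (DY (z - s)))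
          - (l z * (snd (DY (z - s)) + d z * Y (z - s)) + B z \<bullet> fst (DY (z - s))))"
        by (intro Bochner_Integration.integral_cong) (auto simp: inner_prod_def algebra_simps)
      also have "\<dots> = (LINT z|lborel. (d z * l z) *\<^sub>R Y (- (s - z)) + B z \<bullet> fst (DY (z - s)))
          - (LINT z|lborel. l z * (snd (DY (z - s)) + d z * Y (z - s)) + B z \<bullet> fst (DY (z - s)))"
      proof (rule Bochner_Integration.integral_diff)
        show "integrable lborel (\<lambda>z. (d z * l z) *\<^sub>R Y (- (s - z)) + B z \<bullet> fst (DY (z - s)))"
          using j2 Bint by (rule Bochner_Integration.integrable_add)
        have "integrable lborel (\<lambda>z. (d z * l z) *\<^sub>R Y (- (s - z)) - (l z *\<^sub>R - DY (- (s - z))) \<bullet> (0, 1) + B z \<bullet> fst (DY (z - s)))"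
          by (intro Bochner_Integration.integrable_add Bochner_Integration.integrable_diff j2 integrable_inner_left[OF j1] Bint)
        then show "integrable lborel (\<lambda>z. l z * (snd (DY (z - s)) + d z * Y (z - s)) + B z \<bullet> fst (DY (z - s)))"
          by (simp add: inner_prod_def algebra_simps)
      qed
      also have "\<dots> = (LINT z|lborel. (d z * l z) *\<^sub>R Y (- (s - z))) + (LINT z|lborel. B z \<bullet> fst (DY (z - s)))"
        using eqn[OF test] Bochner_Integration.integral_add[OF j2 Bint] by simp
      also have "(LINT z|lborel. (d z * l z) *\<^sub>R Y (- (s - z))) = (LINT w|lborel. bump 0 r w * corr (\<lambda>z. d z * l z) f (s + w))"
        using mollify_correlation[OF dl fsq fint r(1), of s] by (simp add: mollify_real Y_def)
      also have "(LINT z|lborel. B z \<bullet> fst (DY (z - s))) = (LINT w|lborel. bump 0 r w * corr B F (s + w))"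
        using mollify_correlation[OF B Fsq Fint r(1), of s] by (simp add: DYF)
      also have "(LINT w|lborel. bump 0 r w * corr (\<lambda>z. d z * l z) f (s + w)) + (LINT w|lborel. bump 0 r w * corr B F (s + w))
          = (LINT w|lborel. bump 0 r w * A (s + w))"
        unfolding A_def distrib_left by (rule Bochner_Integration.integral_add[OF cA[OF dl fsq] cA[OF B Fsq], symmetric])
      finally have DH: "conv (\<lambda>w. - DY (- w)) l s \<bullet> (0, 1) = (LINT w|lborel. bump 0 r w * A (s + w))" .
      have "(conv (\<lambda>w. Y (- w)) l has_derivative (\<lambda>v. conv (\<lambda>w. - DY (- w)) l s \<bullet> v)) (at s)"
        using kernel_C1[OF kH] unfolding C1_with_def by blast
      moreover have "((\<lambda>t. (\<epsilon> *\<^sub>R e, t)) has_derivative (\<lambda>h. (0, h))) (at t)"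
        by (intro has_derivative_Pair has_derivative_const has_derivative_ident)
      ultimately have "((\<lambda>t. conv (\<lambda>w. Y (- w)) l (\<epsilon> *\<^sub>R e, t)) has_derivative (\<lambda>h. conv (\<lambda>w. - DY (- w)) l s \<bullet> (0, h))) (at t)"
        unfolding s_def by (rule has_derivative_compose[rotated])
      moreover have "conv (\<lambda>w. - DY (- w)) l s \<bullet> (0, h) = (LINT w|lborel. bump 0 r w * A (s + w)) * h" for h
        unfolding DH[symmetric] by (simp add: inner_prod_def)
      ultimately show ?thesis unfolding has_field_derivative_def H s_def by (simp add: mult_commute_abs)
    qed
    then show "\<exists>r0>0. \<forall>r t. 0 < r \<and> r < r0 \<and> r < t \<longrightarrow>
        ((\<lambda>t. LINT w|lborel. bump 0 r w * corr l f ((\<epsilon> *\<^sub>R e, t) + w)) has_real_derivative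
          (LINT w|lborel. bump 0 r w * A ((\<epsilon> *\<^sub>R e, t) + w))) (at t)"
      using \<delta>(1) by blast
  qed
  have "(LINT z|lborel. (d z * l z) * f z + B z \<bullet> F z) = A (0, 0)"
    unfolding A_def corr_def zero_prod_def[symmetric]
    using sq_integrable_inner[OF dl fsq] sq_integrable_inner[OF B Fsq] by simp
  then show ?thesis using key by (simp add: f_def F_def)
qed

lemma C2_function_continuous: "C2_function g \<Longrightarrow> continuous_on UNIV g"
  unfolding C2_function_def
  by (intro differentiable_imp_continuous_on) (auto simp: differentiable_on_def differentiable_def)

text \<open>The segment property. At a boundary point \<open>\<Omega>\<close> is locally the region above a graph, so moving up along
  the axis leads from the closure into \<open>\<Omega>\<close>; at an interior point one may take \<open>e = 0\<close>.\<close>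

lemma C2_domain_segment:
  fixes \<Omega> :: "'x::euclidean_space set"
  assumes \<Omega>: "open \<Omega>" "C2_boundary \<Omega>" and x0: "x0 \<in> closure \<Omega>"
  shows "\<exists>r>0. \<exists>e. \<forall>x\<in>closure \<Omega>. norm (x - x0) \<le> r \<longrightarrow> (\<forall>\<epsilon>. 0 < \<epsilon> \<and> \<epsilon> < r \<longrightarrow> x + \<epsilon> *\<^sub>R e \<in> \<Omega>)"
proof (cases "x0 \<in> \<Omega>")
  case True
  then obtain R where R: "R > 0" "ball x0 R \<subseteq> \<Omega>" using \<Omega>(1) open_contains_ball by blast
  have "x + \<epsilon> *\<^sub>R 0 \<in> \<Omega>" if "norm (x - x0) \<le> R / 2" for x and \<epsilon> :: real
  proof -
    have "x \<in> ball x0 R" using that R(1) by (simp add: dist_norm norm_minus_commute)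
    then show ?thesis using R(2) by auto
  qed
  then show ?thesis using R(1) by (intro exI[of _ "R / 2"]) (auto intro!: exI[of _ 0])
next
  case False
  then have "x0 \<in> frontier \<Omega>" using x0 \<Omega>(1) by (simp add: frontier_def interior_open)
  then obtain R e g where R: "R > 0" "norm e = 1" "C2_function g"
    and graph: "\<Omega> \<inter> ball x0 R = {x \<in> ball x0 R. x \<bullet> e > g (x - (x \<bullet> e) *\<^sub>R e)}"
    using \<Omega>(2) unfolding C2_boundary_def by blast
  have g: "continuous_on UNIV g" by (rule C2_function_continuous[OF R(3)])
  have ee: "e \<bullet> e = 1" using R(2) by (simp add: norm_eq_1)
  have "x + \<epsilon> *\<^sub>R e \<in> \<Omega>" if x: "x \<in> closure \<Omega>" "norm (x - x0) \<le> R / 3" and \<epsilon>: "0 < \<epsilon>" "\<epsilon> < R / 3" for x \<epsilon>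
  proof -
    obtain s where s: "\<And>n. s n \<in> \<Omega>" "s \<longlonglongrightarrow> x" using x(1) unfolding closure_sequential by blast
    have xb: "x \<in> ball x0 R" using x(2) R(1) by (simp add: dist_norm norm_minus_commute)
    then have "\<forall>\<^sub>F n in sequentially. s n \<in> ball x0 R" using s(2) open_ball unfolding tendsto_def by blast
    then have ev: "\<forall>\<^sub>F n in sequentially. g (s n - (s n \<bullet> e) *\<^sub>R e) \<le> s n \<bullet> e"
    proof eventually_elim
      case (elim n)
      then have "s n \<in> \<Omega> \<inter> ball x0 R" using s(1) by blast
      then show ?case unfolding graph by simp
    qed
    have "(\<lambda>n. s n - (s n \<bullet> e) *\<^sub>R e) \<longlonglongrightarrow> x - (x \<bullet> e) *\<^sub>R e" by (intro tendsto_intros s(2))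
    then have "(\<lambda>n. g (s n - (s n \<bullet> e) *\<^sub>R e)) \<longlonglongrightarrow> g (x - (x \<bullet> e) *\<^sub>R e)"
      using g by (intro isCont_tendsto_compose[of _ g]) (simp add: continuous_on_eq_continuous_at)
    moreover have "(\<lambda>n. s n \<bullet> e) \<longlonglongrightarrow> x \<bullet> e" by (intro tendsto_intros s(2))
    ultimately have le: "g (x - (x \<bullet> e) *\<^sub>R e) \<le> x \<bullet> e"
      using ev tendsto_le[OF sequentially_bot] by blast
    have "norm (x + \<epsilon> *\<^sub>R e - x0) \<le> norm (x - x0) + norm (\<epsilon> *\<^sub>R e)"
      using norm_triangle_ineq[of "x - x0" "\<epsilon> *\<^sub>R e"] by (simp add: algebra_simps)
    then have "x + \<epsilon> *\<^sub>R e \<in> ball x0 R" using x(2) \<epsilon> R(1,2) by (simp add: dist_norm norm_minus_commute)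
    moreover have "(x + \<epsilon> *\<^sub>R e) \<bullet> e > g ((x + \<epsilon> *\<^sub>R e) - ((x + \<epsilon> *\<^sub>R e) \<bullet> e) *\<^sub>R e)"
      using le \<epsilon>(1) by (simp add: inner_add_left ee algebra_simps)
    ultimately have "x + \<epsilon> *\<^sub>R e \<in> \<Omega> \<inter> ball x0 R" unfolding graph by blast
    then show ?thesis by blast
  qed
  then show ?thesis using R(1) by (intro exI[of _ "R / 3"]) (auto intro!: exI[of _ e])
qed

lemma C1_with_exp_snd: "C1_with (\<lambda>z::'x::euclidean_space \<times> real. exp (k * snd z)) (\<lambda>z. (0, k * exp (k * snd z)))"
  unfolding C1_with_def
proof (intro conjI allI)
  fix z :: "'x \<times> real"
  show "((\<lambda>z. exp (k * snd z)) has_derivative (\<lambda>v. (0, k * exp (k * snd z)) \<bullet> v)) (at z)"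
    by (auto intro!: derivative_eq_intros simp: inner_prod_def algebra_simps)
  show "continuous_on UNIV (\<lambda>z::'x \<times> real. (0::'x, k * exp (k * snd z)))"
    by (intro continuous_intros)
qed

lemma exp_weight_bound: "\<lbrakk>0 < t; t < T\<rbrakk> \<Longrightarrow> exp (k * t) \<le> exp (\<bar>k\<bar> * T)" for k t T :: real
  by (simp, rule order_trans[OF mult_right_mono[OF abs_ge_self]]) (auto intro: mult_left_mono)

text \<open>The functions \<open>exp(k t) l\<close> and \<open>exp(k t) m\<close> satisfy the same system with \<open>d + k\<close> in place of \<open>d\<close>,
  so the zero order coefficient can be made as large as desired.\<close>

lemma weighted_local_energy_inequality:
  fixes \<Omega> :: "'x::euclidean_space set" and l :: "'x \<times> real \<Rightarrow> real" and m B :: "'x \<times> real \<Rightarrow> 'x" and k :: real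
  assumes \<Omega>: "open \<Omega>" "bounded \<Omega>" and r0: "r0 > 0"
    and seg: "\<And>x \<epsilon>. x \<in> closure \<Omega> \<Longrightarrow> norm (x - x0) \<le> r0 \<Longrightarrow> 0 < \<epsilon> \<Longrightarrow> \<epsilon> < r0 \<Longrightarrow> x + \<epsilon> *\<^sub>R e \<in> \<Omega>"
    and l: "sq_integrable l" and m: "sq_integrable m" and B: "sq_integrable B"
    and supp: "\<And>z. z \<notin> \<Omega> \<times> {0<..<T} \<Longrightarrow> l z = 0" "\<And>z. z \<notin> \<Omega> \<times> {0<..<T} \<Longrightarrow> m z = 0"
      "\<And>z. z \<notin> \<Omega> \<times> {0<..<T} \<Longrightarrow> B z = 0"
    and d: "d \<in> borel_measurable borel" "\<And>z. \<bar>d z\<bar> \<le> D"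
    and grad: "\<And>\<theta> D\<theta> w. C1_with \<theta> D\<theta> \<Longrightarrow> (LINT z|lborel. l z * (fst (D\<theta> z) \<bullet> w) + \<theta> z * (m z \<bullet> w)) = 0"
    and eqn: "\<And>y Dy. interior_test \<Omega> y Dy \<Longrightarrow>
        (LINT z|lborel. l z * (snd (Dy z) + d z * y z) + B z \<bullet> fst (Dy z)) = 0"
  defines "E \<equiv> \<lambda>z. exp (k * snd z)"
  shows "(LINT z|lborel. ((d z + k) * (E z * l z)) * (bump x0 r0 (fst z) * (E z * l z))
      + (E z *\<^sub>R B z) \<bullet> (bump x0 r0 (fst z) *\<^sub>R (E z *\<^sub>R m z) + (E z * l z) *\<^sub>R bump_grad x0 r0 (fst z))) \<le> 0"
proof (rule local_energy_inequality[OF \<Omega> r0 seg, where T = T and D = "D + \<bar>k\<bar>"])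
  have [measurable]: "l \<in> borel_measurable borel" "m \<in> borel_measurable borel" "B \<in> borel_measurable borel"
    "d \<in> borel_measurable borel" using l m B d by (auto simp: sq_integrable_def)
  have Em [measurable]: "E \<in> borel_measurable borel"
    unfolding E_def by (intro borel_measurable_continuous_onI continuous_intros)
  have bd: "norm (E z *\<^sub>R v) \<le> exp (\<bar>k\<bar> * T) * norm v" if "z \<notin> \<Omega> \<times> {0<..<T} \<Longrightarrow> v = 0"
    for z and v :: "'c::real_normed_vector"
    using that exp_weight_bound[of "snd z" T k] unfolding E_def
    by (cases "z \<in> \<Omega> \<times> {0<..<T}") (auto intro!: mult_right_mono)
  show "sq_integrable (\<lambda>z. E z * l z)"
    using bd[OF supp(1)] by (intro sq_integrable_le[OF l, where c = "exp (\<bar>k\<bar> * T)"]) auto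
  show "sq_integrable (\<lambda>z. E z *\<^sub>R m z)"
    using bd[OF supp(2)] by (intro sq_integrable_le[OF m, where c = "exp (\<bar>k\<bar> * T)"]) auto
  show "sq_integrable (\<lambda>z. E z *\<^sub>R B z)"
    using bd[OF supp(3)] by (intro sq_integrable_le[OF B, where c = "exp (\<bar>k\<bar> * T)"]) auto
  show "(\<lambda>z. d z + k) \<in> borel_measurable borel" by measurable
  show "\<bar>d z + k\<bar> \<le> D + \<bar>k\<bar>" for z using d(2)[of z] by linarith
  note CE = C1_with_exp_snd[where 'x = 'x and k = k]
  show "(LINT z|lborel. (E z * l z) * (fst (D\<theta> z) \<bullet> w) + \<theta> z * ((E z *\<^sub>R m z) \<bullet> w)) = 0" if "C1_with \<theta> D\<theta>" for \<theta> D\<theta> w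
    using grad[OF C1_with_mult[OF CE that], of w] by (simp add: E_def algebra_simps)
  show "(LINT z|lborel. (E z * l z) * (snd (Dy z) + (d z + k) * y z) + (E z *\<^sub>R B z) \<bullet> fst (Dy z)) = 0"
    if y: "interior_test \<Omega> y Dy" for y Dy
  proof -
    have "interior_test \<Omega> (\<lambda>z. exp (k * snd z) * y z) (\<lambda>z. exp (k * snd z) *\<^sub>R Dy z + y z *\<^sub>R (0, k * exp (k * snd z)))"
      using y C1_with_mult[OF CE, of y Dy] unfolding interior_test_def by fastforce
    from eqn[OF this] show ?thesis by (simp add: E_def algebra_simps)
  qed
qed (use supp in auto)

text \<open>Finitely many bumps from the local inequality cover the closure of \<open>\<Omega>\<close>. Their sum \<open>\<Psi>\<close> has a positive lower
  bound \<open>\<mu>\<close> there, which takes the place of a partition of unity: the terms with \<open>\<nabla>\<Psi>\<close> are absorbed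
  by half of the coercive term and by the zero order term once \<open>k\<close> is large. The sum of the local
  inequalities then bounds a positive definite quantity above by zero.\<close>

lemma parabolic_uniqueness:
  fixes \<Omega> :: "'x::euclidean_space set" and l :: "'x \<times> real \<Rightarrow> real" and m B :: "'x \<times> real \<Rightarrow> 'x"
  assumes \<Omega>: "open \<Omega>" "bounded \<Omega>" "\<Omega> \<noteq> {}" "C2_boundary \<Omega>"
    and l: "sq_integrable l" and m: "sq_integrable m" and B: "sq_integrable B"
    and supp: "\<And>z. z \<notin> \<Omega> \<times> {0<..<T} \<Longrightarrow> l z = 0" "\<And>z. z \<notin> \<Omega> \<times> {0<..<T} \<Longrightarrow> m z = 0"
    and c0: "c0 > 0" and coer: "\<And>z. c0 * (norm (m z))\<^sup>2 \<le> B z \<bullet> m z" and Cb: "\<And>z. norm (B z) \<le> Cb * norm (m z)"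
    and d: "d \<in> borel_measurable borel" "\<And>z. \<bar>d z\<bar> \<le> D"
    and grad: "\<And>\<theta> D\<theta> w. C1_with \<theta> D\<theta> \<Longrightarrow> (LINT z|lborel. l z * (fst (D\<theta> z) \<bullet> w) + \<theta> z * (m z \<bullet> w)) = 0"
    and eqn: "\<And>y Dy. interior_test \<Omega> y Dy \<Longrightarrow>
        (LINT z|lborel. l z * (snd (Dy z) + d z * y z) + B z \<bullet> fst (Dy z)) = 0"
  shows "AE z in lborel. l z = 0 \<and> m z = 0"
proof -
  have suppB: "B z = 0" if "z \<notin> \<Omega> \<times> {0<..<T}" for z using Cb[of z] supp(2)[OF that] by simp
  have cl: "compact (closure \<Omega>)" using \<Omega>(2) by (simp add: compact_closure)
  obtain \<rho> e where re: "\<And>x0. x0 \<in> closure \<Omega> \<Longrightarrow> \<rho> x0 > 0"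
    "\<And>x0 x \<epsilon>. x0 \<in> closure \<Omega> \<Longrightarrow> x \<in> closure \<Omega> \<Longrightarrow> norm (x - x0) \<le> \<rho> x0 \<Longrightarrow> 0 < \<epsilon> \<Longrightarrow> \<epsilon> < \<rho> x0 \<Longrightarrow> x + \<epsilon> *\<^sub>R e x0 \<in> \<Omega>"
    using C2_domain_segment[OF \<Omega>(1,4)] by metis
  have "closure \<Omega> \<subseteq> (\<Union>x0\<in>closure \<Omega>. ball x0 (\<rho> x0))" using re(1) by force
  from compactE_image[OF cl _ this] obtain S where S: "S \<subseteq> closure \<Omega>" "finite S" "closure \<Omega> \<subseteq> (\<Union>x0\<in>S. ball x0 (\<rho> x0))"
    by auto
  define \<Psi> where "\<Psi> x = (\<Sum>x0\<in>S. bump x0 (\<rho> x0) x)" for x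
  define V where "V x = (\<Sum>x0\<in>S. bump_grad x0 (\<rho> x0) x)" for x
  have kern: "kernel (bump x0 (\<rho> x0)) (bump_grad x0 (\<rho> x0))" if "x0 \<in> S" for x0
    using that S(1) re(1) by (intro bump_kernel) auto
  have cont: "continuous_on UNIV \<Psi>" "continuous_on UNIV V"
    unfolding \<Psi>_def[abs_def] V_def[abs_def] using kern by (auto intro!: continuous_on_sum simp: kernel_def)
  have pos: "0 < \<Psi> x" if xc: "x \<in> closure \<Omega>" for x
  proof -
    obtain x0 where "x0 \<in> S" "x \<in> ball x0 (\<rho> x0)" using S(3) xc by blast
    then have "0 < bump x0 (\<rho> x0) x" using bump_pos_iff[of "\<rho> x0" x0 x] S(1) re(1) by (auto simp: dist_norm norm_minus_commute)
    then show ?thesis unfolding \<Psi>_def using S(2) \<open>x0 \<in> S\<close> by (intro sum_pos2) auto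
  qed
  have "closure \<Omega> \<noteq> {}" using \<Omega>(3) by simp
  from continuous_attains_inf[OF cl this continuous_on_subset[OF cont(1) subset_UNIV]]
  obtain xm where xm: "xm \<in> closure \<Omega>" "\<And>x. x \<in> closure \<Omega> \<Longrightarrow> \<Psi> xm \<le> \<Psi> x" by blast
  define \<mu> where "\<mu> = \<Psi> xm"
  have \<mu>: "\<mu> > 0" "\<And>x. x \<in> closure \<Omega> \<Longrightarrow> \<mu> \<le> \<Psi> x" using pos xm by (auto simp: \<mu>_def)
  have "bounded (V ` closure \<Omega>)"
    by (intro compact_imp_bounded compact_continuous_image continuous_on_subset[OF cont(2)] cl) auto
  then obtain G where G: "\<And>x. x \<in> closure \<Omega> \<Longrightarrow> norm (V x) \<le> G" by (auto simp: bounded_iff)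
  have D0: "0 \<le> D" using d(2) abs_ge_zero order_trans by blast
  define q where "q = c0 * \<mu>"
  have q: "q > 0" using c0 \<mu> by (simp add: q_def)
  \<comment> \<open>then \<open>(d + k) \<Psi>\<close> exceeds by at least \<open>1\<close> the factor left over from absorbing the cross term\<close>
  define k where "k = D + (1 + (Cb * G)\<^sup>2 / (2 * q)) / \<mu>"
  define E where "E z = exp (k * snd z)" for z :: "'x \<times> real"
  define g where "g z = E z * l z" for z
  define M where "M z = E z *\<^sub>R m z" for z
  define N where "N z = E z *\<^sub>R B z" for z
  define h where "h x0 z = ((d z + k) * g z) * (bump x0 (\<rho> x0) (fst z) * g z)
      + N z \<bullet> (bump x0 (\<rho> x0) (fst z) *\<^sub>R M z + g z *\<^sub>R bump_grad x0 (\<rho> x0) (fst z))" for x0 z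
  have le0: "(LINT z|lborel. h x0 z) \<le> 0" if "x0 \<in> S" for x0
    unfolding h_def g_def M_def N_def E_def
    by (rule weighted_local_energy_inequality[OF \<Omega>(1,2) _ _ l m B supp suppB d grad eqn, where e = "e x0" and T = T])
      (use re that S(1) in auto)
  have [measurable]: "l \<in> borel_measurable borel" "m \<in> borel_measurable borel" "B \<in> borel_measurable borel"
    "d \<in> borel_measurable borel" using l m B d by (auto simp: sq_integrable_def)
  have Em [measurable]: "E \<in> borel_measurable borel"
    unfolding E_def[abs_def] by (intro borel_measurable_continuous_onI continuous_intros)
  have bd: "norm (E z *\<^sub>R v) \<le> exp (\<bar>k\<bar> * T) * norm v" if "z \<notin> \<Omega> \<times> {0<..<T} \<Longrightarrow> v = 0"
    for z and v :: "'c::real_normed_vector"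
    using that exp_weight_bound[of "snd z" T k] unfolding E_def
    by (cases "z \<in> \<Omega> \<times> {0<..<T}") (auto intro!: mult_right_mono)
  have gsq: "sq_integrable g"
    unfolding g_def using bd[OF supp(1)] by (intro sq_integrable_le[OF l, where c = "exp (\<bar>k\<bar> * T)"]) auto
  have Msq: "sq_integrable M"
    unfolding M_def using bd[OF supp(2)] by (intro sq_integrable_le[OF m, where c = "exp (\<bar>k\<bar> * T)"]) auto
  have Nsq: "sq_integrable N"
    unfolding N_def using bd[OF suppB] by (intro sq_integrable_le[OF B, where c = "exp (\<bar>k\<bar> * T)"]) auto
  have [measurable]: "g \<in> borel_measurable borel" "M \<in> borel_measurable borel" "N \<in> borel_measurable borel"
    using gsq Msq Nsq by (auto simp: sq_integrable_def)
  have hint: "integrable lborel (h x0)" if x0: "x0 \<in> S" for x0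
  proof -
    have c: "continuous_on UNIV (bump x0 (\<rho> x0))" "continuous_on UNIV (bump_grad x0 (\<rho> x0))"
      using kern[OF x0] by (simp_all add: kernel_def)
    have "continuous_on UNIV (\<lambda>z::'x \<times> real. bump x0 (\<rho> x0) (fst z))" "continuous_on UNIV (\<lambda>z::'x \<times> real. bump_grad x0 (\<rho> x0) (fst z))"
      using continuous_on_compose2[OF c(1) continuous_on_fst[OF continuous_on_id]]
        continuous_on_compose2[OF c(2) continuous_on_fst[OF continuous_on_id]] by simp_all
    then have [measurable]: "(\<lambda>z::'x \<times> real. bump x0 (\<rho> x0) (fst z)) \<in> borel_measurable borel"
      "(\<lambda>z::'x \<times> real. bump_grad x0 (\<rho> x0) (fst z)) \<in> borel_measurable borel"
      by (auto intro: borel_measurable_continuous_onI)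
    obtain b where b: "\<And>x. norm (bump_grad x0 (\<rho> x0) x) \<le> b" using kernel_bounds(2)[OF kern[OF x0]] by blast
    have s1: "sq_integrable (\<lambda>z. (d z + k) * g z)"
    proof (rule sq_integrable_le[OF gsq, where c = "D + \<bar>k\<bar>"])
      show "norm ((d z + k) * g z) \<le> (D + \<bar>k\<bar>) * norm (g z)" for z
        using d(2)[of z] by (simp add: abs_mult) (intro mult_right_mono, auto)
    qed measurable
    have s2: "sq_integrable (\<lambda>z. bump x0 (\<rho> x0) (fst z) * g z)"
      by (rule sq_integrable_le[OF gsq, where c = "\<rho> x0 ^ 4"]) (auto simp: abs_mult bump_le intro: mult_right_mono)
    have s3: "sq_integrable (\<lambda>z. bump x0 (\<rho> x0) (fst z) *\<^sub>R M z)"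
      by (rule sq_integrable_le[OF Msq, where c = "\<rho> x0 ^ 4"]) (auto simp: bump_le intro: mult_right_mono)
    have s4: "sq_integrable (\<lambda>z. g z *\<^sub>R bump_grad x0 (\<rho> x0) (fst z))"
      by (rule sq_integrable_le[OF gsq, where c = b]) (auto simp: b mult.commute[of b] intro: mult_left_mono)
    show ?thesis unfolding h_def[abs_def]
      using sq_integrable_inner[OF s1 s2] sq_integrable_inner[OF Nsq sq_integrable_add[OF s3 s4]] by simp
  qed
  have hsum: "(\<Sum>x0\<in>S. h x0 z) = (d z + k) * \<Psi> (fst z) * (g z)\<^sup>2 + \<Psi> (fst z) * (N z \<bullet> M z) + g z * (N z \<bullet> V (fst z))" for z
    unfolding h_def \<Psi>_def V_def
    by (simp add: sum.distrib inner_add_right inner_sum_right sum_distrib_left sum_distrib_right power2_eq_square algebra_simps)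
  have low: "q / 2 * (norm (M z))\<^sup>2 + (g z)\<^sup>2 \<le> (\<Sum>x0\<in>S. h x0 z)" for z
  proof (cases "z \<in> \<Omega> \<times> {0<..<T}")
    case True
    then have x: "fst z \<in> closure \<Omega>" using closure_subset[of \<Omega>] by auto
    have E0: "E z > 0" by (simp add: E_def)
    define a b where "a = norm (M z)" and "b = \<bar>g z\<bar>"
    have ab: "a \<ge> 0" "b \<ge> 0" by (simp_all add: a_def b_def)
    have NM: "c0 * a\<^sup>2 \<le> N z \<bullet> M z"
    proof -
      have "c0 * a\<^sup>2 = (E z)\<^sup>2 * (c0 * (norm (m z))\<^sup>2)" by (simp add: a_def M_def power_mult_distrib)
      also have "\<dots> \<le> (E z)\<^sup>2 * (B z \<bullet> m z)" by (intro mult_left_mono coer) simp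
      also have "\<dots> = N z \<bullet> M z" by (simp add: N_def M_def power2_eq_square)
      finally show ?thesis .
    qed
    have t1: "q * a\<^sup>2 \<le> \<Psi> (fst z) * (N z \<bullet> M z)"
    proof -
      have "q * a\<^sup>2 = \<mu> * (c0 * a\<^sup>2)" by (simp add: q_def)
      also have "\<dots> \<le> \<Psi> (fst z) * (N z \<bullet> M z)"
        using \<mu> x NM c0 by (intro mult_mono) (auto intro: order_trans[OF less_imp_le])
      finally show ?thesis .
    qed
    have dk: "0 \<le> k - D" using \<mu>(1) q by (simp add: k_def)
    have t2: "(1 + (Cb * G)\<^sup>2 / (2 * q)) * b\<^sup>2 \<le> (d z + k) * \<Psi> (fst z) * (g z)\<^sup>2"
    proof -
      have "(1 + (Cb * G)\<^sup>2 / (2 * q)) = (k - D) * \<mu>" using \<mu>(1) by (simp add: k_def)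
      also have "\<dots> \<le> (d z + k) * \<Psi> (fst z)"
        using d(2)[of z] \<mu> x dk by (intro mult_mono) (auto simp: abs_le_iff)
      finally show ?thesis unfolding b_def by (simp add: mult_right_mono)
    qed
    have t3: "\<bar>g z * (N z \<bullet> V (fst z))\<bar> \<le> q / 2 * a\<^sup>2 + (Cb * G)\<^sup>2 / (2 * q) * b\<^sup>2"
    proof -
      have nN: "norm (N z) \<le> Cb * a"
        using mult_left_mono[OF Cb[of z] less_imp_le[OF E0]] E0 by (simp add: N_def a_def M_def mult_ac)
      have "\<bar>N z \<bullet> V (fst z)\<bar> \<le> norm (N z) * norm (V (fst z))" by (rule Cauchy_Schwarz_ineq2)
      also have "\<dots> \<le> (Cb * a) * G" using nN G[OF x] order_trans[OF norm_ge_zero nN] by (intro mult_mono) auto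
      finally have "\<bar>g z * (N z \<bullet> V (fst z))\<bar> \<le> b * (Cb * a * G)"
        unfolding abs_mult b_def by (intro mult_left_mono) auto
      moreover have "b * (Cb * a * G) \<le> q / 2 * a\<^sup>2 + (Cb * G)\<^sup>2 / (2 * q) * b\<^sup>2"
      proof -
        \<comment> \<open>Young's inequality with half of the coercive term\<close>
        have "0 \<le> (q * a - Cb * G * b)\<^sup>2 / (2 * q)" using q by simp
        also have "\<dots> = q / 2 * a\<^sup>2 + (Cb * G)\<^sup>2 / (2 * q) * b\<^sup>2 - b * (Cb * a * G)"
          using q by (simp add: power2_eq_square field_simps)
        finally show ?thesis by linarith
      qed
      ultimately show ?thesis by linarith
    qed
    have bb: "(g z)\<^sup>2 = b\<^sup>2" by (simp add: b_def)
    show ?thesis using t1 t2 t3 unfolding hsum a_def[symmetric] abs_le_iff distrib_right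
      by (simp add: bb)
  next
    case False
    then show ?thesis using supp suppB by (simp add: hsum g_def M_def N_def)
  qed
  have int: "integrable lborel (\<lambda>z. q / 2 * (norm (M z))\<^sup>2 + (g z)\<^sup>2)"
    using gsq Msq by (simp add: sq_integrable_def)
  have "(LINT z|lborel. q / 2 * (norm (M z))\<^sup>2 + (g z)\<^sup>2) \<le> (LINT z|lborel. (\<Sum>x0\<in>S. h x0 z))"
    by (rule integral_mono[OF int]) (use hint low in auto)
  also have "\<dots> = (\<Sum>x0\<in>S. LINT z|lborel. h x0 z)" using hint by (rule Bochner_Integration.integral_sum)
  also have "\<dots> \<le> 0" using le0 by (rule sum_nonpos)
  finally have "(LINT z|lborel. q / 2 * (norm (M z))\<^sup>2 + (g z)\<^sup>2) \<le> 0" .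
  moreover have "0 \<le> (LINT z|lborel. q / 2 * (norm (M z))\<^sup>2 + (g z)\<^sup>2)" using q by simp
  ultimately have "(LINT z|lborel. q / 2 * (norm (M z))\<^sup>2 + (g z)\<^sup>2) = 0" by linarith
  then have "AE z in lborel. q / 2 * (norm (M z))\<^sup>2 + (g z)\<^sup>2 = 0"
    using integral_nonneg_eq_0_iff_AE[OF int] q by simp
  then show ?thesis
  proof eventually_elim
    case (elim z)
    then have "q / 2 * (norm (M z))\<^sup>2 = 0 \<and> (g z)\<^sup>2 = 0" using q by (subst (asm) add_nonneg_eq_0_iff) auto
    then show ?case using q by (simp add: M_def g_def E_def)
  qed
qed

section \<open>The energy estimate\<close>

text \<open>The factor \<open>\<kappa>\<close> cuts off at the time \<open>T\<close>, where \<open>u\<close> need not vanish. Together with the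
  support condition it confines all difference quotients to one ball, where the gradient bounds them.\<close>

lemma integral_difference_quotient:
  fixes u \<kappa> :: "'a::euclidean_space \<Rightarrow> real"
  assumes u: "C1_with u Du" and \<kappa>: "\<kappa> \<in> borel_measurable borel" "\<And>z. \<bar>\<kappa> z\<bar> \<le> 1"
    and supp: "\<And>z h. R < norm z \<Longrightarrow> \<kappa> z \<noteq> 0 \<Longrightarrow> 0 \<le> h \<Longrightarrow> h \<le> 1 \<Longrightarrow> u (z + h *\<^sub>R v) = 0"
  shows "\<And>h. 0 \<le> h \<Longrightarrow> h \<le> 1 \<Longrightarrow> integrable lborel (\<lambda>z. \<kappa> z * u (z + h *\<^sub>R v))"
    and "(\<lambda>n. LINT z|lborel. \<kappa> z * ((u (z + (1 / Suc n) *\<^sub>R v) - u z) * Suc n)) \<longlonglongrightarrow> (LINT z|lborel. \<kappa> z * (Du z \<bullet> v))"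
proof -
  have uc: "continuous_on UNIV u" by (rule C1_with_continuous[OF u])
  have Duc: "continuous_on UNIV Du" using u by (simp add: C1_with_def)
  have [measurable]: "u \<in> borel_measurable borel" "Du \<in> borel_measurable borel" "\<kappa> \<in> borel_measurable borel"
    using uc Duc \<kappa>(1) by (auto intro: borel_measurable_continuous_onI)
  define Q where "Q = cball (0::'a) (R + norm v)"
  have cQ: "compact Q" "convex Q" by (simp_all add: Q_def)
  have "bounded (u ` Q)" "bounded (Du ` Q)"
    by (auto intro!: compact_imp_bounded compact_continuous_image cQ continuous_on_subset[OF uc] continuous_on_subset[OF Duc])
  then obtain b G where b: "\<And>z. z \<in> Q \<Longrightarrow> \<bar>u z\<bar> \<le> b" and G: "\<And>z. z \<in> Q \<Longrightarrow> norm (Du z) \<le> G"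
    by (auto simp: bounded_iff)
  have inQ: "z + h *\<^sub>R v \<in> Q" if "norm z \<le> R" "0 \<le> h" "h \<le> 1" for z h
  proof -
    have "norm (z + h *\<^sub>R v) \<le> norm z + h * norm v" using norm_triangle_ineq[of z "h *\<^sub>R v"] that by simp
    also have "\<dots> \<le> R + 1 * norm v" using that by (intro add_mono mult_right_mono) auto
    finally show ?thesis by (simp add: Q_def)
  qed
  show "integrable lborel (\<lambda>z. \<kappa> z * u (z + h *\<^sub>R v))" if h: "0 \<le> h" "h \<le> 1" for h
  proof (rule integrable_bounded_support[where R = R and B = "\<bar>b\<bar>"])
    show "norm (\<kappa> z * u (z + h *\<^sub>R v)) \<le> \<bar>b\<bar>" for z
    proof (cases "norm z \<le> R")
      case True
      then have "\<bar>u (z + h *\<^sub>R v)\<bar> \<le> \<bar>b\<bar>" using b[OF inQ[OF _ h]] by fastforce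
      then have "\<bar>\<kappa> z\<bar> * \<bar>u (z + h *\<^sub>R v)\<bar> \<le> 1 * \<bar>b\<bar>" using \<kappa>(2) by (intro mult_mono) auto
      then show ?thesis by (simp add: abs_mult)
    next
      case False
      then show ?thesis using supp[of z h] h by (cases "\<kappa> z = 0") auto
    qed
    show "\<kappa> z * u (z + h *\<^sub>R v) = 0" if "R < norm z" for z
      using supp[OF that _ h] by (cases "\<kappa> z = 0") auto
  qed measurable
  show "(\<lambda>n. LINT z|lborel. \<kappa> z * ((u (z + (1 / Suc n) *\<^sub>R v) - u z) * Suc n)) \<longlonglongrightarrow> (LINT z|lborel. \<kappa> z * (Du z \<bullet> v))"
  proof (rule integral_dominated_convergence[where w = "\<lambda>z. indicator (cball 0 R) z * (\<bar>G\<bar> * norm v)"])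
    show "integrable lborel (\<lambda>z::'a. indicator (cball 0 R) z * (\<bar>G\<bar> * norm v))"
      using emeasure_lborel_cball_finite[of "0::'a" R]
      by (intro integrable_mult_left) (simp add: integrable_indicator_iff)
    show "AE z in lborel. (\<lambda>n. \<kappa> z * ((u (z + (1 / Suc n) *\<^sub>R v) - u z) * Suc n)) \<longlonglongrightarrow> \<kappa> z * (Du z \<bullet> v)"
    proof (intro AE_I2 tendsto_mult tendsto_const)
      fix z
      have "(u has_derivative (\<lambda>w. Du z \<bullet> w)) (at (z + 0 *\<^sub>R v))" using u by (simp add: C1_with_def)
      moreover have "((\<lambda>h. z + h *\<^sub>R v) has_derivative (\<lambda>h. h *\<^sub>R v)) (at 0)"
        by (auto intro!: derivative_eq_intros)
      ultimately have "((\<lambda>h. u (z + h *\<^sub>R v)) has_derivative (\<lambda>h. Du z \<bullet> (h *\<^sub>R v))) (at 0)"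
        by (rule has_derivative_compose[rotated])
      then have "((\<lambda>h. u (z + h *\<^sub>R v)) has_real_derivative (Du z \<bullet> v)) (at 0)"
        by (simp add: has_field_derivative_def mult_commute_abs)
      then have "((\<lambda>h. (u (z + h *\<^sub>R v) - u z) / h) \<longlongrightarrow> Du z \<bullet> v) (at 0)"
        by (simp add: DERIV_def)
      moreover have "filterlim (\<lambda>n. 1 / real (Suc n)) (at 0) sequentially"
        unfolding filterlim_at using LIMSEQ_inverse_real_of_nat by (simp add: inverse_eq_divide)
      ultimately have "(\<lambda>n. (u (z + (1 / real (Suc n)) *\<^sub>R v) - u z) / (1 / real (Suc n))) \<longlonglongrightarrow> Du z \<bullet> v"
        by (rule filterlim_compose)
      then show "(\<lambda>n. (u (z + (1 / Suc n) *\<^sub>R v) - u z) * Suc n) \<longlonglongrightarrow> Du z \<bullet> v" by simp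
    qed
    show "AE z in lborel. norm (\<kappa> z * ((u (z + (1 / Suc n) *\<^sub>R v) - u z) * Suc n)) \<le> indicator (cball 0 R) z * (\<bar>G\<bar> * norm v)" for n
    proof (rule AE_I2)
      fix z
      define h where "h = 1 / real (Suc n)"
      have h: "0 < h" "h \<le> 1" "h * Suc n = 1" by (simp_all add: h_def)
      show "norm (\<kappa> z * ((u (z + (1 / Suc n) *\<^sub>R v) - u z) * Suc n)) \<le> indicator (cball 0 R) z * (\<bar>G\<bar> * norm v)"
      proof (cases "norm z \<le> R")
        case True
        have z: "z + h *\<^sub>R v \<in> Q" "z \<in> Q" using inQ[OF True, of h] inQ[OF True, of 0] h by auto
        have "norm (u (z + h *\<^sub>R v) - u z) \<le> \<bar>G\<bar> * norm ((z + h *\<^sub>R v) - z)"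
        proof (rule differentiable_bound[OF cQ(2) _ _ z])
          fix x assume x: "x \<in> Q"
          show "(u has_derivative (\<lambda>w. Du x \<bullet> w)) (at x within Q)"
            using u by (auto simp: C1_with_def intro: has_derivative_at_withinI)
          show "onorm (\<lambda>w. Du x \<bullet> w) \<le> \<bar>G\<bar>"
          proof (rule onorm_le)
            fix w
            have "norm (Du x \<bullet> w) \<le> norm (Du x) * norm w" by (simp add: Cauchy_Schwarz_ineq2)
            also have "\<dots> \<le> \<bar>G\<bar> * norm w" using G[OF x] by (intro mult_right_mono) auto
            finally show "norm (Du x \<bullet> w) \<le> \<bar>G\<bar> * norm w" .
          qed
        qed
        then have "\<bar>u (z + h *\<^sub>R v) - u z\<bar> * Suc n \<le> (\<bar>G\<bar> * (h * norm v)) * Suc n"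
          using h by (intro mult_right_mono) auto
        also have "\<dots> = \<bar>G\<bar> * norm v * (h * Suc n)" by (simp only: mult_ac)
        also have "\<dots> = \<bar>G\<bar> * norm v" unfolding h(3) by simp
        finally have "\<bar>\<kappa> z\<bar> * (\<bar>u (z + h *\<^sub>R v) - u z\<bar> * Suc n) \<le> 1 * (\<bar>G\<bar> * norm v)"
          by (intro mult_mono[OF \<kappa>(2)]) auto
        then show ?thesis using True by (simp add: abs_mult h_def)
      next
        case False
        then show ?thesis using supp[of z h] supp[of z 0] h by (cases "\<kappa> z = 0") (auto simp: h_def)
      qed
    qed
  qed measurable
qed

text \<open>The gradient vanishes where \<open>u\<close> vanishes in a neighbourhood; at \<open>t = 0\<close> it does so by continuity from
  negative times.\<close>

lemma interior_test_gradient_zero: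
  assumes u: "interior_test \<Omega> u Du" and z: "fst z \<notin> \<Omega> \<or> snd z \<le> 0"
  shows "Du z = 0"
proof -
  obtain K where K: "compact K" "K \<subseteq> \<Omega>" "\<And>x t. x \<notin> K \<or> t \<le> 0 \<Longrightarrow> u (x, t) = 0"
    using u unfolding interior_test_def by blast
  have C: "C1_with u Du" using u by (simp add: interior_test_def)
  have zero: "Du z = 0" if "open W" "z \<in> W" "\<And>w. w \<in> W \<Longrightarrow> u w = 0" for W z
  proof -
    have "(u has_derivative (\<lambda>w. Du z \<bullet> w)) (at z)" using C unfolding C1_with_def by blast
    then have "((\<lambda>_. 0) has_derivative (\<lambda>w. Du z \<bullet> w)) (at z)"
      by (rule has_derivative_transform_within_open[OF _ that])
    from has_derivative_unique[OF this has_derivative_const] have "Du z \<bullet> Du z = 0"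
      by (rule fun_cong)
    then show ?thesis by simp
  qed
  show ?thesis
  proof (cases "fst z \<in> K")
    case False
    have "open ((- K) \<times> (UNIV :: real set))"
      using K(1) by (intro open_Times) (auto simp: compact_imp_closed open_Compl)
    then show ?thesis using False K(3) by (intro zero[of "(- K) \<times> UNIV"]) (auto simp: mem_Times_iff)
  next
    case True
    then have t: "snd z \<le> 0" using z K(2) by auto
    have "Du (z - (0, 1 / real (Suc n))) = 0" for n
    proof (rule zero[of "UNIV \<times> {..<0}"])
      have "0 < 1 / real (Suc n)" by simp
      then have "snd z - 1 / real (Suc n) < 0" using t by linarith
      then show "z - (0, 1 / real (Suc n)) \<in> UNIV \<times> {..<0}"
        by (simp only: mem_Times_iff snd_diff snd_conv UNIV_I lessThan_iff simp_thms)
      show "open ((UNIV :: 'a set) \<times> {..<0::real})" by (intro open_Times) auto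
      fix w :: "'a \<times> real" assume "w \<in> UNIV \<times> {..<0}"
      then show "u w = 0" using K(3)[of "fst w" "snd w"] by (simp add: mem_Times_iff)
    qed
    moreover have "(\<lambda>n. Du (z - (0, 1 / real (Suc n)))) \<longlonglongrightarrow> Du (z - (0, 0))"
    proof (rule isCont_tendsto_compose[where g = Du])
      show "isCont Du (z - (0, 0))" using C unfolding C1_with_def continuous_on_eq_continuous_at[OF open_UNIV] by blast
      have "(\<lambda>n. 1 / real (Suc n)) \<longlonglongrightarrow> 0"
        using LIMSEQ_inverse_real_of_nat by (simp add: inverse_eq_divide)
      then show "(\<lambda>n. z - (0, 1 / real (Suc n))) \<longlonglongrightarrow> z - (0, 0)" by (intro tendsto_intros)
    qed
    ultimately have "(\<lambda>n::nat. 0) \<longlonglongrightarrow> Du (z - (0, 0))" by simp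
    from LIMSEQ_unique[OF this tendsto_const] show ?thesis by (simp add: zero_prod_def[symmetric])
  qed
qed

lemma integrable_lebesgue_on_continuous:
  fixes f :: "'a::euclidean_space \<Rightarrow> 'b::euclidean_space"
  assumes S: "open S" "bounded S" and f: "continuous_on UNIV f"
  shows "integrable (lebesgue_on S) f"
    and "(LINT z|lebesgue_on S. f z) = (LINT z|lborel. indicator S z *\<^sub>R f z)"
    and "f \<in> borel_measurable (lebesgue_on S)"
proof -
  have [measurable]: "f \<in> borel_measurable borel" "S \<in> sets borel" using f S by (auto intro: borel_measurable_continuous_onI)
  show fm: "f \<in> borel_measurable (lebesgue_on S)"
    by (intro measurable_restrict_space1 measurable_completion) simp
  have hm: "(\<lambda>z. indicator S z *\<^sub>R f z) \<in> borel_measurable borel" by measurable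
  have ae: "AE z in lebesgue_on S. indicator S z *\<^sub>R f z = f z" by (rule AE_I2) simp
  note rep = integral_borel_representative[OF _ fm hm _ ae]
  show "(LINT z|lebesgue_on S. f z) = (LINT z|lborel. indicator S z *\<^sub>R f z)" using rep(2) by simp
  obtain R where R: "\<And>z. z \<in> S \<Longrightarrow> norm z \<le> R" using S(2) by (auto simp: bounded_iff)
  have "bounded (f ` cball 0 R)"
    by (intro compact_imp_bounded compact_continuous_image continuous_on_subset[OF f]) auto
  then obtain b where b: "\<And>z. norm z \<le> R \<Longrightarrow> norm (f z) \<le> b" by (fastforce simp: bounded_iff)
  have "integrable lborel (\<lambda>z. indicator S z *\<^sub>R f z)"
  proof (rule integrable_bounded_support[where R = R and B = "\<bar>b\<bar>"])
    show "norm (indicator S z *\<^sub>R f z) \<le> \<bar>b\<bar>" for z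
      using b[OF R, of z] by (cases "z \<in> S") auto
    show "indicator S z *\<^sub>R f z = 0" if "R < norm z" for z using R[of z] that by (cases "z \<in> S") auto
  qed measurable
  then show "integrable (lebesgue_on S) f" using rep(1) by simp
qed

text \<open>Integration by parts without iterated integrals: the integral of a spatial derivative is a limit of
  integrals of difference quotients, which are zero by translation invariance. For the time derivative
  a backward shift turns the cut-off \<open>t < T\<close> into \<open>t < T - h\<close>, which can only decrease the integral of a nonnegative \<open>u\<close>.
  The boundary term at \<open>T\<close> thus enters with its sign.\<close>

lemma integral_interior_test_gradient:
  fixes \<Omega> :: "'x::euclidean_space set"
  assumes \<Omega>: "open \<Omega>" "bounded \<Omega>" and u: "interior_test \<Omega> u Du"
  shows "(LINT z|lebesgue_on (\<Omega> \<times> {0<..<T}). fst (Du z) \<bullet> b) = 0"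
    and "(\<And>z. 0 \<le> u z) \<Longrightarrow> 0 \<le> (LINT z|lebesgue_on (\<Omega> \<times> {0<..<T}). snd (Du z))"
proof -
  obtain K where K: "compact K" "K \<subseteq> \<Omega>" "\<And>x t. x \<notin> K \<or> t \<le> 0 \<Longrightarrow> u (x, t) = 0"
    using u unfolding interior_test_def by blast
  have C: "C1_with u Du" using u by (simp add: interior_test_def)
  have Dc: "continuous_on UNIV Du" using C by (simp add: C1_with_def)
  have [measurable]: "u \<in> borel_measurable borel"
    by (rule borel_measurable_continuous_onI[OF C1_with_continuous[OF C]])
  obtain Rx where Rx: "\<And>x. x \<in> K \<Longrightarrow> norm x \<le> Rx" using compact_imp_bounded[OF K(1)] by (auto simp: bounded_iff)
  have opn: "open (\<Omega> \<times> {0<..<T})" "bounded (\<Omega> \<times> {0<..<T})" using \<Omega> by (auto intro: open_Times bounded_Times)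
  define \<kappa> :: "'x \<times> real \<Rightarrow> real" where "\<kappa> z = indicator {..<T} (snd z)" for z
  have "(snd :: 'x \<times> real \<Rightarrow> real) \<in> borel_measurable borel"
    by (intro borel_measurable_continuous_onI continuous_on_snd continuous_on_id)
  then have \<kappa>m [measurable]: "\<kappa> \<in> borel_measurable borel" unfolding \<kappa>_def[abs_def] by measurable
  have \<kappa>1: "\<bar>\<kappa> z\<bar> \<le> 1" for z by (simp add: \<kappa>_def split: split_indicator)
  \<comment> \<open>laterally and at \<open>t = 0\<close> the gradient vanishes anyway, so only the cut-off at \<open>T\<close> remains\<close>
  have restrict: "(LINT z|lebesgue_on (\<Omega> \<times> {0<..<T}). Du z \<bullet> v) = (LINT z|lborel. \<kappa> z * (Du z \<bullet> v))" for v
  proof -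
    have "(LINT z|lebesgue_on (\<Omega> \<times> {0<..<T}). Du z \<bullet> v) = (LINT z|lborel. indicator (\<Omega> \<times> {0<..<T}) z *\<^sub>R (Du z \<bullet> v))"
      by (rule integrable_lebesgue_on_continuous(2)[OF opn]) (intro continuous_intros Dc)
    also have "\<dots> = (LINT z|lborel. \<kappa> z * (Du z \<bullet> v))"
    proof (intro Bochner_Integration.integral_cong refl)
      fix z :: "'x \<times> real"
      show "indicator (\<Omega> \<times> {0<..<T}) z *\<^sub>R (Du z \<bullet> v) = \<kappa> z * (Du z \<bullet> v)"
        using interior_test_gradient_zero[OF u, of z]
        by (cases "fst z \<in> \<Omega> \<and> 0 < snd z") (auto simp: \<kappa>_def indicator_def mem_Times_iff)
    qed
    finally show ?thesis .
  qed
  have supp: "u (z + h *\<^sub>R v) = 0"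
    if z: "Rx + \<bar>T\<bar> + norm v < norm z" "\<kappa> z \<noteq> 0" and h: "0 \<le> h" "h \<le> 1" and v: "snd v \<le> 0" for z v and h :: real
  proof (rule ccontr)
    assume "u (z + h *\<^sub>R v) \<noteq> 0"
    then have k: "fst z + h *\<^sub>R fst v \<in> K" "0 < snd z + h * snd v"
      using K(3)[of "fst z + h *\<^sub>R fst v" "snd z + h * snd v"] by (auto simp: prod_eq_iff plus_prod_def scaleR_prod_def not_le[symmetric])
    have "h * snd v \<le> 0" using h v by (simp add: mult_nonneg_nonpos)
    then have "0 < snd z" "snd z < T" using k(2) z(2) by (auto simp: \<kappa>_def indicator_def split: if_splits)
    moreover have "norm (fst z) \<le> Rx + norm v"
    proof -
      have "norm (fst z) \<le> norm (fst z + h *\<^sub>R fst v) + norm (h *\<^sub>R fst v)"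
        using norm_triangle_ineq4[of "fst z + h *\<^sub>R fst v" "h *\<^sub>R fst v"] by simp
      also have "\<dots> \<le> Rx + 1 * norm v"
      proof (rule add_mono[OF Rx[OF k(1)]])
        show "norm (h *\<^sub>R fst v) \<le> 1 * norm v"
          using mult_mono[OF h(2), of "norm (fst v)" "norm v"] h norm_fst_le[of "fst v" "snd v"] by simp
      qed
      finally show ?thesis by simp
    qed
    ultimately show False using norm_Pair_le[of "fst z" "snd z"] z(1) by simp
  qed
  have zero: "(\<lambda>z. \<kappa> z * ((u (z + h *\<^sub>R v) - u z) * c)) = (\<lambda>z. (\<kappa> z * u (z + h *\<^sub>R v) - \<kappa> z * u (z + 0 *\<^sub>R v)) * c)" for h v c
    by (simp add: fun_eq_iff algebra_simps)
  show "(LINT z|lebesgue_on (\<Omega> \<times> {0<..<T}). fst (Du z) \<bullet> b) = 0"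
  proof -
    let ?v = "(b, 0::real)"
    have i: "integrable lborel (\<lambda>z. \<kappa> z * u (z + h *\<^sub>R ?v))" if "0 \<le> h" "h \<le> 1" for h
      by (rule integral_difference_quotient(1)[OF C \<kappa>m \<kappa>1 supp[of ?v] that]) auto
    have lim: "(\<lambda>n. LINT z|lborel. \<kappa> z * ((u (z + (1 / Suc n) *\<^sub>R ?v) - u z) * Suc n)) \<longlonglongrightarrow> (LINT z|lborel. \<kappa> z * (Du z \<bullet> ?v))"
      by (rule integral_difference_quotient(2)[OF C \<kappa>m \<kappa>1 supp[of ?v]]) auto
    have "(LINT z|lborel. \<kappa> z * ((u (z + (1 / Suc n) *\<^sub>R ?v) - u z) * Suc n)) = 0" for n
    proof -
      define h where "h = 1 / real (Suc n)"
      have h: "0 \<le> h" "h \<le> 1" by (simp_all add: h_def)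
      define w where "w = h *\<^sub>R ?v"
      have \<kappa>w: "\<kappa> (z + w) = \<kappa> z" for z by (simp add: w_def \<kappa>_def)
      have m: "(\<lambda>z. \<kappa> z * u z) \<in> borel_measurable borel" by measurable
      have "(LINT z|lborel. \<kappa> z * u (z + w)) = (LINT z|lborel. \<kappa> z * u z)"
        using integral_translate(1)[OF m, of "- w"] by (simp add: \<kappa>w)
      then show ?thesis
        unfolding zero unfolding h_def[symmetric] w_def[symmetric]
        using Bochner_Integration.integral_diff[OF i[OF h] i[of 0]] by (simp add: w_def zero_prod_def[symmetric])
    qed
    then have "(\<lambda>n::nat. 0) \<longlonglongrightarrow> (LINT z|lborel. \<kappa> z * (Du z \<bullet> ?v))" using lim by simp
    from LIMSEQ_unique[OF this tendsto_const] have "(LINT z|lebesgue_on (\<Omega> \<times> {0<..<T}). Du z \<bullet> ?v) = 0"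
      unfolding restrict .
    then show ?thesis by (simp add: inner_prod_def)
  qed
  assume pos: "\<And>z. 0 \<le> u z"
  show "0 \<le> (LINT z|lebesgue_on (\<Omega> \<times> {0<..<T}). snd (Du z))"
  proof -
    \<comment> \<open>a backward direction is used because \<open>u\<close> vanishes before time \<open>0\<close> but not after time \<open>T\<close>\<close>
    let ?v = "(0::'x, - 1::real)"
    have i: "integrable lborel (\<lambda>z. \<kappa> z * u (z + h *\<^sub>R ?v))" if "0 \<le> h" "h \<le> 1" for h
      by (rule integral_difference_quotient(1)[OF C \<kappa>m \<kappa>1 supp[of ?v] that]) auto
    have lim: "(\<lambda>n. LINT z|lborel. \<kappa> z * ((u (z + (1 / Suc n) *\<^sub>R ?v) - u z) * Suc n)) \<longlonglongrightarrow> (LINT z|lborel. \<kappa> z * (Du z \<bullet> ?v))"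
      by (rule integral_difference_quotient(2)[OF C \<kappa>m \<kappa>1 supp[of ?v]]) auto
    have le: "(LINT z|lborel. \<kappa> z * ((u (z + (1 / Suc n) *\<^sub>R ?v) - u z) * Suc n)) \<le> 0" for n
    proof -
      define h where "h = 1 / real (Suc n)"
      have h: "0 \<le> h" "h \<le> 1" by (simp_all add: h_def)
      define \<kappa>' where "\<kappa>' z = \<kappa> (z + (0, h))" for z
      have [measurable]: "\<kappa>' \<in> borel_measurable borel" unfolding \<kappa>'_def by measurable
      have m: "(\<lambda>z. \<kappa>' z * u z) \<in> borel_measurable borel" by measurable
      have sh: "z + h *\<^sub>R ?v = z - (0, h)" for z by (simp add: prod_eq_iff)
      have tr: "(LINT z|lborel. \<kappa> z * u (z + h *\<^sub>R ?v)) = (LINT z|lborel. \<kappa>' z * u z)"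
        using integral_translate(1)[OF m, of "(0, h)"] unfolding sh by (simp add: \<kappa>'_def)
      have int': "integrable lborel (\<lambda>z. \<kappa>' z * u z)"
        using integral_translate(2)[OF m, of "(0, h)"] i[OF h] unfolding sh by (simp add: \<kappa>'_def)
      have "(LINT z|lborel. \<kappa>' z * u z) \<le> (LINT z|lborel. \<kappa> z * u z)"
      proof (rule integral_mono[OF int'])
        show "integrable lborel (\<lambda>z. \<kappa> z * u z)" using i[of 0] by (simp add: zero_prod_def[symmetric])
        show "\<kappa>' z * u z \<le> \<kappa> z * u z" for z
          using pos[of z] h by (intro mult_right_mono) (auto simp: \<kappa>'_def \<kappa>_def split: split_indicator)
      qed
      then have "(LINT z|lborel. \<kappa> z * u (z + h *\<^sub>R ?v)) - (LINT z|lborel. \<kappa> z * u (z + 0 *\<^sub>R ?v)) \<le> 0"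
        unfolding tr by (simp add: zero_prod_def[symmetric])
      then have "((LINT z|lborel. \<kappa> z * u (z + h *\<^sub>R ?v)) - (LINT z|lborel. \<kappa> z * u (z + 0 *\<^sub>R ?v))) * Suc n \<le> 0"
        by (intro mult_nonpos_nonneg) auto
      then show ?thesis unfolding zero h_def[symmetric]
        using Bochner_Integration.integral_diff[OF i[OF h] i[of 0]] by simp
    qed
    have "(LINT z|lborel. \<kappa> z * (Du z \<bullet> ?v)) \<le> 0"
      by (rule LIMSEQ_le_const2[OF lim]) (use le in blast)
    then have "(LINT z|lebesgue_on (\<Omega> \<times> {0<..<T}). Du z \<bullet> ?v) \<le> 0" unfolding restrict .
    then show ?thesis by (simp add: inner_prod_def)
  qed
qed

lemma interior_test_mult:
  assumes "C1_with a Da" "interior_test \<Omega> y Dy"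
  shows "interior_test \<Omega> (\<lambda>z. a z * y z) (\<lambda>z. a z *\<^sub>R Dy z + y z *\<^sub>R Da z)"
  using assms C1_with_mult[of a Da y Dy] unfolding interior_test_def by fastforce

text \<open>Multiply \<open>I\<close> by \<open>w y\<close> with \<open>w = exp(-2kt)\<close>. The terms \<open>y y\<^sub>t\<close> and \<open>- y div p\<close> become \<open>(w y\<^sup>2)\<^sub>t / 2 + k w y\<^sup>2\<close> and
  \<open>w p \<bullet> \<nabla>y\<close> up to a divergence; the integral of the derivative is nonnegative, that of the divergence is zero. Since
  \<open>p = c \<nabla>y - J\<close>, coercivity bounds \<open>p \<bullet> \<nabla>y\<close> below by a multiple of \<open>- \<parallel>J\<parallel>\<^sup>2\<close>. With
  \<open>k = D + 1\<close> the zero order terms dominate \<open>d y\<^sup>2\<close> and \<open>y I\<close>.\<close>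

lemma energy_estimate:
  fixes \<Omega> :: "(real ^ 'n::finite) set" and c :: "real ^ 'n \<Rightarrow> real ^ 'n ^ 'n"
  assumes \<Omega>: "open \<Omega>" "bounded \<Omega>" and T: "T > 0" and c0: "c0 > 0"
    and coer: "\<And>x \<xi>. x \<in> \<Omega> \<Longrightarrow> c0 * (norm \<xi>)\<^sup>2 \<le> (c x *v \<xi>) \<bullet> \<xi>"
    and D: "D \<ge> 0" "AE z in lebesgue_on (\<Omega> \<times> {0<..<T}). \<bar>d z\<bar> \<le> D"
    and y: "interior_test \<Omega> y Dy" and p: "\<And>i. C1_with (\<lambda>z. p z $ i) (Dp i)"
    and I: "I \<in> L2 (\<Omega> \<times> {0<..<T})" "\<And>z. z \<in> \<Omega> \<times> {0<..<T} \<Longrightarrow>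
      I z = snd (Dy z) - (\<Sum>i\<in>UNIV. fst (Dp i z) $ i) + d z * y z"
    and J: "J \<in> L2 (\<Omega> \<times> {0<..<T})" "\<And>z. z \<in> \<Omega> \<times> {0<..<T} \<Longrightarrow> J z = c (fst z) *v fst (Dy z) - p z"
  shows "y \<in> L2 (\<Omega> \<times> {0<..<T})"
    and "(L2_norm (\<Omega> \<times> {0<..<T}) y)\<^sup>2 \<le> exp (2 * (D + 1) * T) * max 1 (1 / (2 * c0)) *
      ((L2_norm (\<Omega> \<times> {0<..<T}) I)\<^sup>2 + (L2_norm (\<Omega> \<times> {0<..<T}) J)\<^sup>2)"
proof -
  let ?Q = "\<Omega> \<times> {0<..<T}" and ?M = "lebesgue_on (\<Omega> \<times> {0<..<T})"
  have Q: "open ?Q" "bounded ?Q" using \<Omega> by (auto intro: open_Times bounded_Times)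
  define k where "k = D + 1"
  define w where "w z = exp (- 2 * k * snd z)" for z :: "(real ^ 'n) \<times> real"
  define Dw where "Dw z = (0 :: real ^ 'n, - 2 * k * w z)" for z
  have w: "C1_with w Dw" unfolding w_def[abs_def] Dw_def[abs_def] by (rule C1_with_exp_snd)
  have yC: "C1_with y Dy" using y by (simp add: interior_test_def)
  have yc: "continuous_on UNIV y" by (rule C1_with_continuous[OF yC])
  have wc: "continuous_on UNIV w" by (rule C1_with_continuous[OF w])
  note wy = interior_test_mult[OF w y]
  note t1 = interior_test_mult[OF yC wy] and t2 = interior_test_mult[OF p wy]
  define Dt where "Dt z = y z *\<^sub>R (w z *\<^sub>R Dy z + y z *\<^sub>R Dw z) + (w z * y z) *\<^sub>R Dy z" for z
  define Ds where "Ds i z = p z $ i *\<^sub>R (w z *\<^sub>R Dy z + y z *\<^sub>R Dw z) + (w z * y z) *\<^sub>R Dp i z" for i z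
  have Dt: "interior_test \<Omega> (\<lambda>z. y z * (w z * y z)) Dt" unfolding Dt_def[abs_def] by (rule t1)
  have Ds: "interior_test \<Omega> (\<lambda>z. p z $ i * (w z * y z)) (Ds i)" for i unfolding Ds_def[abs_def] by (rule t2)
  have w0: "w z > 0" for z by (simp add: w_def)
  have "0 \<le> y z * (w z * y z)" for z using w0[of z] by (simp add: zero_le_mult_iff mult.left_commute)
  then have tpos: "0 \<le> (LINT z|?M. snd (Dt z))" by (rule integral_interior_test_gradient(2)[OF \<Omega> Dt])
  have szero: "(LINT z|?M. fst (Ds i z) \<bullet> axis i 1) = 0" for i by (rule integral_interior_test_gradient(1)[OF \<Omega> Ds])
  have Dtc: "continuous_on UNIV Dt" and Dsc: "continuous_on UNIV (Ds i)" for i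
    using Dt Ds by (auto simp: interior_test_def C1_with_def)
  have it: "integrable ?M (\<lambda>z. snd (Dt z))"
    by (rule integrable_lebesgue_on_continuous(1)[OF Q]) (intro continuous_intros Dtc)
  have ih: "integrable ?M (\<lambda>z. fst (Ds i z) \<bullet> axis i 1)" for i
    by (rule integrable_lebesgue_on_continuous(1)[OF Q]) (intro continuous_intros Dsc)
  have iwy: "integrable ?M (\<lambda>z. w z * (y z)\<^sup>2)"
    by (rule integrable_lebesgue_on_continuous(1)[OF Q]) (intro continuous_intros wc yc)
  have iy: "integrable ?M (\<lambda>z. (y z)\<^sup>2)"
    by (rule integrable_lebesgue_on_continuous(1)[OF Q]) (intro continuous_intros yc)
  have iI: "integrable ?M (\<lambda>z. (I z)\<^sup>2)" using I(1) by (simp add: L2_def)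
  have iJ: "integrable ?M (\<lambda>z. (norm (J z))\<^sup>2)" using J(1) by (simp add: L2_def)
  show "y \<in> L2 ?Q" using iy integrable_lebesgue_on_continuous(3)[OF Q yc] by (simp add: L2_def)
  have k0: "k \<ge> 0" "k \<ge> D + 1" using D(1) by (auto simp: k_def)
  have wle: "w z \<le> 1" "exp (- 2 * k * T) \<le> w z" if "z \<in> ?Q" for z
    using that k0(1) by (auto simp: w_def mult_left_mono)
  \<comment> \<open>the constant in \<open>\<parallel>J\<parallel> \<parallel>g\<parallel> \<le> c0 \<parallel>g\<parallel>\<^sup>2 + \<beta> \<parallel>J\<parallel>\<^sup>2\<close>\<close>
  define \<beta> where "\<beta> = 1 / (4 * c0)"
  have \<beta>: "\<beta> > 0" using c0 by (simp add: \<beta>_def)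
  have pointwise: "w z * (y z)\<^sup>2 / 2 \<le> (I z)\<^sup>2 / 2 + \<beta> * (norm (J z))\<^sup>2 - snd (Dt z) / 2 + (\<Sum>i\<in>UNIV. fst (Ds i z) \<bullet> axis i 1)"
    if z: "z \<in> ?Q" and dz: "\<bar>d z\<bar> \<le> D" for z
  proof -
    define g where "g = fst (Dy z)"
    have ed: "snd (Dt z) / 2 = w z * (y z * snd (Dy z)) - k * (w z * (y z)\<^sup>2)"
      by (simp add: Dt_def Dw_def power2_eq_square field_simps)
    have es: "(\<Sum>i\<in>UNIV. fst (Ds i z) \<bullet> axis i 1) = w z * (p z \<bullet> g) + w z * (y z * (\<Sum>i\<in>UNIV. fst (Dp i z) $ i))"
    proof -
      have "p z \<bullet> g = (\<Sum>i\<in>UNIV. p z $ i * g $ i)" by (simp add: inner_vec_def)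
      then show ?thesis
        by (simp add: Ds_def Dw_def inner_axis g_def sum.distrib sum_distrib_left algebra_simps)
    qed
    have eI: "y z * (\<Sum>i\<in>UNIV. fst (Dp i z) $ i) = y z * snd (Dy z) + d z * (y z)\<^sup>2 - y z * I z"
    proof -
      have S: "(\<Sum>i\<in>UNIV. fst (Dp i z) $ i) = snd (Dy z) + d z * y z - I z" using I(2)[OF z] by simp
      show ?thesis unfolding S by (simp add: power2_eq_square algebra_simps)
    qed
    have "p z \<bullet> g = (c (fst z) *v g) \<bullet> g - J z \<bullet> g"
      using J(2)[OF z] by (simp add: g_def inner_diff_left)
    moreover have "c0 * (norm g)\<^sup>2 \<le> (c (fst z) *v g) \<bullet> g" using z by (intro coer) auto
    moreover have "J z \<bullet> g \<le> norm (J z) * norm g" by (rule norm_cauchy_schwarz)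
    moreover have "norm (J z) * norm g \<le> c0 * (norm g)\<^sup>2 + \<beta> * (norm (J z))\<^sup>2"
    proof -
      have "0 \<le> (2 * c0 * norm g - norm (J z))\<^sup>2 * \<beta>" using \<beta> by simp
      also have "\<dots> = c0 * (norm g)\<^sup>2 + \<beta> * (norm (J z))\<^sup>2 - norm (J z) * norm g"
        using c0 by (simp add: \<beta>_def power2_eq_square field_simps)
      finally show ?thesis by linarith
    qed
    ultimately have pg: "- (\<beta> * (norm (J z))\<^sup>2) \<le> p z \<bullet> g" by linarith
    have yI: "y z * I z \<le> (y z)\<^sup>2 / 2 + (I z)\<^sup>2 / 2"
      using sum_squares_bound[of "y z" "I z"] by linarith
    have "- D * (y z)\<^sup>2 \<le> d z * (y z)\<^sup>2" using dz by (intro mult_right_mono) auto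
    moreover have "(D + 1) * (y z)\<^sup>2 \<le> k * (y z)\<^sup>2" using k0 by (intro mult_right_mono) auto
    ultimately have "(y z)\<^sup>2 / 2 \<le> (I z)\<^sup>2 / 2 + \<beta> * (norm (J z))\<^sup>2
        + (p z \<bullet> g + d z * (y z)\<^sup>2 - y z * I z + k * (y z)\<^sup>2)"
      using pg yI unfolding distrib_right by linarith
    from mult_left_mono[OF this less_imp_le[OF w0[of z]]]
    have "w z * (y z)\<^sup>2 / 2 \<le> w z * ((I z)\<^sup>2 / 2 + \<beta> * (norm (J z))\<^sup>2) - snd (Dt z) / 2
        + (\<Sum>i\<in>UNIV. fst (Ds i z) \<bullet> axis i 1)"
      unfolding ed es eI by (simp add: algebra_simps)
    moreover have "w z * ((I z)\<^sup>2 / 2 + \<beta> * (norm (J z))\<^sup>2) \<le> 1 * ((I z)\<^sup>2 / 2 + \<beta> * (norm (J z))\<^sup>2)"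
      using wle(1)[OF z] \<beta> by (intro mult_right_mono) auto
    ultimately show ?thesis unfolding mult_1 by argo
  qed
  have Qm: "?Q \<in> sets borel" using Q(1) by simp
  have "(LINT z|?M. w z * (y z)\<^sup>2 / 2) \<le> (LINT z|?M. (I z)\<^sup>2 / 2 + \<beta> * (norm (J z))\<^sup>2 - snd (Dt z) / 2
      + (\<Sum>i\<in>UNIV. fst (Ds i z) \<bullet> axis i 1))"
  proof (rule integral_mono_AE)
    show "AE z in ?M. w z * (y z)\<^sup>2 / 2 \<le> (I z)\<^sup>2 / 2 + \<beta> * (norm (J z))\<^sup>2 - snd (Dt z) / 2
        + (\<Sum>i\<in>UNIV. fst (Ds i z) \<bullet> axis i 1)"
      using D(2) unfolding AE_lebesgue_on_iff[OF Qm]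
      by eventually_elim (use pointwise in blast)
  qed (use iwy iI iJ it ih in simp_all)
  also have "\<dots> = (LINT z|?M. (I z)\<^sup>2) / 2 + \<beta> * (LINT z|?M. (norm (J z))\<^sup>2) - (LINT z|?M. snd (Dt z)) / 2"
    using iI iJ it ih by (simp add: Bochner_Integration.integral_sum szero)
  also have "\<dots> \<le> (LINT z|?M. (I z)\<^sup>2) / 2 + \<beta> * (LINT z|?M. (norm (J z))\<^sup>2)" using tpos by simp
  finally have e1: "(LINT z|?M. w z * (y z)\<^sup>2) \<le> (LINT z|?M. (I z)\<^sup>2) + 2 * \<beta> * (LINT z|?M. (norm (J z))\<^sup>2)"
    using iwy by simp
  have "(LINT z|?M. exp (- 2 * k * T) * (y z)\<^sup>2) \<le> (LINT z|?M. w z * (y z)\<^sup>2)"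
    using iy iwy wle(2) by (intro integral_mono) (auto intro: mult_right_mono)
  then have e2: "exp (- 2 * k * T) * (LINT z|?M. (y z)\<^sup>2) \<le> (LINT z|?M. w z * (y z)\<^sup>2)" by simp
  have nI: "0 \<le> (LINT z|?M. (I z)\<^sup>2)" and nJ: "0 \<le> (LINT z|?M. (norm (J z))\<^sup>2)" by simp_all
  define m where "m = max 1 (1 / (2 * c0))"
  have m: "1 \<le> m" "2 * \<beta> \<le> m" by (auto simp: m_def \<beta>_def)
  have "exp (- 2 * k * T) * (LINT z|?M. (y z)\<^sup>2) \<le> m * (LINT z|?M. (I z)\<^sup>2) + m * (LINT z|?M. (norm (J z))\<^sup>2)"
    using e1 e2 mult_right_mono[OF m(1) nI] mult_right_mono[OF m(2) nJ] by linarith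
  then have "exp (2 * k * T) * (exp (- 2 * k * T) * (LINT z|?M. (y z)\<^sup>2))
      \<le> exp (2 * k * T) * (m * ((LINT z|?M. (I z)\<^sup>2) + (LINT z|?M. (norm (J z))\<^sup>2)))"
    by (intro mult_left_mono) (auto simp: distrib_left)
  then have "(LINT z|?M. (y z)\<^sup>2) \<le> exp (2 * k * T) * m * ((LINT z|?M. (I z)\<^sup>2) + (LINT z|?M. (norm (J z))\<^sup>2))"
    by (simp add: mult.assoc[symmetric] exp_add[symmetric])
  then show "(L2_norm ?Q y)\<^sup>2 \<le> exp (2 * (D + 1) * T) * max 1 (1 / (2 * c0)) * ((L2_norm ?Q I)\<^sup>2 + (L2_norm ?Q J)\<^sup>2)"
    unfolding L2_norm_def m_def k_def by simp
qed

section \<open>The weighted operators as a linear map into a Hilbert space\<close>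

text \<open>Zero extensions from \<open>S\<close> form an orthogonal complement, which makes closedness immediate.\<close>

lemma supported_lsq_iff:
  fixes x :: "('a::euclidean_space, 'b::euclidean_space) lsq"
  assumes S: "S \<in> sets borel"
  shows "x \<in> lsq_on S ` L2 S \<longleftrightarrow> (\<forall>g. sq_integrable g \<and> (\<forall>z\<in>S. g z = 0) \<longrightarrow> x \<bullet> lsq_of g = 0)"
proof
  assume "x \<in> lsq_on S ` L2 S"
  then obtain f where f: "f \<in> L2 S" "x = lsq_on S f" by blast
  obtain h where h: "sq_integrable h" "\<And>z. z \<notin> S \<Longrightarrow> h z = 0" "lsq_on S f = lsq_of h"
    using lsq_on_cases[OF S f(1)] by metis
  show "\<forall>g. sq_integrable g \<and> (\<forall>z\<in>S. g z = 0) \<longrightarrow> x \<bullet> lsq_of g = 0"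
  proof (intro allI impI, elim conjE)
    fix g :: "'a \<Rightarrow> 'b" assume g: "sq_integrable g" "\<forall>z\<in>S. g z = 0"
    have "h z \<bullet> g z = 0" for z using h(2)[of z] g(2) by (cases "z \<in> S") auto
    then show "x \<bullet> lsq_of g = 0" using f(2) h(3) by (simp add: inner_lsq_of h(1) g(1))
  qed
next
  assume orth: "\<forall>g. sq_integrable g \<and> (\<forall>z\<in>S. g z = 0) \<longrightarrow> x \<bullet> lsq_of g = 0"
  obtain f where f: "sq_integrable f" "x = lsq_of f" by (rule lsq_cases)
  have [measurable]: "f \<in> borel_measurable borel" "S \<in> sets borel" using f(1) S by (auto simp: sq_integrable_def)
  define g where "g z = indicator (- S) z *\<^sub>R f z" for z
  have gm: "g \<in> borel_measurable borel" unfolding g_def[abs_def] by measurable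
  have g: "sq_integrable g"
    by (rule sq_integrable_le[OF f(1) gm, where c = 1]) (simp add: g_def split: split_indicator)
  have "x \<bullet> lsq_of g = 0" using orth g by (simp add: g_def)
  then have "(LINT z|lborel. f z \<bullet> g z) = 0" using f g by (simp add: inner_lsq_of)
  moreover have "f z \<bullet> g z = (norm (g z))\<^sup>2" for z
    by (simp add: g_def power2_norm_eq_inner split: split_indicator)
  ultimately have "(norm (lsq_of g))\<^sup>2 = 0" using g by (simp add: norm_lsq_of)
  then have g0: "lsq_of g = 0" by simp
  define h where "h z = f z - g z" for z
  have h: "sq_integrable h" "\<And>z. z \<notin> S \<Longrightarrow> h z = 0"
    using sq_integrable_diff[OF f(1) g] by (simp_all add: h_def[abs_def] g_def)
  have "x = lsq_of h" using lsq_of_diff[OF f(1) g] g0 f(2) by (simp add: h_def[abs_def])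
  also have "\<dots> = lsq_on S h" using lsq_on_of_supported(2)[OF S h] by simp
  finally show "x \<in> lsq_on S ` L2 S" using lsq_on_of_supported(1)[OF S h] by blast
qed

lemma supported_lsq_closed_subspace:
  assumes S: "S \<in> sets borel"
  shows "subspace (lsq_on S ` L2 S :: ('a::euclidean_space, 'b::euclidean_space) lsq set)"
    and "closed (lsq_on S ` L2 S :: ('a::euclidean_space, 'b::euclidean_space) lsq set)"
proof -
  have eq: "(lsq_on S ` L2 S :: ('a, 'b) lsq set) = {x. \<forall>g. sq_integrable g \<and> (\<forall>z\<in>S. g z = 0) \<longrightarrow> x \<bullet> lsq_of g = 0}"
    using supported_lsq_iff[OF S] by blast
  show "subspace (lsq_on S ` L2 S :: ('a, 'b) lsq set)"
    unfolding eq subspace_def by (auto simp: inner_add_left)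
  have "closed {x :: ('a, 'b) lsq. sq_integrable g \<and> (\<forall>z\<in>S. g z = 0) \<longrightarrow> x \<bullet> lsq_of g = 0}" for g
  proof (cases "sq_integrable g \<and> (\<forall>z\<in>S. g z = 0)")
    case True
    then have eq1: "{x :: ('a, 'b) lsq. sq_integrable g \<and> (\<forall>z\<in>S. g z = 0) \<longrightarrow> x \<bullet> lsq_of g = 0} = {x. x \<bullet> lsq_of g = 0}" by blast
    show ?thesis unfolding eq1 by (intro closed_Collect_eq continuous_intros)
  next
    case False
    then have eq1: "{x :: ('a, 'b) lsq. sq_integrable g \<and> (\<forall>z\<in>S. g z = 0) \<longrightarrow> x \<bullet> lsq_of g = 0} = UNIV" by blast
    show ?thesis unfolding eq1 by (rule closed_UNIV)
  qed
  then show "closed (lsq_on S ` L2 S :: ('a, 'b) lsq set)"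
    unfolding eq by (intro closed_Collect_all)
qed

lemma L2_of_bounded:
  fixes f :: "'a::euclidean_space \<Rightarrow> 'b::euclidean_space"
  assumes S: "open S" "bounded S" and f: "f \<in> borel_measurable (lebesgue_on S)"
    and b: "AE z in lebesgue_on S. norm (f z) \<le> b"
  shows "f \<in> L2 S"
proof (rule L2_bound(1)[where f = "\<lambda>z. 1 :: real" and c = "\<bar>b\<bar>"])
  show "(\<lambda>z. 1 :: real) \<in> L2 S"
    using integrable_lebesgue_on_continuous(1)[OF S continuous_on_const[of UNIV "1 :: real"]] by (simp add: L2_def)
  show "AE z in lebesgue_on S. norm (f z) \<le> \<bar>b\<bar> * norm (1 :: real)" using b by eventually_elim simp
qed (use f in auto)

lemma C1_closure_derivative:
  assumes "f \<in> C1_closure S"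
  obtains f' where "continuous_on (closure S) f'" "\<And>z. z \<in> S \<Longrightarrow> (f has_derivative blinfun_apply (f' z)) (at z)"
    "\<And>z v. z \<in> S \<Longrightarrow> frechet_derivative f (at z) v = blinfun_apply (f' z) v"
proof -
  obtain f' where f': "continuous_on (closure S) f'" "\<And>z. z \<in> S \<Longrightarrow> (f has_derivative blinfun_apply (f' z)) (at z)"
    using assms unfolding C1_closure_def by blast
  have "frechet_derivative f (at z) v = blinfun_apply (f' z) v" if "z \<in> S" for z v
    using frechet_derivative_at[OF f'(2)[OF that]] by simp
  with f' that show thesis by blast
qed

text \<open>General linear combinations, so that one computation covers sums, multiples and differences of states.\<close>

definition lin_state :: "real \<Rightarrow> 'n::finite state \<Rightarrow> real \<Rightarrow> 'n state \<Rightarrow> 'n state" where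
  "lin_state a v b w = (\<lambda>z. a * fst v z + b * fst w z, \<lambda>z. a *\<^sub>R snd v z + b *\<^sub>R snd w z)"

lemma C1_closure_lin:
  fixes f g :: "'a::real_normed_vector \<Rightarrow> 'b::real_normed_vector"
  assumes "f \<in> C1_closure S" "g \<in> C1_closure S"
  shows "(\<lambda>z. a *\<^sub>R f z + b *\<^sub>R g z) \<in> C1_closure S"
    and "\<And>z v. z \<in> S \<Longrightarrow> frechet_derivative (\<lambda>z. a *\<^sub>R f z + b *\<^sub>R g z) (at z) v
      = a *\<^sub>R frechet_derivative f (at z) v + b *\<^sub>R frechet_derivative g (at z) v"
proof -
  obtain f' where f': "continuous_on (closure S) f'" "\<And>z. z \<in> S \<Longrightarrow> (f has_derivative blinfun_apply (f' z)) (at z)"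
    "\<And>z v. z \<in> S \<Longrightarrow> frechet_derivative f (at z) v = blinfun_apply (f' z) v"
    using C1_closure_derivative[OF assms(1)] by metis
  obtain g' where g': "continuous_on (closure S) g'" "\<And>z. z \<in> S \<Longrightarrow> (g has_derivative blinfun_apply (g' z)) (at z)"
    "\<And>z v. z \<in> S \<Longrightarrow> frechet_derivative g (at z) v = blinfun_apply (g' z) v"
    using C1_closure_derivative[OF assms(2)] by metis
  have d: "((\<lambda>z. a *\<^sub>R f z + b *\<^sub>R g z) has_derivative blinfun_apply (a *\<^sub>R f' z + b *\<^sub>R g' z)) (at z)" if "z \<in> S" for z
    using f'(2)[OF that] g'(2)[OF that]
    by (auto intro!: derivative_eq_intros simp: blinfun.add_left blinfun.scaleR_left)
  have c: "continuous_on (closure S) (\<lambda>z. a *\<^sub>R f z + b *\<^sub>R g z)"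
    using assms by (intro continuous_intros) (auto simp: C1_closure_def)
  have c': "continuous_on (closure S) (\<lambda>z. a *\<^sub>R f' z + b *\<^sub>R g' z)"
    using f'(1) g'(1) by (intro continuous_intros)
  show "(\<lambda>z. a *\<^sub>R f z + b *\<^sub>R g z) \<in> C1_closure S"
    unfolding C1_closure_def using c c' d by blast
  fix z v assume z: "z \<in> S"
  show "frechet_derivative (\<lambda>z. a *\<^sub>R f z + b *\<^sub>R g z) (at z) v
      = a *\<^sub>R frechet_derivative f (at z) v + b *\<^sub>R frechet_derivative g (at z) v"
    using fun_cong[OF frechet_derivative_at[OF d[OF z]], of v] f'(3)[OF z, of v] g'(3)[OF z, of v]
    by (simp add: blinfun.add_left blinfun.scaleR_left)
qed

lemma norm_matrix_vector_mult_le: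
  fixes A :: "real ^ 'n ^ 'm"
  shows "norm (A *v x) \<le> norm A * norm x"
proof -
  have "norm (A *v x) \<le> L2_set (\<lambda>i. norm (A $ i) * norm x) UNIV"
    unfolding norm_vec_def[of "A *v x"]
    by (rule L2_set_mono) (simp_all add: matrix_vector_mul_component Cauchy_Schwarz_ineq2)
  also have "\<dots> = norm A * norm x"
    by (simp add: norm_vec_def[of A] L2_set_left_distrib)
  finally show ?thesis .
qed

text \<open>The hypotheses of the theorem for one choice of observation region and weights.\<close>

locale parabolic_problem =
  fixes P :: "'n::finite problem" and c0 \<rho>s :: real
  assumes domain: "bounded_C2_domain (Omega P)" and horizon: "horizon P > 0"
    and coeff_c: "coeff_c P \<in> C1_closure (Omega P)" and c0: "c0 > 0"
    and coercive: "\<And>x \<xi>. x \<in> closure (Omega P) \<Longrightarrow> (coeff_c P x *v \<xi>) \<bullet> \<xi> \<ge> c0 * (norm \<xi>)\<^sup>2"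
    and coeff_d: "coeff_d P \<in> Linf (QT P)"
    and omega: "open (omega P)" "omega P \<subseteq> Omega P"
    and weight: "\<rho>s > 0" "wt0 P \<in> weight_class (Omega P) (horizon P) \<rho>s"
      "wt P \<in> weight_class (Omega P) (horizon P) \<rho>s" "wt P \<in> Linf (QT P)"
      "wt1 P \<in> weight_class (Omega P) (horizon P) \<rho>s" "wt1 P \<in> Linf (QT P)"
    and eta: "eta1 P > 0" "eta2 P > 0"
begin

lemma QT_eq: "QT P = Omega P \<times> {0<..<horizon P}"
  by (simp add: QT_def cyl_def)

lemma Omega: "open (Omega P)" "bounded (Omega P)" "Omega P \<noteq> {}" "C2_boundary (Omega P)"
  using domain by (auto simp: bounded_C2_domain_def)

lemma QT: "open (QT P)" "bounded (QT P)" "QT P \<in> sets borel"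
proof -
  show "open (QT P)" using Omega(1) by (auto simp: QT_eq intro: open_Times)
  then show "QT P \<in> sets borel" by simp
  show "bounded (QT P)" using Omega(2) by (auto simp: QT_eq intro: bounded_Times)
qed

lemma qT: "open (qT P)" "bounded (qT P)" "qT P \<in> sets borel" "qT P \<subseteq> QT P"
proof -
  show "open (qT P)" using omega(1) by (auto simp: qT_def cyl_def intro: open_Times)
  then show "qT P \<in> sets borel" by simp
  show sub: "qT P \<subseteq> QT P" using omega(2) by (auto simp: qT_def QT_def cyl_def)
  show "bounded (qT P)" using QT(2) sub by (rule bounded_subset)
qed

lemma wt_pos: "z \<in> QT P \<Longrightarrow> \<rho>s \<le> wt0 P z" "z \<in> QT P \<Longrightarrow> \<rho>s \<le> wt P z" "z \<in> QT P \<Longrightarrow> \<rho>s \<le> wt1 P z"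
  using weight by (auto simp: weight_class_def QT_def)

lemma wt_continuous: "continuous_on (QT P) (wt0 P)" "continuous_on (QT P) (wt P)" "continuous_on (QT P) (wt1 P)"
  using weight by (auto simp: weight_class_def QT_def)

lemma measurable_continuous_QT:
  fixes f :: "'n spacetime \<Rightarrow> 'b::euclidean_space"
  shows "continuous_on (QT P) f \<Longrightarrow> f \<in> borel_measurable (lebesgue_on (QT P))"
    and "continuous_on (QT P) f \<Longrightarrow> f \<in> borel_measurable (lebesgue_on (qT P))"
  using QT(1) qT(1,4)
  by (auto intro!: continuous_imp_measurable_on_sets_lebesgue intro: continuous_on_subset)

definition dmax :: real where
  "dmax = max 0 (Linf_norm (QT P) (coeff_d P))"

text \<open>Because \<open>Q\<^sub>T\<close> is open and nonempty it has positive measure, so the essential supremum of \<open>\<bar>f\<bar>\<close> is nonnegative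
  and its real part is the bound.\<close>

lemma Linf_bound:
  assumes "f \<in> Linf (QT P)"
  shows "AE z in lebesgue_on (QT P). \<bar>f z\<bar> \<le> Linf_norm (QT P) f" "0 \<le> Linf_norm (QT P) f"
proof -
  let ?M = "lebesgue_on (QT P)" and ?s = "esssup (lebesgue_on (QT P)) (\<lambda>z. ereal \<bar>f z\<bar>)"
  have lt: "?s < \<infinity>" using assms by (simp add: Linf_def)
  have ae: "AE z in ?M. ereal \<bar>f z\<bar> \<le> ?s" by (rule esssup_AE)
  \<comment> \<open>the cylinder contains a ball\<close>
  have ne: "\<not> (AE z in ?M. False)"
  proof
    assume "AE z in ?M. False"
    then have "AE z in lborel. z \<notin> QT P" unfolding AE_lebesgue_on_iff[OF QT(3)] by simp
    then have "emeasure lborel {z \<in> space lborel. z \<in> QT P} = 0"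
      using emeasure_eq_0_AE[of "\<lambda>z. z \<in> QT P" lborel] by blast
    then have e0: "emeasure lborel (QT P) = 0" by simp
    obtain x where x: "x \<in> Omega P" using Omega(3) by blast
    have "(x, horizon P / 2) \<in> QT P" using x horizon by (simp add: QT_eq)
    then obtain r where r: "r > 0" "ball (x, horizon P / 2) r \<subseteq> QT P" using QT(1) open_contains_ball by blast
    then have "emeasure lborel (ball (x, horizon P / 2) r) = 0"
      using e0 emeasure_mono[OF r(2), of lborel] QT(3) by simp
    then show False using content_ball_pos[OF r(1), of "(x, horizon P / 2)"] by (simp add: measure_def)
  qed
  have nonneg: "0 \<le> ?s"
  proof (rule ccontr)
    assume "\<not> 0 \<le> ?s"
    have "\<not> ereal \<bar>f z\<bar> \<le> ?s" for z
    proof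
      assume "ereal \<bar>f z\<bar> \<le> ?s"
      moreover have "0 \<le> ereal \<bar>f z\<bar>" by simp
      ultimately have "0 \<le> ?s" by (rule order_trans[rotated])
      with \<open>\<not> 0 \<le> ?s\<close> show False by blast
    qed
    then have "AE z in ?M. False" using ae by simp
    with ne show False by blast
  qed
  have s: "?s = ereal (Linf_norm (QT P) f)" unfolding Linf_norm_def using lt nonneg by (cases ?s) auto
  show "AE z in ?M. \<bar>f z\<bar> \<le> Linf_norm (QT P) f" using ae unfolding s by simp
  show "0 \<le> Linf_norm (QT P) f" using nonneg unfolding s by simp
qed

lemma dmax: "AE z in lebesgue_on (QT P). \<bar>coeff_d P z\<bar> \<le> dmax" "0 \<le> dmax"
  using Linf_bound[OF coeff_d] by (auto simp: dmax_def)

lemma U0_derivatives: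
  assumes v: "v \<in> U0 P"
  shows "fst v \<in> C1_closure (QT P)" "snd v \<in> C1_closure (QT P)"
    and "fst v \<in> L2 (QT P)" "fst v \<in> L2 (qT P)" "opI P v \<in> L2 (QT P)" "opJ P v \<in> L2 (QT P)"
proof -
  show y: "fst v \<in> C1_closure (QT P)" and p: "snd v \<in> C1_closure (QT P)" using v by (auto simp: U0_def)
  have cl: "compact (closure (QT P))" using QT(2) by (simp add: compact_closure)
  have sub: "QT P \<subseteq> closure (QT P)" by (rule closure_subset)
  obtain y' where y': "continuous_on (closure (QT P)) y'" "\<And>z h. z \<in> QT P \<Longrightarrow> frechet_derivative (fst v) (at z) h = blinfun_apply (y' z) h"
    using C1_closure_derivative[OF y] by metis
  obtain p' where p': "continuous_on (closure (QT P)) p'" "\<And>z h. z \<in> QT P \<Longrightarrow> frechet_derivative (snd v) (at z) h = blinfun_apply (p' z) h"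
    using C1_closure_derivative[OF p] by metis
  have yc: "continuous_on (closure (QT P)) (fst v)" and pc: "continuous_on (closure (QT P)) (snd v)"
    using y p by (auto simp: C1_closure_def)
  have bdd: "\<exists>b. \<forall>z\<in>QT P. norm (f z) \<le> b" if "continuous_on (closure (QT P)) f" for f :: "'n spacetime \<Rightarrow> 'b::euclidean_space"
  proof -
    have "bounded (f ` closure (QT P))" using compact_imp_bounded[OF compact_continuous_image[OF that cl]] .
    then show ?thesis using sub by (auto simp: bounded_iff)
  qed
  obtain yb where yb: "\<And>z. z \<in> QT P \<Longrightarrow> norm (fst v z) \<le> yb" using bdd[OF yc] by blast
  show "fst v \<in> L2 (QT P)"
    by (rule L2_of_bounded[OF QT(1,2) measurable_continuous_QT(1)[OF continuous_on_subset[OF yc sub]], where b = yb])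
      (use yb in \<open>auto intro!: AE_I2\<close>)
  show "fst v \<in> L2 (qT P)"
    by (rule L2_of_bounded[OF qT(1,2) measurable_continuous_QT(2)[OF continuous_on_subset[OF yc sub]], where b = yb])
      (use yb qT(4) in \<open>auto intro!: AE_I2\<close>)
  define g where "g z = blinfun_apply (y' z) (0, 1) - (\<Sum>i\<in>UNIV. blinfun_apply (p' z) (axis i 1, 0) $ i)" for z
  have gc: "continuous_on (closure (QT P)) g"
    unfolding g_def[abs_def] by (intro continuous_intros y'(1) p'(1))
  obtain bg where bg: "\<And>z. z \<in> QT P \<Longrightarrow> norm (g z) \<le> bg" using bdd[OF gc] by blast
  have I: "opI P v z = g z + coeff_d P z * fst v z" if "z \<in> QT P" for z
    by (simp add: opI_def time_deriv_def space_div_def y'(2)[OF that] p'(2)[OF that] g_def)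
  have dm: "coeff_d P \<in> borel_measurable (lebesgue_on (QT P))" using coeff_d by (simp add: Linf_def)
  have ym: "fst v \<in> borel_measurable (lebesgue_on (QT P))" and gm: "g \<in> borel_measurable (lebesgue_on (QT P))"
    by (rule measurable_continuous_QT(1)[OF continuous_on_subset[OF yc sub]], rule measurable_continuous_QT(1)[OF continuous_on_subset[OF gc sub]])
  have "(\<lambda>z. g z + coeff_d P z * fst v z) \<in> borel_measurable (lebesgue_on (QT P))" using dm ym gm by measurable
  then have Im: "opI P v \<in> borel_measurable (lebesgue_on (QT P))"
    by (subst measurable_cong[where g = "\<lambda>z. g z + coeff_d P z * fst v z"]) (auto simp: I)
  show "opI P v \<in> L2 (QT P)"
  proof (rule L2_of_bounded[OF QT(1,2) Im])
    show "AE z in lebesgue_on (QT P). norm (opI P v z) \<le> bg + dmax * yb"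
      using dmax(1) AE_space
    proof eventually_elim
      case (elim z)
      then have z: "z \<in> QT P" by simp
      have "norm (opI P v z) \<le> norm (g z) + \<bar>coeff_d P z\<bar> * \<bar>fst v z\<bar>"
        using norm_triangle_ineq[of "g z" "coeff_d P z * fst v z"] by (simp add: I[OF z] abs_mult)
      also have "\<dots> \<le> bg + dmax * yb"
        using bg[OF z] yb[OF z] elim(1) dmax(2) by (intro add_mono mult_mono) auto
      finally show ?case .
    qed
  qed
  define j where "j z = coeff_c P (fst z) *v (\<chi> i. blinfun_apply (y' z) (axis i 1, 0)) - snd v z" for z
  have cc: "continuous_on (closure (Omega P)) (coeff_c P)" using coeff_c by (simp add: C1_closure_def)
  have clQ: "closure (QT P) = closure (Omega P) \<times> closure {0<..<horizon P}" by (simp add: QT_eq closure_Times)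
  have cfst: "continuous_on (closure (QT P)) (\<lambda>z. coeff_c P (fst z))"
    by (rule continuous_on_compose2[OF cc continuous_on_fst[OF continuous_on_id]]) (auto simp: clQ)
  have jc: "continuous_on (closure (QT P)) j"
    unfolding j_def[abs_def] matrix_vector_mult_def
    by (intro continuous_intros cfst y'(1) pc)
  obtain bj where bj: "\<And>z. z \<in> QT P \<Longrightarrow> norm (j z) \<le> bj" using bdd[OF jc] by blast
  have J: "opJ P v z = j z" if "z \<in> QT P" for z
    by (simp add: opJ_def space_grad_def y'(2)[OF that] j_def)
  have "j \<in> borel_measurable (lebesgue_on (QT P))" by (rule measurable_continuous_QT(1)[OF continuous_on_subset[OF jc sub]])
  then have Jm: "opJ P v \<in> borel_measurable (lebesgue_on (QT P))"
    by (subst measurable_cong[where g = j]) (auto simp: J)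
  show "opJ P v \<in> L2 (QT P)"
    by (rule L2_of_bounded[OF QT(1,2) Jm, where b = bj]) (use bj J in \<open>auto intro!: AE_I2\<close>)
qed

lemma U0_lin:
  assumes v: "v \<in> U0 P" and w: "w \<in> U0 P"
  shows "lin_state a v b w \<in> U0 P"
    and "z \<in> QT P \<Longrightarrow> opI P (lin_state a v b w) z = a * opI P v z + b * opI P w z"
    and "z \<in> QT P \<Longrightarrow> opJ P (lin_state a v b w) z = a *\<^sub>R opJ P v z + b *\<^sub>R opJ P w z"
proof -
  note y = C1_closure_lin[OF U0_derivatives(1)[OF v] U0_derivatives(1)[OF w], where a = a and b = b]
  note p = C1_closure_lin[OF U0_derivatives(2)[OF v] U0_derivatives(2)[OF w], where a = a and b = b]
  show "lin_state a v b w \<in> U0 P" using y(1) p(1) v w by (auto simp: U0_def lin_state_def)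
  assume z: "z \<in> QT P"
  note yz = y(2)[OF z, simplified] and pz = p(2)[OF z]
  show "opI P (lin_state a v b w) z = a * opI P v z + b * opI P w z"
    by (simp add: opI_def lin_state_def time_deriv_def space_div_def yz pz sum.distrib sum_distrib_left algebra_simps)
  have "space_grad (\<lambda>z. a * fst v z + b * fst w z) z = a *\<^sub>R space_grad (fst v) z + b *\<^sub>R space_grad (fst w) z"
    by (simp add: space_grad_def yz vec_eq_iff)
  then show "opJ P (lin_state a v b w) z = a *\<^sub>R opJ P v z + b *\<^sub>R opJ P w z"
    by (simp add: opJ_def lin_state_def matrix_vector_right_distrib matrix_vector_mult_scaleR algebra_simps)
qed

definition obs_weighted :: "'n state \<Rightarrow> 'n spacetime \<Rightarrow> real" where "obs_weighted v = (\<lambda>z. fst v z / wt0 P z)"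
definition J_weighted :: "'n state \<Rightarrow> 'n spacetime \<Rightarrow> real ^ 'n" where "J_weighted v = (\<lambda>z. (1 / wt1 P z) *\<^sub>R opJ P v z)"
definition I_weighted :: "'n state \<Rightarrow> 'n spacetime \<Rightarrow> real" where "I_weighted v = (\<lambda>z. opI P v z / wt P z)"

lemma L2_divide_wt0:
  assumes "f \<in> L2 (qT P)"
  shows "(\<lambda>z. f z / wt0 P z) \<in> L2 (qT P)" "L2_norm (qT P) (\<lambda>z. f z / wt0 P z) \<le> 1 / \<rho>s * L2_norm (qT P) f"
proof -
  have m: "(\<lambda>z. f z / wt0 P z) \<in> borel_measurable (lebesgue_on (qT P))"
    using assms measurable_continuous_QT(2)[OF wt_continuous(1)] by (auto simp: L2_def)
  have "AE z in lebesgue_on (qT P). norm (f z / wt0 P z) \<le> 1 / \<rho>s * norm (f z)"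
  proof (rule AE_I2)
    fix z assume "z \<in> space (lebesgue_on (qT P))"
    then have "\<rho>s \<le> wt0 P z" using wt_pos(1)[of z] qT(4) by (metis space_lebesgue_on subsetD)
    then show "norm (f z / wt0 P z) \<le> 1 / \<rho>s * norm (f z)" using weight(1) by (simp add: abs_divide frac_le)
  qed
  from L2_bound[OF assms m this] show "(\<lambda>z. f z / wt0 P z) \<in> L2 (qT P)"
    "L2_norm (qT P) (\<lambda>z. f z / wt0 P z) \<le> 1 / \<rho>s * L2_norm (qT P) f" using weight(1) by auto
qed

lemma weighted_L2:
  assumes v: "v \<in> U0 P"
  shows "obs_weighted v \<in> L2 (qT P)" "J_weighted v \<in> L2 (QT P)" "I_weighted v \<in> L2 (QT P)"
proof -
  show "obs_weighted v \<in> L2 (qT P)" unfolding obs_weighted_def by (rule L2_divide_wt0(1)[OF U0_derivatives(4)[OF v]])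
  have m1: "J_weighted v \<in> borel_measurable (lebesgue_on (QT P))"
    using U0_derivatives(6)[OF v] measurable_continuous_QT(1)[OF wt_continuous(3)] by (auto simp: L2_def J_weighted_def)
  have "AE z in lebesgue_on (QT P). norm (J_weighted v z) \<le> 1 / \<rho>s * norm (opJ P v z)"
  proof (rule AE_I2)
    fix z assume "z \<in> space (lebesgue_on (QT P))"
    then have "\<rho>s \<le> wt1 P z" using wt_pos(3) by auto
    then show "norm (J_weighted v z) \<le> 1 / \<rho>s * norm (opJ P v z)" using weight(1) by (simp add: J_weighted_def frac_le)
  qed
  from L2_bound(1)[OF U0_derivatives(6)[OF v] m1 this] show "J_weighted v \<in> L2 (QT P)" using weight(1) by auto
  have m2: "I_weighted v \<in> borel_measurable (lebesgue_on (QT P))"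
    using U0_derivatives(5)[OF v] measurable_continuous_QT(1)[OF wt_continuous(2)] by (auto simp: L2_def I_weighted_def)
  have "AE z in lebesgue_on (QT P). norm (I_weighted v z) \<le> 1 / \<rho>s * norm (opI P v z)"
  proof (rule AE_I2)
    fix z assume "z \<in> space (lebesgue_on (QT P))"
    then have "\<rho>s \<le> wt P z" using wt_pos(2) by auto
    then show "norm (I_weighted v z) \<le> 1 / \<rho>s * norm (opI P v z)" using weight(1) by (simp add: I_weighted_def abs_divide frac_le)
  qed
  from L2_bound(1)[OF U0_derivatives(5)[OF v] m2 this] show "I_weighted v \<in> L2 (QT P)" using weight(1) by auto
qed

definition Phi0 :: "'n state \<Rightarrow> ('n spacetime, real) lsq \<times> ('n spacetime, real ^ 'n) lsq \<times> ('n spacetime, real) lsq" where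
  "Phi0 v = (lsq_on (qT P) (obs_weighted v), lsq_on (QT P) (J_weighted v), lsq_on (QT P) (I_weighted v))"

lemma lsq_on_lin:
  assumes S: "S \<in> sets borel" and f: "f \<in> L2 S" and g: "g \<in> L2 S" and h: "h \<in> L2 S"
    and eq: "\<And>z. z \<in> S \<Longrightarrow> h z = a *\<^sub>R f z + b *\<^sub>R g z"
  shows "lsq_on S h = a *\<^sub>R lsq_on S f + b *\<^sub>R lsq_on S g"
proof -
  note s = lsq_on_scaleR[OF S f, of a] lsq_on_scaleR[OF S g, of b]
  note add = lsq_on_add[OF S s(1,3)]
  have "lsq_on S h = lsq_on S (\<lambda>z. a *\<^sub>R f z + b *\<^sub>R g z)"
    unfolding lsq_on_eq_iff[OF S h add(1)] by (rule AE_I2) (simp add: eq)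
  then show ?thesis using add(2) s(2,4) by simp
qed

lemma Phi0_lin:
  assumes v: "v \<in> U0 P" and w: "w \<in> U0 P"
  shows "Phi0 (lin_state a v b w) = a *\<^sub>R Phi0 v + b *\<^sub>R Phi0 w"
proof -
  note l = U0_lin[OF v w, where a = a and b = b]
  note F = weighted_L2[OF v] weighted_L2[OF w] weighted_L2[OF l(1)]
  have "lsq_on (qT P) (obs_weighted (lin_state a v b w)) = a *\<^sub>R lsq_on (qT P) (obs_weighted v) + b *\<^sub>R lsq_on (qT P) (obs_weighted w)"
    by (rule lsq_on_lin[OF qT(3) F(1,4,7)]) (simp add: obs_weighted_def lin_state_def add_divide_distrib)
  moreover have "lsq_on (QT P) (J_weighted (lin_state a v b w)) = a *\<^sub>R lsq_on (QT P) (J_weighted v) + b *\<^sub>R lsq_on (QT P) (J_weighted w)"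
    by (rule lsq_on_lin[OF QT(3) F(2,5,8)]) (simp add: J_weighted_def l(3) scaleR_add_right mult.commute)
  moreover have "lsq_on (QT P) (I_weighted (lin_state a v b w)) = a *\<^sub>R lsq_on (QT P) (I_weighted v) + b *\<^sub>R lsq_on (QT P) (I_weighted w)"
    by (rule lsq_on_lin[OF QT(3) F(3,6,9)]) (simp add: I_weighted_def l(2) add_divide_distrib)
  ultimately show ?thesis by (simp add: Phi0_def plus_prod_def scaleR_prod_def)
qed

lemma subspace_Phi0_image:
  assumes W: "W \<subseteq> U0 P" "W \<noteq> {}" and lin: "\<And>v w a b. v \<in> W \<Longrightarrow> w \<in> W \<Longrightarrow> lin_state a v b w \<in> W"
  shows "subspace (Phi0 ` W)"
proof -
  obtain v0 where v0: "v0 \<in> W" using W(2) by blast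
  have comb: "a *\<^sub>R Phi0 v + b *\<^sub>R Phi0 w \<in> Phi0 ` W" if "v \<in> W" "w \<in> W" for v w a b
  proof -
    have "a *\<^sub>R Phi0 v + b *\<^sub>R Phi0 w = Phi0 (lin_state a v b w)"
      using that W(1) by (intro Phi0_lin[symmetric]) auto
    then show ?thesis using lin[OF that, of a b] by (simp only: imageI)
  qed
  have "0 \<in> Phi0 ` W" using comb[OF v0 v0, of 0 0] by simp
  moreover have "Phi0 v + Phi0 w \<in> Phi0 ` W" if "v \<in> W" "w \<in> W" for v w
    using comb[OF that, of 1 1] by simp
  moreover have "a *\<^sub>R Phi0 v \<in> Phi0 ` W" if "v \<in> W" for v a
    using comb[OF that that, of a 0] by simp
  ultimately show ?thesis unfolding subspace_def by blast
qed

end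

section \<open>Bounds and density for interior states\<close>

lemma C1_with_lin:
  assumes "C1_with f Df" "C1_with g Dg"
  shows "C1_with (\<lambda>z. a * f z + b * g z) (\<lambda>z. a *\<^sub>R Df z + b *\<^sub>R Dg z)"
proof -
  have "((\<lambda>z. a * f z + b * g z) has_derivative (\<lambda>v. (a *\<^sub>R Df z + b *\<^sub>R Dg z) \<bullet> v)) (at z)" for z
    using assms unfolding C1_with_def
    by (auto intro!: derivative_eq_intros simp: inner_add_left)
  moreover have "continuous_on UNIV (\<lambda>z. a *\<^sub>R Df z + b *\<^sub>R Dg z)"
    using assms by (intro continuous_intros) (auto simp: C1_with_def)
  ultimately show ?thesis by (simp add: C1_with_def)
qed

lemma interior_test_lin:
  assumes f: "interior_test \<Omega> f Df" and g: "interior_test \<Omega> g Dg"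
  shows "interior_test \<Omega> (\<lambda>z. a * f z + b * g z) (\<lambda>z. a *\<^sub>R Df z + b *\<^sub>R Dg z)"
proof -
  obtain K where K: "compact K" "K \<subseteq> \<Omega>" "\<And>x t. x \<notin> K \<or> t \<le> 0 \<Longrightarrow> f (x, t) = 0"
    using f unfolding interior_test_def by blast
  obtain L where L: "compact L" "L \<subseteq> \<Omega>" "\<And>x t. x \<notin> L \<or> t \<le> 0 \<Longrightarrow> g (x, t) = 0"
    using g unfolding interior_test_def by blast
  have "compact (K \<union> L)" "K \<union> L \<subseteq> \<Omega>" using K L by auto
  moreover have "\<forall>x t. x \<notin> K \<union> L \<or> t \<le> 0 \<longrightarrow> a * f (x, t) + b * g (x, t) = 0"
    using K(3) L(3) by auto
  moreover have "C1_with (\<lambda>z. a * f z + b * g z) (\<lambda>z. a *\<^sub>R Df z + b *\<^sub>R Dg z)"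
    using f g by (intro C1_with_lin) (auto simp: interior_test_def)
  ultimately show ?thesis unfolding interior_test_def by blast
qed

lemma C1_with_zero: "C1_with (\<lambda>z. 0) (\<lambda>z. 0)"
  unfolding C1_with_def by (auto intro!: derivative_eq_intros)

lemma interior_test_zero: "interior_test \<Omega> (\<lambda>z. 0) (\<lambda>z. 0)"
  unfolding interior_test_def using C1_with_zero by (auto intro!: exI[of _ "{}"])

context parabolic_problem
begin

text \<open>In contrast to a general element of \<open>U\<^sub>0\<close>, the components are differentiable on the whole of
  space-time and \<open>y\<close> vanishes for \<open>t \<le> 0\<close>. The energy estimate needs the zero initial value.\<close>

definition interior_states :: "'n state set" where
  "interior_states = {v. \<exists>Dy Dp. interior_test (Omega P) (fst v) Dy \<and> (\<forall>i. C1_with (\<lambda>z. snd v z $ i) (Dp i))}"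

lemma interior_state_derivatives:
  assumes y: "interior_test (Omega P) (fst v) Dy" and p: "\<And>i. C1_with (\<lambda>z. snd v z $ i) (Dp i)"
  shows "v \<in> U0 P" "opI P v z = snd (Dy z) - (\<Sum>i\<in>UNIV. fst (Dp i z) $ i) + coeff_d P z * fst v z"
    and "opJ P v z = coeff_c P (fst z) *v fst (Dy z) - snd v z"
proof -
  have C: "C1_with (fst v) Dy" using y by (simp add: interior_test_def)
  have dy: "(fst v has_derivative (\<lambda>h. Dy z \<bullet> h)) (at z)" for z using C unfolding C1_with_def by blast
  have dp: "(snd v has_derivative (\<lambda>h. \<chi> i. Dp i z \<bullet> h)) (at z)" for z
  proof -
    have "((\<lambda>z. snd v z $ i) has_derivative (\<lambda>h. Dp i z \<bullet> h)) (at z)" for i using p[of i] unfolding C1_with_def by blast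
    then have "((\<lambda>z. snd v z \<bullet> b) has_derivative (\<lambda>h. (\<chi> i. Dp i z \<bullet> h) \<bullet> b)) (at z)" if "b \<in> Basis" for b :: "real ^ 'n"
      using that by (auto simp: Basis_vec_def inner_axis)
    then show ?thesis using has_derivative_componentwise_within[of "snd v" _ z UNIV] by blast
  qed
  note fy = fun_cong[OF frechet_derivative_at[OF dy], symmetric] and fp = fun_cong[OF frechet_derivative_at[OF dp], symmetric]
  show "opI P v z = snd (Dy z) - (\<Sum>i\<in>UNIV. fst (Dp i z) $ i) + coeff_d P z * fst v z"
    by (simp add: opI_def time_deriv_def space_div_def fy fp inner_prod_def inner_axis)
  have "space_grad (fst v) z = fst (Dy z)"
    by (simp add: space_grad_def fy inner_prod_def inner_axis vec_eq_iff)
  then show "opJ P v z = coeff_c P (fst z) *v fst (Dy z) - snd v z" by (simp add: opJ_def)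
  have "fst v \<in> C1_closure (QT P)"
    unfolding C1_closure_def mem_Collect_eq
  proof (intro conjI exI ballI)
    show "continuous_on (closure (QT P)) (fst v)" using C1_with_continuous[OF C] continuous_on_subset by blast
    have "continuous_on UNIV Dy" using C by (simp add: C1_with_def)
    then have "continuous_on UNIV (\<lambda>z. blinfun_inner_left (Dy z))"
      by (rule bounded_linear.continuous_on[OF bounded_linear_blinfun_inner_left])
    then show "continuous_on (closure (QT P)) (\<lambda>z. blinfun_inner_left (Dy z))" using continuous_on_subset by blast
    show "(fst v has_derivative blinfun_apply (blinfun_inner_left (Dy z))) (at z)" for z
      using dy[of z] by (simp add: blinfun_inner_left.rep_eq inner_commute)
  qed
  moreover have "snd v \<in> C1_closure (QT P)"
    unfolding C1_closure_def mem_Collect_eq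
  proof (intro conjI exI ballI)
    have "continuous_on UNIV (snd v)" by (rule has_derivative_continuous_on) (use dp in \<open>auto intro: has_derivative_at_withinI\<close>)
    then show "continuous_on (closure (QT P)) (snd v)" using continuous_on_subset by blast
    have bl: "blinfun_apply (Blinfun (\<lambda>h. \<chi> i. Dp i z \<bullet> h)) = (\<lambda>h. \<chi> i. Dp i z \<bullet> h)" for z
      by (rule bounded_linear_Blinfun_apply[OF has_derivative_bounded_linear[OF dp]])
    have Dpc: "continuous_on (closure (QT P)) (Dp i)" for i using p[of i] continuous_on_subset unfolding C1_with_def by blast
    show "continuous_on (closure (QT P)) (\<lambda>z. Blinfun (\<lambda>h. \<chi> i. Dp i z \<bullet> h))"
      by (rule continuous_on_blinfun_componentwise) (unfold bl, intro continuous_intros Dpc)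
    show "(snd v has_derivative blinfun_apply (Blinfun (\<lambda>h. \<chi> i. Dp i z \<bullet> h))) (at z)" for z
      unfolding bl by (rule dp)
  qed
  moreover have "fst v z = 0" if "z \<in> SigmaT P" for z
  proof -
    have "fst z \<notin> Omega P" using that Omega(1) by (auto simp: SigmaT_def cyl_def frontier_def interior_open)
    then show ?thesis using y unfolding interior_test_def by (metis prod.collapse subsetD)
  qed
  ultimately show "v \<in> U0 P" by (cases v) (auto simp: U0_def)
qed

lemma subspace_interior_states: "subspace (Phi0 ` interior_states)" "interior_states \<subseteq> U0 P"
proof -
  show sub: "interior_states \<subseteq> U0 P"
    unfolding interior_states_def using interior_state_derivatives(1) by blast
  show "subspace (Phi0 ` interior_states)"
  proof (rule subspace_Phi0_image[OF sub])
    have "((\<lambda>z. 0, \<lambda>z. 0) :: 'n state) \<in> interior_states"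
      unfolding interior_states_def using interior_test_zero C1_with_zero by fastforce
    then show "interior_states \<noteq> {}" by blast
    fix v w a b assume v: "v \<in> interior_states" and w: "w \<in> interior_states"
    obtain Dy Dp where d: "interior_test (Omega P) (fst v) Dy" "\<And>i. C1_with (\<lambda>z. snd v z $ i) (Dp i)"
      using v unfolding interior_states_def by blast
    obtain Ey Ep where e: "interior_test (Omega P) (fst w) Ey" "\<And>i. C1_with (\<lambda>z. snd w z $ i) (Ep i)"
      using w unfolding interior_states_def by blast
    have "interior_test (Omega P) (fst (lin_state a v b w)) (\<lambda>z. a *\<^sub>R Dy z + b *\<^sub>R Ey z)"
      using interior_test_lin[OF d(1) e(1)] by (simp add: lin_state_def)
    moreover have "C1_with (\<lambda>z. snd (lin_state a v b w) z $ i) (\<lambda>z. a *\<^sub>R Dp i z + b *\<^sub>R Ep i z)" for i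
      using C1_with_lin[OF d(2) e(2)] by (simp add: lin_state_def)
    ultimately show "lin_state a v b w \<in> interior_states" unfolding interior_states_def mem_Collect_eq
      by (intro exI[of _ "\<lambda>z. a *\<^sub>R Dy z + b *\<^sub>R Ey z"] exI[of _ "\<lambda>i z. a *\<^sub>R Dp i z + b *\<^sub>R Ep i z"]) blast
  qed
qed

text \<open>The factor from the energy estimate for \<open>D = dmax\<close>; it involves neither the observation region nor the weights.\<close>

definition energy_const :: real where
  "energy_const = exp (2 * (dmax + 1) * horizon P) * max 1 (1 / (2 * c0))"

lemma energy_const_pos: "energy_const > 0"
  by (simp add: energy_const_def less_max_iff_disj)

lemma L2_norm_nonneg: "0 \<le> L2_norm S f"
  by (simp add: L2_norm_def)

lemma L2_norm_weight:
  fixes f :: "'n spacetime \<Rightarrow> 'b::euclidean_space"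
  assumes r: "r \<in> Linf (QT P)" and w: "\<And>z. z \<in> QT P \<Longrightarrow> \<rho>s \<le> r z"
    and f: "f \<in> L2 (QT P)" and g: "(\<lambda>z. (1 / r z) *\<^sub>R f z) \<in> L2 (QT P)"
  shows "L2_norm (QT P) f \<le> Linf_norm (QT P) r * L2_norm (QT P) (\<lambda>z. (1 / r z) *\<^sub>R f z)"
proof (rule L2_bound(2)[OF g])
  show "f \<in> borel_measurable (lebesgue_on (QT P))" using f by (simp add: L2_def)
  show "0 \<le> Linf_norm (QT P) r" by (rule Linf_bound(2)[OF r])
  show "AE z in lebesgue_on (QT P). norm (f z) \<le> Linf_norm (QT P) r * norm ((1 / r z) *\<^sub>R f z)"
    using Linf_bound(1)[OF r] AE_space
  proof eventually_elim
    case (elim z)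
    have pos: "r z > 0" using w[of z] elim(2) weight(1) by auto
    have "norm (f z) = r z * norm ((1 / r z) *\<^sub>R f z)" using pos by simp
    also have "\<dots> \<le> Linf_norm (QT P) r * norm ((1 / r z) *\<^sub>R f z)" using elim(1) by (intro mult_right_mono) auto
    finally show ?case .
  qed
qed

text \<open>The energy estimate controls \<open>y\<close> on the whole cylinder. Its restriction to \<open>q\<^sub>T\<close> divided by \<open>\<rho>\<^sub>0 \<ge> \<rho>s\<close>
  is the observation, and the essential suprema of \<open>\<rho>\<^sub>1\<close> and \<open>\<rho>\<close> allow the operators to be replaced by their weighted versions.\<close>

lemma observation_bound:
  assumes v: "v \<in> interior_states"
  shows "(norm (fst (Phi0 v)))\<^sup>2 \<le> energy_const / \<rho>s\<^sup>2 * (Linf_norm (QT P) (wt1 P))\<^sup>2 * (norm (fst (snd (Phi0 v))))\<^sup>2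
    + energy_const / \<rho>s\<^sup>2 * (Linf_norm (QT P) (wt P))\<^sup>2 * (norm (snd (snd (Phi0 v))))\<^sup>2"
proof -
  obtain Dy Dp where d: "interior_test (Omega P) (fst v) Dy" "\<And>i. C1_with (\<lambda>z. snd v z $ i) (Dp i)"
    using v unfolding interior_states_def by blast
  have U: "v \<in> U0 P" by (rule interior_state_derivatives(1)[OF d])
  note F = weighted_L2[OF U] and L = U0_derivatives[OF U]
  have en: "(L2_norm (QT P) (fst v))\<^sup>2 \<le> energy_const * ((L2_norm (QT P) (opI P v))\<^sup>2 + (L2_norm (QT P) (opJ P v))\<^sup>2)"
    unfolding energy_const_def QT_eq
  proof (rule energy_estimate(2)[OF Omega(1,2) horizon c0 _ dmax(2) _ d])
    show "c0 * (norm \<xi>)\<^sup>2 \<le> (coeff_c P x *v \<xi>) \<bullet> \<xi>" if "x \<in> Omega P" for x \<xi>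
      using coercive[of x \<xi>] that closure_subset[of "Omega P"] by auto
    show "AE z in lebesgue_on (Omega P \<times> {0<..<horizon P}). \<bar>coeff_d P z\<bar> \<le> dmax"
      unfolding QT_eq[symmetric] by (rule dmax(1))
    show "opI P v \<in> L2 (Omega P \<times> {0<..<horizon P})" "opJ P v \<in> L2 (Omega P \<times> {0<..<horizon P})"
      using L(5,6) by (simp_all add: QT_eq)
  qed (rule interior_state_derivatives(2,3)[OF d])+
  have n0: "L2_norm (qT P) (fst v) \<le> L2_norm (QT P) (fst v)"
  proof -
    have i: "integrable (lebesgue_on (QT P)) (\<lambda>z. (norm (fst v z))\<^sup>2)" "integrable (lebesgue_on (qT P)) (\<lambda>z. (norm (fst v z))\<^sup>2)"
      using L(3,4) by (auto simp: L2_def)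
    have s: "QT P \<inter> space lebesgue \<in> sets lebesgue" "qT P \<inter> space lebesgue \<in> sets lebesgue" using QT(3) qT(3) by auto
    have "(LINT z|lebesgue_on (qT P). (norm (fst v z))\<^sup>2) \<le> (LINT z|lebesgue_on (QT P). (norm (fst v z))\<^sup>2)"
      unfolding integral_restrict_space[OF s(1)] integral_restrict_space[OF s(2)]
    proof (rule integral_mono)
      show "integrable lebesgue (\<lambda>z. indicator (qT P) z *\<^sub>R (norm (fst v z))\<^sup>2)"
        using i(2) integrable_restrict_space[OF s(2), of "\<lambda>z. (norm (fst v z))\<^sup>2"] by blast
      show "integrable lebesgue (\<lambda>z. indicator (QT P) z *\<^sub>R (norm (fst v z))\<^sup>2)"
        using i(1) integrable_restrict_space[OF s(1), of "\<lambda>z. (norm (fst v z))\<^sup>2"] by blast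
      show "indicator (qT P) z *\<^sub>R (norm (fst v z))\<^sup>2 \<le> indicator (QT P) z *\<^sub>R (norm (fst v z))\<^sup>2" for z
        using qT(4) by (auto split: split_indicator)
    qed
    then show ?thesis unfolding L2_norm_def by simp
  qed
  have "L2_norm (qT P) (obs_weighted v) \<le> 1 / \<rho>s * L2_norm (qT P) (fst v)"
    unfolding obs_weighted_def by (rule L2_divide_wt0(2)[OF L(4)])
  also have "\<dots> \<le> 1 / \<rho>s * L2_norm (QT P) (fst v)" using n0 weight(1) by (intro mult_left_mono) auto
  finally have "(L2_norm (qT P) (obs_weighted v))\<^sup>2 \<le> (1 / \<rho>s * L2_norm (QT P) (fst v))\<^sup>2"
    by (intro power_mono L2_norm_nonneg)
  also have "\<dots> = 1 / \<rho>s\<^sup>2 * (L2_norm (QT P) (fst v))\<^sup>2" by (simp add: power_mult_distrib power_divide)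
  also have "\<dots> \<le> 1 / \<rho>s\<^sup>2 * (energy_const * ((L2_norm (QT P) (opI P v))\<^sup>2 + (L2_norm (QT P) (opJ P v))\<^sup>2))"
    using en by (intro mult_left_mono) auto
  also have "\<dots> = energy_const / \<rho>s\<^sup>2 * (L2_norm (QT P) (opJ P v))\<^sup>2 + energy_const / \<rho>s\<^sup>2 * (L2_norm (QT P) (opI P v))\<^sup>2"
    by (simp add: algebra_simps)
  also have "\<dots> \<le> energy_const / \<rho>s\<^sup>2 * (Linf_norm (QT P) (wt1 P) * L2_norm (QT P) (J_weighted v))\<^sup>2
      + energy_const / \<rho>s\<^sup>2 * (Linf_norm (QT P) (wt P) * L2_norm (QT P) (I_weighted v))\<^sup>2"
  proof (intro add_mono mult_left_mono power_mono L2_norm_nonneg)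
    show "L2_norm (QT P) (opJ P v) \<le> Linf_norm (QT P) (wt1 P) * L2_norm (QT P) (J_weighted v)"
      using L2_norm_weight[OF weight(6) wt_pos(3) L(6)] F(2) by (simp add: J_weighted_def)
    show "L2_norm (QT P) (opI P v) \<le> Linf_norm (QT P) (wt P) * L2_norm (QT P) (I_weighted v)"
      using L2_norm_weight[OF weight(4) wt_pos(2) L(5)] F(3) by (simp add: I_weighted_def)
  qed (use energy_const_pos in auto)
  finally show ?thesis
    by (simp add: Phi0_def norm_lsq_on[OF qT(3) F(1)] norm_lsq_on[OF QT(3) F(2)] norm_lsq_on[OF QT(3) F(3)]
        power_mult_distrib mult.assoc)
qed

definition multipliers :: "(('n spacetime, real ^ 'n) lsq \<times> ('n spacetime, real) lsq) set" where
  "multipliers = (lsq_on (QT P) ` L2 (QT P)) \<times> (lsq_on (QT P) ` L2 (QT P))"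

lemma multipliers: "subspace multipliers" "closed multipliers"
  unfolding multipliers_def
  by (intro subspace_Times supported_lsq_closed_subspace(1)[OF QT(3)])
    (intro closed_Times supported_lsq_closed_subspace(2)[OF QT(3)])

lemma matrix_vector_mult_continuous: "continuous_on UNIV (\<lambda>x. (fst x :: real ^ 'a::finite ^ 'b::finite) *v snd x)"
  unfolding matrix_vector_mult_def by (intro continuous_intros)

lemma transpose_matrix_vector_mult_continuous:
  "continuous_on UNIV (\<lambda>x. transpose (fst x :: real ^ 'a::finite ^ 'b::finite) *v snd x)"
  unfolding matrix_vector_mult_def transpose_def by (simp, intro continuous_intros)

text \<open>Dividing the two components by \<open>\<rho>\<^sub>1\<close> and \<open>\<rho>\<close> gives \<open>\<mu>\<close> and \<open>l\<close>. States \<open>(0, \<theta> w)\<close> with a constant vector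
  \<open>w\<close> express that \<open>\<mu>\<close> is the weak gradient of \<open>l\<close>, and states \<open>(y, 0)\<close> express the backward
  equation, so uniqueness for the dual problem applies.\<close>

lemma orthogonal_multiplier_zero:
  assumes m: "m \<in> multipliers" and orth: "\<And>v. v \<in> interior_states \<Longrightarrow> m \<bullet> snd (Phi0 v) = 0"
  shows "m = 0"
proof -
  let ?M = "lebesgue_on (QT P)"
  obtain f1 f2 where f: "f1 \<in> L2 (QT P)" "f2 \<in> L2 (QT P)" "m = (lsq_on (QT P) f1, lsq_on (QT P) f2)"
    using m by (auto simp: multipliers_def)
  obtain h1 where h1: "sq_integrable h1" "\<And>z. z \<notin> QT P \<Longrightarrow> h1 z = 0" "lsq_on (QT P) f1 = lsq_of h1"
    using lsq_on_cases[OF QT(3) f(1)] by metis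
  obtain h2 where h2: "sq_integrable h2" "\<And>z. z \<notin> QT P \<Longrightarrow> h2 z = 0" "lsq_on (QT P) f2 = lsq_of h2"
    using lsq_on_cases[OF QT(3) f(2)] by metis
  note s1 = lsq_on_of_supported[OF QT(3) h1(1,2)] and s2 = lsq_on_of_supported[OF QT(3) h2(1,2)]
  have [measurable]: "h1 \<in> borel_measurable borel" "h2 \<in> borel_measurable borel" "QT P \<in> sets borel"
    using h1 h2 QT(3) by (auto simp: sq_integrable_def)
  define q1 q2 where "q1 z = indicator (QT P) z *\<^sub>R (1 / wt1 P z)" and "q2 z = indicator (QT P) z *\<^sub>R (1 / wt P z)" for z
  have "continuous_on (QT P) (\<lambda>z. 1 / wt1 P z)" "continuous_on (QT P) (\<lambda>z. 1 / wt P z)"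
    using wt_pos(2,3) weight(1) by (fastforce intro!: continuous_intros wt_continuous)+
  note qc = this
  have [measurable]: "q1 \<in> borel_measurable borel" "q2 \<in> borel_measurable borel"
    unfolding q1_def[abs_def] q2_def[abs_def]
    by (rule borel_measurable_continuous_on_indicator[OF QT(3) qc(1)],
        rule borel_measurable_continuous_on_indicator[OF QT(3) qc(2)])
  have q: "\<bar>q1 z\<bar> \<le> 1 / \<rho>s" "\<bar>q2 z\<bar> \<le> 1 / \<rho>s" for z
    using wt_pos(2,3)[of z] weight(1) by (auto simp: q1_def q2_def abs_divide frac_le split: split_indicator)
  define l where "l z = q2 z * h2 z" for z
  define \<mu> where "\<mu> z = q1 z *\<^sub>R h1 z" for z
  have lm [measurable]: "l \<in> borel_measurable borel" and \<mu>m [measurable]: "\<mu> \<in> borel_measurable borel"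
    unfolding l_def[abs_def] \<mu>_def[abs_def] by measurable
  have l: "sq_integrable l"
    by (rule sq_integrable_le[OF h2(1) lm, where c = "1 / \<rho>s"]) (use mult_right_mono[OF q(2)] in \<open>simp add: l_def abs_mult\<close>)
  have \<mu>: "sq_integrable \<mu>"
    by (rule sq_integrable_le[OF h1(1) \<mu>m, where c = "1 / \<rho>s"]) (use mult_right_mono[OF q(1)] in \<open>simp add: \<mu>_def\<close>)
  have supp: "l z = 0" "\<mu> z = 0" if "z \<notin> QT P" for z using h1(2) h2(2) that by (auto simp: l_def \<mu>_def)
  have dm: "coeff_d P \<in> borel_measurable ?M" using coeff_d by (simp add: Linf_def)
  obtain e where e: "e \<in> borel_measurable borel" "AE z in ?M. e z = coeff_d P z"
    using borel_representative[OF QT(3) dm] by blast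
  \<comment> \<open>a Borel version of \<open>d\<close>, clipped so that the bound holds everywhere\<close>
  define \<delta> where "\<delta> z = max (- dmax) (min dmax (e z))" for z
  have \<delta>m [measurable]: "\<delta> \<in> borel_measurable borel" unfolding \<delta>_def[abs_def] using e(1) by measurable
  have \<delta>b: "\<bar>\<delta> z\<bar> \<le> dmax" for z using dmax(2) by (auto simp: \<delta>_def abs_le_iff)
  have \<delta>: "AE z in ?M. \<delta> z = coeff_d P z"
    using e(2) dmax(1) by eventually_elim (auto simp: \<delta>_def abs_le_iff)
  define A where "A z = indicator (QT P) z *\<^sub>R coeff_c P (fst z)" for z
  have cc: "continuous_on (closure (Omega P)) (coeff_c P)" using coeff_c by (simp add: C1_closure_def)
  have "continuous_on (QT P) (\<lambda>z. coeff_c P (fst z))"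
    by (rule continuous_on_compose2[OF cc continuous_on_fst[OF continuous_on_id]])
      (use closure_subset[of "Omega P"] in \<open>auto simp: QT_eq\<close>)
  then have Am [measurable]: "A \<in> borel_measurable borel"
    unfolding A_def[abs_def] using QT(3) by (intro borel_measurable_continuous_on_indicator)
  have "bounded (coeff_c P ` closure (Omega P))"
    using Omega(2) by (intro compact_imp_bounded compact_continuous_image[OF cc]) (simp add: compact_closure)
  then obtain b where b: "\<And>x. x \<in> closure (Omega P) \<Longrightarrow> norm (coeff_c P x) \<le> b" by (auto simp: bounded_iff)
  have Ab: "norm (A z) \<le> \<bar>b\<bar>" for z
    using b[of "fst z"] closure_subset[of "Omega P"] by (cases "z \<in> QT P") (auto simp: A_def QT_eq)
  \<comment> \<open>the flux of the adjoint operator\<close>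
  define B where "B z = transpose (A z) *v \<mu> z" for z
  have Bm: "B \<in> borel_measurable borel"
    unfolding B_def[abs_def] by (rule borel_measurable_continuous_Pair[OF Am \<mu>m transpose_matrix_vector_mult_continuous])
  have Bdot: "B z \<bullet> w = \<mu> z \<bullet> (A z *v w)" for z w
    by (simp add: B_def transpose_matrix_vector dot_lmul_matrix)
  have Bb: "norm (B z) \<le> \<bar>b\<bar> * norm (\<mu> z)" for z
  proof -
    have "norm (B z) * norm (B z) = \<mu> z \<bullet> (A z *v B z)"
      by (simp add: Bdot[symmetric] power2_norm_eq_inner[symmetric] power2_eq_square)
    also have "\<dots> \<le> norm (\<mu> z) * norm (A z *v B z)" by (rule norm_cauchy_schwarz)
    also have "\<dots> \<le> norm (\<mu> z) * (\<bar>b\<bar> * norm (B z))"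
      by (intro mult_left_mono order_trans[OF norm_matrix_vector_mult_le] mult_right_mono Ab) auto
    finally have "norm (B z) * norm (B z) \<le> (\<bar>b\<bar> * norm (\<mu> z)) * norm (B z)" by (simp add: mult_ac)
    then show ?thesis by (cases "B z = 0") auto
  qed
  have Bsq: "sq_integrable B" by (rule sq_integrable_le[OF \<mu> Bm Bb])
  have test: "(LINT z|lborel. \<mu> z \<bullet> (A z *v fst (Dy z) - p z) + l z * (snd (Dy z) - (\<Sum>i\<in>UNIV. fst (Dp i z) $ i) + \<delta> z * y z)) = 0"
    if y: "interior_test (Omega P) y Dy" and p: "\<And>i. C1_with (\<lambda>z. p z $ i) (Dp i)" for y Dy p Dp
  proof -
    let ?v = "(y, p)"
    have W: "?v \<in> interior_states" unfolding interior_states_def using y p by auto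
    have dv: "interior_test (Omega P) (fst ?v) Dy" "\<And>i. C1_with (\<lambda>z. snd ?v z $ i) (Dp i)" using y p by auto
    note id = interior_state_derivatives[OF dv]
    note F = weighted_L2[OF id(1)]
    have yC: "C1_with y Dy" using y by (simp add: interior_test_def)
    have cont: "continuous_on UNIV y" "continuous_on UNIV Dy" "continuous_on UNIV (\<lambda>z. p z $ i)" "continuous_on UNIV (Dp i)" for i
      using C1_with_continuous[OF yC] C1_with_continuous[OF p] yC p by (auto simp: C1_with_def)
    have pc: "continuous_on UNIV p"
      using continuous_on_vec_lambda[of UNIV "\<lambda>i z. p z $ i"] cont(3) by simp
    define H where "H z = \<mu> z \<bullet> (A z *v fst (Dy z) - p z) + l z * (snd (Dy z) - (\<Sum>i\<in>UNIV. fst (Dp i z) $ i) + \<delta> z * y z)" for z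
    have [measurable]: "y \<in> borel_measurable borel" "p \<in> borel_measurable borel" "(\<lambda>z. snd (Dy z)) \<in> borel_measurable borel"
      "(\<lambda>z. \<Sum>i\<in>UNIV. fst (Dp i z) $ i) \<in> borel_measurable borel" "(\<lambda>z. fst (Dy z)) \<in> borel_measurable borel"
      by (auto intro!: borel_measurable_continuous_onI continuous_intros cont pc)
    have [measurable]: "(\<lambda>z. A z *v fst (Dy z)) \<in> borel_measurable borel"
      by (rule borel_measurable_continuous_Pair[OF _ _ matrix_vector_mult_continuous]) measurable
    have Hm: "H \<in> borel_measurable borel" unfolding H_def[abs_def] by measurable
    have "0 = m \<bullet> snd (Phi0 ?v)" using orth[OF W] by simp
    also have "\<dots> = lsq_on (QT P) h1 \<bullet> lsq_on (QT P) (J_weighted ?v) + lsq_on (QT P) h2 \<bullet> lsq_on (QT P) (I_weighted ?v)"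
      by (simp add: f(3) h1(3) h2(3) s1(2) s2(2) Phi0_def inner_prod_def)
    also have "\<dots> = (LINT z|?M. h1 z \<bullet> J_weighted ?v z) + (LINT z|?M. h2 z \<bullet> I_weighted ?v z)"
      by (rule arg_cong2[where f = plus, OF inner_lsq_on(1)[OF QT(3) s1(1) F(2)] inner_lsq_on(1)[OF QT(3) s2(1) F(3)]])
    also have "\<dots> = (LINT z|?M. h1 z \<bullet> J_weighted ?v z + h2 z \<bullet> I_weighted ?v z)"
      by (rule Bochner_Integration.integral_add[OF inner_lsq_on(2)[OF QT(3) s1(1) F(2)] inner_lsq_on(2)[OF QT(3) s2(1) F(3)], symmetric])
    also have "\<dots> = (LINT z|lborel. H z)"
    proof (rule integral_borel_representative(2)[OF QT(3) _ Hm])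
      show "(\<lambda>z. h1 z \<bullet> J_weighted ?v z + h2 z \<bullet> I_weighted ?v z) \<in> borel_measurable ?M"
        using borel_measurable_integrable[OF Bochner_Integration.integrable_add[OF inner_lsq_on(2)[OF QT(3) s1(1) F(2)] inner_lsq_on(2)[OF QT(3) s2(1) F(3)]]] .
      show "H z = 0" if "z \<notin> QT P" for z using supp[OF that] by (simp add: H_def)
      show "AE z in ?M. H z = h1 z \<bullet> J_weighted ?v z + h2 z \<bullet> I_weighted ?v z"
        using \<delta> AE_space
      proof eventually_elim
        case (elim z)
        then have z: "z \<in> QT P" by simp
        have "J_weighted ?v z = q1 z *\<^sub>R (A z *v fst (Dy z) - p z)" using z by (simp add: J_weighted_def id(3) q1_def A_def)
        moreover have "I_weighted ?v z = q2 z * (snd (Dy z) - (\<Sum>i\<in>UNIV. fst (Dp i z) $ i) + \<delta> z * y z)"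
          using z elim(1) by (simp add: I_weighted_def id(2) q2_def)
        ultimately show ?case by (simp add: H_def \<mu>_def l_def mult_ac)
      qed
    qed
    finally show ?thesis unfolding H_def by simp
  qed
  have "AE z in lborel. l z = 0 \<and> \<mu> z = 0"
  proof (rule parabolic_uniqueness[OF Omega l \<mu> Bsq _ _ c0 _ Bb \<delta>m \<delta>b, where T = "horizon P"])
    show "l z = 0" "\<mu> z = 0" if "z \<notin> Omega P \<times> {0<..<horizon P}" for z using supp[of z] that by (auto simp: QT_eq)
    show "c0 * (norm (\<mu> z))\<^sup>2 \<le> B z \<bullet> \<mu> z" for z
    proof (cases "z \<in> QT P")
      case True
      then have "fst z \<in> closure (Omega P)" using closure_subset[of "Omega P"] by (auto simp: QT_eq)
      from coercive[OF this, of "\<mu> z"] show ?thesis using True by (simp add: Bdot A_def inner_commute)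
    qed (simp add: supp)
    show "(LINT z|lborel. l z * (fst (D\<theta> z) \<bullet> w) + \<theta> z * (\<mu> z \<bullet> w)) = 0" if \<theta>: "C1_with \<theta> D\<theta>" for \<theta> D\<theta> w
    proof -
      have "C1_with (\<lambda>z. (\<theta> z *\<^sub>R w) $ i) (\<lambda>z. (w $ i) *\<^sub>R D\<theta> z)" for i
        using C1_with_lin[OF \<theta> \<theta>, of "w $ i" 0] by (simp add: mult.commute)
      note t = test[OF interior_test_zero this]
      define g where "g z = l z * (fst (D\<theta> z) \<bullet> w) + \<theta> z * (\<mu> z \<bullet> w)" for z
      have sumw: "(\<Sum>i\<in>UNIV. fst ((w $ i) *\<^sub>R D\<theta> z) $ i) = fst (D\<theta> z) \<bullet> w" for z
        by (simp add: inner_vec_def mult.commute)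
      have "\<mu> z \<bullet> (A z *v fst (0 :: 'n spacetime) - \<theta> z *\<^sub>R w)
          + l z * (snd (0 :: 'n spacetime) - (\<Sum>i\<in>UNIV. fst ((w $ i) *\<^sub>R D\<theta> z) $ i) + \<delta> z * 0) = - g z" for z
        unfolding sumw g_def by (simp add: inner_diff_right)
      with t have "(LINT z|lborel. - g z) = 0" by simp
      then show ?thesis unfolding g_def[symmetric] by simp
    qed
    show "(LINT z|lborel. l z * (snd (Dy z) + \<delta> z * y z) + B z \<bullet> fst (Dy z)) = 0" if y: "interior_test (Omega P) y Dy" for y Dy
      using test[OF y, of "\<lambda>z. 0" "\<lambda>i z. 0"] C1_with_zero by (simp add: Bdot add.commute)
  qed
  then have ae: "AE z in lborel. h2 z = 0 \<and> h1 z = 0"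
  proof eventually_elim
    case (elim z)
    show ?case
    proof (cases "z \<in> QT P")
      case True
      then have "q1 z \<noteq> 0" "q2 z \<noteq> 0" using wt_pos(2,3)[OF True] weight(1) by (auto simp: q1_def q2_def)
      then show ?thesis using elim by (simp add: l_def \<mu>_def)
    qed (simp add: h1 h2)
  qed
  then have "AE z in lborel. h1 z = 0" "AE z in lborel. h2 z = 0" by auto
  then have "lsq_of h1 = 0" "lsq_of h2 = 0"
    using lsq_of_eq_iff[OF h1(1) sq_integrable_zero] lsq_of_eq_iff[OF h2(1) sq_integrable_zero] by (simp_all add: zero_lsq_def)
  then show "m = 0" by (simp add: f(3) h1(3) h2(3) zero_prod_def)
qed

end

section \<open>The completion and the mixed formulation\<close>

text \<open>The choice in the extension by continuity is harmless: any two candidates are limits of the same sequence and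
  agree as classes.\<close>

lemma U_extend_eq:
  fixes F :: "'n::finite state \<Rightarrow> 'a::euclidean_space \<Rightarrow> 'b::euclidean_space"
  assumes S: "S \<in> sets borel" and u: "u \<noteq> {}" and F: "\<And>s k. s \<in> u \<Longrightarrow> F (s k) \<in> L2 S"
    and x: "x \<in> lsq_on S ` L2 S" and lim: "\<And>s. s \<in> u \<Longrightarrow> (\<lambda>k. lsq_on S (F (s k))) \<longlonglongrightarrow> x"
  shows "U_extend S F u \<in> L2 S" "lsq_on S (U_extend S F u) = x"
proof -
  let ?P = "\<lambda>f. f \<in> L2 S \<and> (\<forall>s\<in>u. (\<lambda>k. L2_norm S (\<lambda>z. F (s k) z - f z)) \<longlonglongrightarrow> 0)"
  have eq: "L2_norm S (\<lambda>z. F (s k) z - f z) = norm (lsq_on S (F (s k)) - lsq_on S f)" if "s \<in> u" "f \<in> L2 S" for s k f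
    using norm_lsq_on[OF S lsq_on_diff(1)[OF S F[OF that(1)] that(2)]] lsq_on_diff(2)[OF S F[OF that(1)] that(2)] by simp
  obtain f where f: "f \<in> L2 S" "x = lsq_on S f" using x by blast
  have "(\<lambda>k. L2_norm S (\<lambda>z. F (s k) z - f z)) \<longlonglongrightarrow> 0" if "s \<in> u" for s
    unfolding eq[OF that f(1)] using tendsto_norm[OF LIM_zero[OF lim[OF that]]] by (simp add: f(2))
  then have "?P f" using f(1) by blast
  then have P: "?P (U_extend S F u)" unfolding U_extend_def by (rule someI[where P = ?P])
  then show L: "U_extend S F u \<in> L2 S" by blast
  obtain s where s: "s \<in> u" using u by blast
  have "(\<lambda>k. norm (lsq_on S (F (s k)) - lsq_on S (U_extend S F u))) \<longlonglongrightarrow> 0"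
    using P s unfolding eq[OF s L, symmetric] by blast
  then have "(\<lambda>k. lsq_on S (F (s k)) - lsq_on S (U_extend S F u)) \<longlonglongrightarrow> 0"
    by (rule tendsto_norm_zero_cancel)
  then have "(\<lambda>k. lsq_on S (F (s k))) \<longlonglongrightarrow> lsq_on S (U_extend S F u)"
    by (rule LIM_zero_cancel)
  from LIMSEQ_unique[OF this lim[OF s]] show "lsq_on S (U_extend S F u) = x" .
qed

context parabolic_problem
begin

text \<open>The model of the completion inside the Hilbert space.\<close>

definition state_space :: "(('n spacetime, real) lsq \<times> ('n spacetime, real ^ 'n) lsq \<times> ('n spacetime, real) lsq) set" where
  "state_space = closure (Phi0 ` U0 P)"

lemma state_space: "subspace state_space" "closed state_space" "snd ` state_space \<subseteq> multipliers"
proof -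
  have "U0 P \<noteq> {}" using subspace_interior_states subspace_0 by blast
  then have "subspace (Phi0 ` U0 P)" using U0_lin(1) by (intro subspace_Phi0_image) auto
  then show "subspace state_space" unfolding state_space_def by (rule subspace_closure)
  show "closed state_space" by (simp add: state_space_def)
  have "closed (snd -` multipliers :: (('n spacetime, real) lsq \<times> ('n spacetime, real ^ 'n) lsq \<times> ('n spacetime, real) lsq) set)"
    by (rule continuous_closed_vimage[OF multipliers(2)]) (intro continuous_intros)
  moreover have "Phi0 ` U0 P \<subseteq> snd -` multipliers" using weighted_L2 by (auto simp: Phi0_def multipliers_def)
  ultimately have "state_space \<subseteq> snd -` multipliers" unfolding state_space_def by (intro closure_minimal)
  then show "snd ` state_space \<subseteq> multipliers" by auto
qed

text \<open>Adding \<open>eta1\<close> and \<open>eta2\<close> makes this the constant of the asserted estimate; the lift itself has the smaller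
  bound without them.\<close>

definition infsup_const :: real where
  "infsup_const = sqrt (max (energy_const / \<rho>s\<^sup>2 * (Linf_norm (QT P) (wt1 P))\<^sup>2 + eta1 P)
                            (energy_const / \<rho>s\<^sup>2 * (Linf_norm (QT P) (wt P))\<^sup>2 + eta2 P))"

text \<open>The lift is obtained from interior states only: they have dense second components by
  \<open>orthogonal_multiplier_zero\<close> and bounded first components by \<open>observation_bound\<close>.\<close>

lemma infsup:
  assumes x: "x \<in> multipliers"
  shows "\<exists>w. (w, x) \<in> state_space \<and> norm w \<le> infsup_const * norm x"
proof -
  let ?S = "Phi0 ` interior_states"
  define K1 K2 where "K1 = energy_const / \<rho>s\<^sup>2 * (Linf_norm (QT P) (wt1 P))\<^sup>2"
    and "K2 = energy_const / \<rho>s\<^sup>2 * (Linf_norm (QT P) (wt P))\<^sup>2"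
  have K: "0 \<le> K1" "0 \<le> K2" using energy_const_pos by (simp_all add: K1_def K2_def)
  define m where "m = max (K1 + eta1 P) (K2 + eta2 P)"
  have m: "K1 \<le> m" "K2 \<le> m" "0 \<le> m" using K eta by (auto simp: m_def)
  have beta: "infsup_const = sqrt m" by (simp add: infsup_const_def m_def K1_def K2_def)
  have "subspace (snd ` ?S)"
    by (rule linear_subspace_image[OF bounded_linear.linear[OF bounded_linear_snd] subspace_interior_states(1)])
  moreover have "snd ` ?S \<subseteq> multipliers"
    using state_space(3) closure_subset[of "Phi0 ` U0 P"] subspace_interior_states(2) unfolding state_space_def by blast
  ultimately have "closure (snd ` ?S) = multipliers"
    using orthogonal_multiplier_zero by (intro closure_subspace_eq_of_orthogonal multipliers) auto
  then have "x \<in> closure (snd ` ?S)" using x by simp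
  then have "\<exists>w. (w, x) \<in> closure ?S \<and> norm w \<le> infsup_const * norm x"
  proof (rule bounded_lift_of_dense_range[OF subspace_interior_states(1)])
    fix h assume "h \<in> ?S"
    then obtain v where v: "v \<in> interior_states" "h = Phi0 v" by blast
    have "(norm (fst h))\<^sup>2 \<le> K1 * (norm (fst (snd h)))\<^sup>2 + K2 * (norm (snd (snd h)))\<^sup>2"
      unfolding v(2) K1_def K2_def by (rule observation_bound[OF v(1)])
    also have "\<dots> \<le> m * (norm (fst (snd h)))\<^sup>2 + m * (norm (snd (snd h)))\<^sup>2"
      using m by (intro add_mono mult_right_mono) auto
    also have "\<dots> = m * (norm (snd h))\<^sup>2" by (simp add: norm_prod_def[of "snd h"] algebra_simps)
    finally have "sqrt ((norm (fst h))\<^sup>2) \<le> sqrt (m * (norm (snd h))\<^sup>2)" by (rule real_sqrt_le_mono)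
    then show "norm (fst h) \<le> infsup_const * norm (snd h)" by (simp add: beta real_sqrt_mult)
  qed
  moreover have "closure ?S \<subseteq> state_space" unfolding state_space_def using subspace_interior_states(2) by (intro closure_mono) auto
  ultimately show ?thesis by blast
qed

text \<open>The norm of \<open>U\<close> in the coordinates of the Hilbert space. It carries the factors \<open>eta1\<close> and \<open>eta2\<close>,
  whereas the mixed problem is solved for the unweighted norm; the two are equivalent.\<close>

definition state_norm :: "('n spacetime, real) lsq \<times> ('n spacetime, real ^ 'n) lsq \<times> ('n spacetime, real) lsq \<Rightarrow> real" where
  "state_norm h = sqrt ((norm (fst h))\<^sup>2 + eta1 P * (norm (fst (snd h)))\<^sup>2 + eta2 P * (norm (snd (snd h)))\<^sup>2)"

lemma state_norm_bounds:
  shows "\<exists>a b. a > 0 \<and> b > 0 \<and> (\<forall>h. a * norm h \<le> state_norm h) \<and> (\<forall>h. state_norm h \<le> b * norm h)"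
proof -
  define p q where "p = min 1 (min (eta1 P) (eta2 P))" and "q = max 1 (max (eta1 P) (eta2 P))"
  have p: "p > 0" "p \<le> 1" "p \<le> eta1 P" "p \<le> eta2 P" using eta by (auto simp: p_def)
  have q: "q > 0" "1 \<le> q" "eta1 P \<le> q" "eta2 P \<le> q" by (auto simp: q_def)
  have n: "(norm h)\<^sup>2 = (norm (fst h))\<^sup>2 + ((norm (fst (snd h)))\<^sup>2 + (norm (snd (snd h)))\<^sup>2)"
    for h :: "('n spacetime, real) lsq \<times> ('n spacetime, real ^ 'n) lsq \<times> ('n spacetime, real) lsq"
    by (simp add: norm_prod_def[of h] norm_prod_def[of "snd h"])
  have "sqrt p * norm h \<le> state_norm h" for h
  proof -
    have "sqrt p * norm h = sqrt (p * (norm h)\<^sup>2)" by (simp add: real_sqrt_mult)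
    also have "\<dots> \<le> state_norm h"
      unfolding state_norm_def n distrib_left add.assoc
      using p mult_right_mono[OF p(2), of "(norm (fst h))\<^sup>2"] by (intro real_sqrt_le_mono add_mono mult_right_mono) auto
    finally show ?thesis .
  qed
  moreover have "state_norm h \<le> sqrt q * norm h" for h
  proof -
    have "state_norm h \<le> sqrt (q * (norm h)\<^sup>2)"
      unfolding state_norm_def n distrib_left add.assoc
      using q mult_right_mono[OF q(2), of "(norm (fst h))\<^sup>2"] by (intro real_sqrt_le_mono add_mono mult_right_mono) auto
    also have "\<dots> = sqrt q * norm h" by (simp add: real_sqrt_mult)
    finally show ?thesis .
  qed
  ultimately show ?thesis using p(1) q(1) by (intro exI[of _ "sqrt p"] exI[of _ "sqrt q"]) auto
qed

lemma state_diff_lin: "state_diff v w = lin_state 1 v (- 1) w"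
  by (simp add: state_diff_def lin_state_def fun_eq_iff)

lemma state_diff_U0:
  assumes "v \<in> U0 P" "w \<in> U0 P"
  shows "state_diff v w \<in> U0 P" "Phi0 (state_diff v w) = Phi0 v - Phi0 w"
  unfolding state_diff_lin using U0_lin(1)[OF assms] Phi0_lin[OF assms] by auto

lemma U0_inner_self:
  assumes v: "v \<in> U0 P"
  shows "U0_inner P v v = (state_norm (Phi0 v))\<^sup>2"
proof -
  note F = weighted_L2[OF v]
  have "U0_inner P v v = (LINT z|lebesgue_on (qT P). obs_weighted v z \<bullet> obs_weighted v z)
      + eta1 P * (LINT z|lebesgue_on (QT P). J_weighted v z \<bullet> J_weighted v z) + eta2 P * (LINT z|lebesgue_on (QT P). I_weighted v z \<bullet> I_weighted v z)"
    unfolding U0_inner_def obs_weighted_def J_weighted_def I_weighted_def by (simp add: power2_eq_square)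
  also have "\<dots> = (norm (fst (Phi0 v)))\<^sup>2 + eta1 P * (norm (fst (snd (Phi0 v))))\<^sup>2 + eta2 P * (norm (snd (snd (Phi0 v))))\<^sup>2"
    unfolding Phi0_def power2_norm_eq_inner fst_conv snd_conv
    by (simp only: inner_lsq_on(1)[OF qT(3) F(1) F(1)] inner_lsq_on(1)[OF QT(3) F(2) F(2)] inner_lsq_on(1)[OF QT(3) F(3) F(3)])
  also have "\<dots> = (state_norm (Phi0 v))\<^sup>2"
    unfolding state_norm_def using eta by (subst real_sqrt_pow2) auto
  finally show ?thesis .
qed

lemma U0_dist_eq:
  assumes "v \<in> U0 P" "w \<in> U0 P"
  shows "U0_dist P v w = state_norm (Phi0 v - Phi0 w)"
proof -
  have "0 \<le> state_norm (Phi0 v - Phi0 w)" unfolding state_norm_def using eta by auto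
  then show ?thesis
    unfolding U0_dist_def U0_inner_self[OF state_diff_U0(1)[OF assms]] state_diff_U0(2)[OF assms] by simp
qed

lemma U_cauchy_iff: "s \<in> U_cauchy P \<longleftrightarrow> (\<forall>k. s k \<in> U0 P) \<and> Cauchy (\<lambda>k. Phi0 (s k))"
proof -
  obtain a b where ab: "a > 0" "b > 0" "\<And>h. a * norm h \<le> state_norm h" "\<And>h. state_norm h \<le> b * norm h"
    using state_norm_bounds by blast
  have "(\<forall>\<epsilon>>0. \<exists>M. \<forall>m\<ge>M. \<forall>n\<ge>M. U0_dist P (s m) (s n) < \<epsilon>) \<longleftrightarrow> Cauchy (\<lambda>k. Phi0 (s k))" if s: "\<forall>k. s k \<in> U0 P"
  proof
    assume c: "\<forall>\<epsilon>>0. \<exists>M. \<forall>m\<ge>M. \<forall>n\<ge>M. U0_dist P (s m) (s n) < \<epsilon>"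
    show "Cauchy (\<lambda>k. Phi0 (s k))"
    proof (rule metric_CauchyI)
      fix e :: real assume "e > 0"
      then have "a * e > 0" using ab by simp
      then obtain M where M: "\<And>m n. m \<ge> M \<Longrightarrow> n \<ge> M \<Longrightarrow> U0_dist P (s m) (s n) < a * e" using c by blast
      have "dist (Phi0 (s m)) (Phi0 (s n)) < e" if "m \<ge> M" "n \<ge> M" for m n
      proof -
        have "a * norm (Phi0 (s m) - Phi0 (s n)) < a * e"
          using ab(3)[of "Phi0 (s m) - Phi0 (s n)"] M[OF that] U0_dist_eq[of "s m" "s n"] s by simp
        then show ?thesis using ab(1) by (simp add: dist_norm)
      qed
      then show "\<exists>M. \<forall>m\<ge>M. \<forall>n\<ge>M. dist (Phi0 (s m)) (Phi0 (s n)) < e" by blast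
    qed
  next
    assume c: "Cauchy (\<lambda>k. Phi0 (s k))"
    show "\<forall>\<epsilon>>0. \<exists>M. \<forall>m\<ge>M. \<forall>n\<ge>M. U0_dist P (s m) (s n) < \<epsilon>"
    proof (intro allI impI)
      fix e :: real assume "e > 0"
      then obtain M where M: "\<And>m n. m \<ge> M \<Longrightarrow> n \<ge> M \<Longrightarrow> dist (Phi0 (s m)) (Phi0 (s n)) < e / b"
        using metric_CauchyD[OF c, of "e / b"] ab(2) by auto
      have "U0_dist P (s m) (s n) < e" if "m \<ge> M" "n \<ge> M" for m n
      proof -
        have "U0_dist P (s m) (s n) \<le> b * norm (Phi0 (s m) - Phi0 (s n))"
          using ab(4)[of "Phi0 (s m) - Phi0 (s n)"] U0_dist_eq[of "s m" "s n"] s by simp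
        also have "\<dots> < b * (e / b)" using M[OF that] ab(2) unfolding dist_norm by (intro mult_strict_left_mono)
        finally show ?thesis using ab(2) by simp
      qed
      then show "\<exists>M. \<forall>m\<ge>M. \<forall>n\<ge>M. U0_dist P (s m) (s n) < e" by blast
    qed
  qed
  then show ?thesis unfolding U_cauchy_def by blast
qed

definition state_lim :: "(nat \<Rightarrow> 'n state) \<Rightarrow> ('n spacetime, real) lsq \<times> ('n spacetime, real ^ 'n) lsq \<times> ('n spacetime, real) lsq" where
  "state_lim s = lim (\<lambda>k. Phi0 (s k))"

lemma state_lim:
  assumes "s \<in> U_cauchy P"
  shows "(\<lambda>k. Phi0 (s k)) \<longlonglongrightarrow> state_lim s" "state_lim s \<in> state_space"
proof -
  have "Cauchy (\<lambda>k. Phi0 (s k))" using assms U_cauchy_iff by blast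
  then show l: "(\<lambda>k. Phi0 (s k)) \<longlonglongrightarrow> state_lim s"
    unfolding state_lim_def using Cauchy_convergent convergent_LIMSEQ_iff by blast
  have "\<forall>k. Phi0 (s k) \<in> Phi0 ` U0 P" using assms U_cauchy_iff by blast
  then show "state_lim s \<in> state_space" unfolding state_space_def closure_sequential
    using l by (intro exI[of _ "\<lambda>k. Phi0 (s k)"] conjI)
qed

text \<open>Sequences at vanishing distance are those with the same limit in the Hilbert space, so a class in \<open>U\<close> is
  the same thing as a point of the closure.\<close>

lemma U_rel_iff: "(s, s') \<in> U_rel P \<longleftrightarrow> s \<in> U_cauchy P \<and> s' \<in> U_cauchy P \<and> state_lim s = state_lim s'"
proof -
  obtain a b where ab: "a > 0" "b > 0" "\<And>h. a * norm h \<le> state_norm h" "\<And>h. state_norm h \<le> b * norm h"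
    using state_norm_bounds by blast
  have "(\<lambda>k. U0_dist P (s k) (s' k)) \<longlonglongrightarrow> 0 \<longleftrightarrow> state_lim s = state_lim s'" if s: "s \<in> U_cauchy P" "s' \<in> U_cauchy P"
  proof -
    have U: "\<And>k. s k \<in> U0 P" "\<And>k. s' k \<in> U0 P" using s U_cauchy_iff by blast+
    define d where "d k = Phi0 (s k) - Phi0 (s' k)" for k
    have dist: "U0_dist P (s k) (s' k) = state_norm (d k)" for k unfolding d_def by (rule U0_dist_eq[OF U])
    have dlim: "d \<longlonglongrightarrow> state_lim s - state_lim s'" unfolding d_def[abs_def] by (intro tendsto_diff state_lim s)
    show ?thesis
      unfolding dist
    proof
      assume z: "(\<lambda>k. state_norm (d k)) \<longlonglongrightarrow> 0"
      have "(\<lambda>k. state_norm (d k) / a) \<longlonglongrightarrow> 0 / a" by (intro tendsto_divide z tendsto_const) (use ab in simp)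
      then have z': "(\<lambda>k. state_norm (d k) / a) \<longlonglongrightarrow> 0" by simp
      have "d \<longlonglongrightarrow> 0"
      proof (rule Lim_null_comparison[OF _ z'])
        show "\<forall>\<^sub>F k in sequentially. norm (d k) \<le> state_norm (d k) / a"
          using ab(1,3) by (intro always_eventually) (simp add: field_simps)
      qed
      from LIMSEQ_unique[OF dlim this] show "state_lim s = state_lim s'" by simp
    next
      assume "state_lim s = state_lim s'"
      then have "d \<longlonglongrightarrow> 0" using dlim by simp
      then have z': "(\<lambda>k. b * norm (d k)) \<longlonglongrightarrow> 0" by (intro tendsto_mult_right_zero tendsto_norm_zero)
      show "(\<lambda>k. state_norm (d k)) \<longlonglongrightarrow> 0"
      proof (rule Lim_null_comparison[OF _ z'])
        have "0 \<le> state_norm h" for h unfolding state_norm_def using eta by auto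
        then show "\<forall>\<^sub>F k in sequentially. norm (state_norm (d k)) \<le> b * norm (d k)"
          using ab(4) by (intro always_eventually) simp
      qed
    qed
  qed
  then show ?thesis unfolding U_rel_def by blast
qed

text \<open>The identification of the completion with \<open>state_space\<close>, by the common limit of all representing sequences.\<close>

definition Phi :: "(nat \<Rightarrow> 'n state) set \<Rightarrow> ('n spacetime, real) lsq \<times> ('n spacetime, real ^ 'n) lsq \<times> ('n spacetime, real) lsq" where
  "Phi u = state_lim (SOME s. s \<in> u)"

lemma U_class:
  assumes s: "s \<in> U_cauchy P"
  shows "U_rel P `` {s} \<in> U P" "Phi (U_rel P `` {s}) = state_lim s"
proof -
  show "U_rel P `` {s} \<in> U P" unfolding U_def using s by (rule quotientI)
  have "s \<in> U_rel P `` {s}" using s U_rel_iff by blast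
  then have "(SOME t. t \<in> U_rel P `` {s}) \<in> U_rel P `` {s}" by (rule someI[where P = "\<lambda>t. t \<in> U_rel P `` {s}"])
  then show "Phi (U_rel P `` {s}) = state_lim s" unfolding Phi_def using U_rel_iff by (metis Image_singleton_iff)
qed

lemma U_member:
  assumes u: "u \<in> U P" and s: "s \<in> u"
  shows "s \<in> U_cauchy P" "state_lim s = Phi u" "u = U_rel P `` {s}"
proof -
  obtain t where t: "t \<in> U_cauchy P" "u = U_rel P `` {t}" using u unfolding U_def by (rule quotientE)
  then have r: "(t, s) \<in> U_rel P" using s by blast
  then show sc: "s \<in> U_cauchy P" and "state_lim s = Phi u" using U_rel_iff[of t s] U_class(2)[OF t(1)] t(2) by auto
  show "u = U_rel P `` {s}" unfolding t(2) using r by (auto simp: U_rel_iff)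
qed

lemma U_nonempty: "u \<in> U P \<Longrightarrow> \<exists>s. s \<in> u"
  unfolding U_def by (erule quotientE) (use U_rel_iff in blast)

lemma Phi_in_state_space: "u \<in> U P \<Longrightarrow> Phi u \<in> state_space"
  using U_nonempty U_member(1,2) state_lim(2) by metis

lemma Phi_inj:
  assumes "u \<in> U P" "u' \<in> U P" "Phi u = Phi u'"
  shows "u = u'"
proof -
  obtain s s' where s: "s \<in> u" "s' \<in> u'" using U_nonempty assms by blast
  note m = U_member[OF assms(1) s(1)] and m' = U_member[OF assms(2) s(2)]
  have "(s, s') \<in> U_rel P" using m(1,2) m'(1,2) assms(3) by (simp add: U_rel_iff)
  then have "s' \<in> u" using m(3) by blast
  from U_member(3)[OF assms(1) this] m'(3) show ?thesis by simp
qed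

lemma Phi_surj:
  assumes "h \<in> state_space"
  obtains u where "u \<in> U P" "Phi u = h"
proof -
  obtain g where g: "\<forall>k. g k \<in> Phi0 ` U0 P" "g \<longlonglongrightarrow> h" using assms unfolding state_space_def closure_sequential by blast
  then have "\<forall>k. \<exists>v\<in>U0 P. g k = Phi0 v" by blast
  then obtain s where s: "\<And>k. s k \<in> U0 P" "\<And>k. g k = Phi0 (s k)" by metis
  have "g = (\<lambda>k. Phi0 (s k))" using s(2) by (rule ext)
  then have l: "(\<lambda>k. Phi0 (s k)) \<longlonglongrightarrow> h" using g(2) by simp
  then have sc: "s \<in> U_cauchy P" unfolding U_cauchy_iff using s(1) LIMSEQ_imp_Cauchy by blast
  have "state_lim s = h" using LIMSEQ_unique[OF state_lim(1)[OF sc] l] .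
  then show thesis using U_class[OF sc] that by metis
qed

lemma U_diff_Phi:
  assumes u: "u \<in> U P" and v: "v \<in> U P"
  shows "U_diff P u v \<in> U P" "Phi (U_diff P u v) = Phi u - Phi v"
proof -
  have diff: "(\<lambda>k. state_diff (s k) (s' k)) \<in> U_cauchy P \<and> state_lim (\<lambda>k. state_diff (s k) (s' k)) = Phi u - Phi v"
    if "s \<in> u" "s' \<in> v" for s s'
  proof -
    note m = U_member[OF u that(1)] and m' = U_member[OF v that(2)]
    have U: "\<And>k. s k \<in> U0 P" "\<And>k. s' k \<in> U0 P" using m(1) m'(1) U_cauchy_iff by blast+
    have "(\<lambda>k. Phi0 (s k) - Phi0 (s' k)) \<longlonglongrightarrow> Phi u - Phi v"
      using tendsto_diff[OF state_lim(1)[OF m(1)] state_lim(1)[OF m'(1)]] by (simp add: m(2) m'(2))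
    then have l: "(\<lambda>k. Phi0 (state_diff (s k) (s' k))) \<longlonglongrightarrow> Phi u - Phi v" by (simp add: state_diff_U0(2) U)
    then have c: "(\<lambda>k. state_diff (s k) (s' k)) \<in> U_cauchy P"
      unfolding U_cauchy_iff using state_diff_U0(1)[OF U] LIMSEQ_imp_Cauchy by blast
    show ?thesis using c LIMSEQ_unique[OF state_lim(1)[OF c] l] by blast
  qed
  obtain s0 s0' where s0: "s0 \<in> u" "s0' \<in> v" using U_nonempty u v by blast
  let ?d = "\<lambda>k. state_diff (s0 k) (s0' k)"
  note d0 = diff[OF s0]
  have "U_rel P `` {\<lambda>k. state_diff (s k) (s' k)} = U_rel P `` {?d}" if "s \<in> u" "s' \<in> v" for s s'
    using diff[OF that] d0 by (auto simp: U_rel_iff)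
  then have "U_diff P u v = U_rel P `` {?d}" unfolding U_diff_def using s0 by blast
  then show "U_diff P u v \<in> U P" "Phi (U_diff P u v) = Phi u - Phi v" using U_class[of ?d] d0 by auto
qed

text \<open>The extended operators are the components of the limit, because each is continuous along the
  representing sequences.\<close>

lemma extended_maps:
  assumes u: "u \<in> U P"
  shows "obs_map P u \<in> L2 (qT P)" "lsq_on (qT P) (obs_map P u) = fst (Phi u)"
    and "J_map P u \<in> L2 (QT P)" "lsq_on (QT P) (J_map P u) = fst (snd (Phi u))"
    and "I_map P u \<in> L2 (QT P)" "lsq_on (QT P) (I_map P u) = snd (snd (Phi u))"
proof -
  obtain s where s: "s \<in> u" using U_nonempty[OF u] by blast
  then have ne: "u \<noteq> {}" by blast
  have U: "t k \<in> U0 P" if "t \<in> u" for t k using U_member(1)[OF u that] U_cauchy_iff by blast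
  have l: "(\<lambda>k. Phi0 (t k)) \<longlonglongrightarrow> Phi u" if "t \<in> u" for t
    using state_lim(1)[OF U_member(1)[OF u that]] U_member(2)[OF u that] by simp
  have l0: "(\<lambda>k. lsq_on (qT P) (obs_weighted (t k))) \<longlonglongrightarrow> fst (Phi u)"
    and l1: "(\<lambda>k. lsq_on (QT P) (J_weighted (t k))) \<longlonglongrightarrow> fst (snd (Phi u))"
    and l2: "(\<lambda>k. lsq_on (QT P) (I_weighted (t k))) \<longlonglongrightarrow> snd (snd (Phi u))" if "t \<in> u" for t
    using tendsto_fst[OF l[OF that]] tendsto_fst[OF tendsto_snd[OF l[OF that]]] tendsto_snd[OF tendsto_snd[OF l[OF that]]]
    by (simp_all add: Phi0_def)
  have c0: "fst (Phi u) \<in> lsq_on (qT P) ` L2 (qT P)"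
    by (rule closed_sequentially[OF supported_lsq_closed_subspace(2)[OF qT(3)] _ l0[OF s]]) (use weighted_L2(1)[OF U[OF s]] in blast)
  have c1: "fst (snd (Phi u)) \<in> lsq_on (QT P) ` L2 (QT P)"
    by (rule closed_sequentially[OF supported_lsq_closed_subspace(2)[OF QT(3)] _ l1[OF s]]) (use weighted_L2(2)[OF U[OF s]] in blast)
  have c2: "snd (snd (Phi u)) \<in> lsq_on (QT P) ` L2 (QT P)"
    by (rule closed_sequentially[OF supported_lsq_closed_subspace(2)[OF QT(3)] _ l2[OF s]]) (use weighted_L2(3)[OF U[OF s]] in blast)
  have o: "obs_map P u = U_extend (qT P) obs_weighted u" "J_map P u = U_extend (QT P) J_weighted u" "I_map P u = U_extend (QT P) I_weighted u"
    by (simp_all add: obs_map_def J_map_def I_map_def obs_weighted_def[abs_def] J_weighted_def[abs_def] I_weighted_def[abs_def])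
  show "obs_map P u \<in> L2 (qT P)" "lsq_on (qT P) (obs_map P u) = fst (Phi u)"
    unfolding o by (rule U_extend_eq[OF qT(3) ne weighted_L2(1)[OF U] c0 l0], assumption+)+
  show "J_map P u \<in> L2 (QT P)" "lsq_on (QT P) (J_map P u) = fst (snd (Phi u))"
    unfolding o by (rule U_extend_eq[OF QT(3) ne weighted_L2(2)[OF U] c1 l1], assumption+)+
  show "I_map P u \<in> L2 (QT P)" "lsq_on (QT P) (I_map P u) = snd (snd (Phi u))"
    unfolding o by (rule U_extend_eq[OF QT(3) ne weighted_L2(3)[OF U] c2 l2], assumption+)+
qed

lemma U_norm_eq:
  assumes u: "u \<in> U P"
  shows "U_norm P u = state_norm (Phi u)"
  using extended_maps[OF u]
  by (simp add: U_norm_def state_norm_def norm_lsq_on[OF qT(3), symmetric] norm_lsq_on[OF QT(3), symmetric])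

text \<open>The components are exchanged because the residual of a state lists \<open>\<J>\<close> before \<open>\<I>\<close>, while a
  multiplier lists the scalar \<open>\<lambda>\<close> first.\<close>

definition multiplier :: "'n state \<Rightarrow> ('n spacetime, real ^ 'n) lsq \<times> ('n spacetime, real) lsq" where
  "multiplier m = (lsq_on (QT P) (snd m), lsq_on (QT P) (fst m))"

definition data :: "('n spacetime \<Rightarrow> real) \<Rightarrow> ('n spacetime, real) lsq" where
  "data y = lsq_on (qT P) (\<lambda>z. y z / wt0 P z)"

lemma multiplier_image: "multiplier ` X P = multipliers"
  unfolding multiplier_def multipliers_def X_def by force

lemma X_components: "m \<in> X P \<Longrightarrow> fst m \<in> L2 (QT P)" "m \<in> X P \<Longrightarrow> snd m \<in> L2 (QT P)"
  by (auto simp: X_def)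

lemma X_norm_eq:
  assumes "m \<in> X P"
  shows "X_norm P m = norm (multiplier m)"
  using X_components[OF assms]
  by (simp add: X_norm_def multiplier_def norm_prod_def norm_lsq_on[OF QT(3)] add.commute)

lemma X_eq_iff:
  assumes "m \<in> X P" "m' \<in> X P"
  shows "X_eq P m m' \<longleftrightarrow> multiplier m = multiplier m'"
  using X_components[OF assms(1)] X_components[OF assms(2)]
  by (auto simp: X_eq_def multiplier_def lsq_on_eq_iff[OF QT(3)])

lemma X_diff:
  assumes "m \<in> X P" "m' \<in> X P"
  shows "state_diff m m' \<in> X P" "multiplier (state_diff m m') = multiplier m - multiplier m'"
  using lsq_on_diff[OF QT(3) X_components(1)[OF assms(1)] X_components(1)[OF assms(2)]]
    lsq_on_diff[OF QT(3) X_components(2)[OF assms(1)] X_components(2)[OF assms(2)]]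
  by (auto simp: X_def state_diff_def multiplier_def)

lemma form_a_eq: "u \<in> U P \<Longrightarrow> v \<in> U P \<Longrightarrow> form_a P u v = fst (Phi u) \<bullet> fst (Phi v)"
  using inner_lsq_on(1)[OF qT(3) extended_maps(1)[of u] extended_maps(1)[of v]] extended_maps(2)[of u] extended_maps(2)[of v]
  by (simp add: form_a_def)

lemma form_l_eq: "y \<in> L2 (qT P) \<Longrightarrow> u \<in> U P \<Longrightarrow> form_l P y u = data y \<bullet> fst (Phi u)"
  using inner_lsq_on(1)[OF qT(3) extended_maps(1)[of u] L2_divide_wt0(1)[of y]] extended_maps(2)[of u]
  by (simp add: form_l_def data_def inner_commute)

lemma form_b_eq: "u \<in> U P \<Longrightarrow> m \<in> X P \<Longrightarrow> form_b P u m = snd (Phi u) \<bullet> multiplier m"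
  using inner_lsq_on(1)[OF QT(3) extended_maps(3)[of u] X_components(2)[of m]] extended_maps(4)[of u]
    inner_lsq_on(1)[OF QT(3) extended_maps(5)[of u] X_components(1)[of m]] extended_maps(6)[of u]
  by (simp add: form_b_def multiplier_def inner_prod_def)

lemma ball_state_space: "(\<forall>h\<in>state_space. Q h) \<longleftrightarrow> (\<forall>v\<in>U P. Q (Phi v))"
  using Phi_in_state_space Phi_surj by metis

lemma ball_multipliers: "(\<forall>k\<in>multipliers. Q k) \<longleftrightarrow> (\<forall>k\<in>X P. Q (multiplier k))"
  unfolding multiplier_image[symmetric] by blast

text \<open>As \<open>Phi\<close> maps \<open>U\<close> onto \<open>state_space\<close> and multipliers are represented without loss, quantifying over
  test functions is the same on both sides.\<close>

lemma is_solution_iff: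
  assumes y: "y \<in> L2 (qT P)"
  shows "is_solution P y u m \<longleftrightarrow> u \<in> U P \<and> m \<in> X P \<and> mixed_solution state_space multipliers (data y) (Phi u) (multiplier m)"
proof (cases "u \<in> U P \<and> m \<in> X P")
  case True
  then have "Phi u \<in> state_space" "multiplier m \<in> multipliers" using Phi_in_state_space multiplier_image by auto
  then show ?thesis
    using True by (simp add: is_solution_def mixed_solution_def ball_state_space ball_multipliers form_a_eq form_b_eq form_l_eq[OF y])
qed (auto simp: is_solution_def)

lemma is_saddle_point_iff:
  assumes y: "y \<in> L2 (qT P)"
  shows "is_saddle_point P y u m \<longleftrightarrow> u \<in> U P \<and> m \<in> X P \<and> mixed_saddle state_space multipliers (data y) (Phi u) (multiplier m)"
proof (cases "u \<in> U P \<and> m \<in> X P")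
  case True
  then have "Phi u \<in> state_space" "multiplier m \<in> multipliers" using Phi_in_state_space multiplier_image by auto
  moreover have "lagrangian P y v k = mixed_lagrangian (data y) (Phi v) (multiplier k)" if "v \<in> U P" "k \<in> X P" for v k
    using that by (simp add: lagrangian_def mixed_lagrangian_def form_a_eq form_b_eq form_l_eq[OF y])
  ultimately show ?thesis
    using True by (simp add: is_saddle_point_def mixed_saddle_def ball_state_space ball_multipliers)
qed (auto simp: is_saddle_point_def)

lemma infsup_const_nonneg: "0 \<le> infsup_const"
  unfolding infsup_const_def using energy_const_pos eta by (auto simp: le_max_iff_disj)

text \<open>The constraint makes the second component of a solution vanish, so its norm in \<open>U\<close> is that of the
  observation alone.\<close>

lemma solution_bounds:
  assumes y: "y \<in> L2 (qT P)" and sol: "is_solution P y u m"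
  shows "U_norm P u \<le> L2_norm (qT P) (\<lambda>z. y z / wt0 P z)"
    and "X_norm P m \<le> infsup_const * L2_norm (qT P) (\<lambda>z. y z / wt0 P z)"
proof -
  have s: "u \<in> U P" "m \<in> X P" "mixed_solution state_space multipliers (data y) (Phi u) (multiplier m)"
    using sol is_solution_iff[OF y] by auto
  note b = mixed_solution_bounds[OF infsup infsup_const_nonneg state_space(3) s(3)]
  have n: "norm (data y) = L2_norm (qT P) (\<lambda>z. y z / wt0 P z)"
    unfolding data_def by (rule norm_lsq_on[OF qT(3) L2_divide_wt0(1)[OF y]])
  show "U_norm P u \<le> L2_norm (qT P) (\<lambda>z. y z / wt0 P z)"
    using b(1,2) n by (simp add: U_norm_eq[OF s(1)] state_norm_def)
  show "X_norm P m \<le> infsup_const * L2_norm (qT P) (\<lambda>z. y z / wt0 P z)"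
    using b(3) n by (simp add: X_norm_eq[OF s(2)])
qed

lemma solution_unique:
  assumes y: "y \<in> L2 (qT P)" and s: "is_solution P y u m" "is_solution P y u' m'"
  shows "u' = u" "X_eq P m' m"
proof -
  have a: "u \<in> U P" "m \<in> X P" "u' \<in> U P" "m' \<in> X P"
    "mixed_solution state_space multipliers (data y) (Phi u) (multiplier m)"
    "mixed_solution state_space multipliers (data y) (Phi u') (multiplier m')"
    using s is_solution_iff[OF y] by auto
  note b = mixed_solution_bounds[OF infsup infsup_const_nonneg state_space(3) mixed_solution_diff[OF state_space(1) multipliers(1) a(5,6)]]
  have "Phi u' - Phi u = 0" using b(1,2) by (simp add: prod_eq_iff)
  then show "u' = u" using Phi_inj[OF a(3,1)] by simp
  show "X_eq P m' m" using b(3) by (simp add: X_eq_iff[OF a(4,2)])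
qed

lemma data_diff:
  assumes "y \<in> L2 (qT P)" "y' \<in> L2 (qT P)"
  shows "norm (data y' - data y) \<le> 1 / \<rho>s * L2_norm (qT P) (\<lambda>z. y' z - y z)"
proof -
  note d = lsq_on_diff[OF qT(3) L2_divide_wt0(1)[OF assms(2)] L2_divide_wt0(1)[OF assms(1)]]
  have "norm (data y' - data y) = L2_norm (qT P) (\<lambda>z. (y' z - y z) / wt0 P z)"
    unfolding data_def d(2)[symmetric] norm_lsq_on[OF qT(3) d(1)] by (simp add: diff_divide_distrib)
  also have "\<dots> \<le> 1 / \<rho>s * L2_norm (qT P) (\<lambda>z. y' z - y z)"
    by (rule L2_divide_wt0(2)[OF lsq_on_diff(1)[OF qT(3) assms(2,1)]])
  finally show ?thesis .
qed

text \<open>A solution is linear in the data, so the bounds for the difference of two solutions give continuity. The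
  summand \<open>1\<close> in \<open>\<delta>\<close> makes one \<open>\<delta>\<close> serve both for the state, with constant \<open>1\<close>, and for the multiplier.\<close>

lemma well_posed: "well_posed P"
  unfolding well_posed_def
proof (intro conjI ballI allI impI)
  fix y :: "'n spacetime \<Rightarrow> real" assume y: "y \<in> L2 (qT P)"
  obtain h k where hk: "mixed_solution state_space multipliers (data y) h k"
    using mixed_solution_exists[OF state_space(1,2) multipliers state_space(3) infsup] by blast
  then have "h \<in> state_space" "k \<in> multipliers" by (auto simp: mixed_solution_def)
  then obtain u m where u: "u \<in> U P" "Phi u = h" and m: "m \<in> X P" "multiplier m = k"
    using Phi_surj multiplier_image by (metis imageE)
  have "is_solution P y u m" using is_solution_iff[OF y] u m hk by simp
  then show "\<exists>u m. is_solution P y u m \<and> (\<forall>u' m'. is_solution P y u' m' \<longrightarrow> u' = u \<and> X_eq P m' m)"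
    using solution_unique[OF y] by blast
next
  fix y :: "'n spacetime \<Rightarrow> real" and e :: real assume y: "y \<in> L2 (qT P)" and e: "e > 0"
  define \<delta> where "\<delta> = e * \<rho>s / (infsup_const + 1)"
  have \<delta>: "\<delta> > 0" unfolding \<delta>_def using e weight(1) infsup_const_nonneg by (intro divide_pos_pos) auto
  have small: "U_norm P (U_diff P u' u) < e \<and> X_norm P (state_diff m' m) < e"
    if y': "y' \<in> L2 (qT P)" "L2_norm (qT P) (\<lambda>z. y' z - y z) < \<delta>" and s: "is_solution P y u m" "is_solution P y' u' m'"
    for y' u m u' m'
  proof -
    have a: "u \<in> U P" "m \<in> X P" "u' \<in> U P" "m' \<in> X P"
      "mixed_solution state_space multipliers (data y) (Phi u) (multiplier m)"
      "mixed_solution state_space multipliers (data y') (Phi u') (multiplier m')"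
      using s is_solution_iff[OF y] is_solution_iff[OF y'(1)] by auto
    note b = mixed_solution_bounds[OF infsup infsup_const_nonneg state_space(3) mixed_solution_diff[OF state_space(1) multipliers(1) a(5,6)]]
    have "norm (data y' - data y) \<le> 1 / \<rho>s * L2_norm (qT P) (\<lambda>z. y' z - y z)" by (rule data_diff[OF y y'(1)])
    also have "\<dots> < 1 / \<rho>s * \<delta>" using y'(2) weight(1) by (intro mult_strict_left_mono) auto
    also have "\<dots> = e / (infsup_const + 1)" using weight(1) by (simp add: \<delta>_def)
    finally have d: "norm (data y' - data y) < e / (infsup_const + 1)" .
    then have d': "(infsup_const + 1) * norm (data y' - data y) < e"
      using infsup_const_nonneg by (simp add: field_simps)
    have "norm (data y' - data y) \<le> (infsup_const + 1) * norm (data y' - data y)"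
      using infsup_const_nonneg by (simp add: distrib_right)
    moreover have "infsup_const * norm (data y' - data y) \<le> (infsup_const + 1) * norm (data y' - data y)"
      by (simp add: distrib_right)
    moreover have "U_norm P (U_diff P u' u) = norm (fst (Phi u' - Phi u))"
      using b(1) by (simp add: U_norm_eq[OF U_diff_Phi(1)[OF a(3,1)]] U_diff_Phi(2)[OF a(3,1)] state_norm_def)
    moreover have "X_norm P (state_diff m' m) = norm (multiplier m' - multiplier m)"
      by (simp add: X_norm_eq[OF X_diff(1)[OF a(4,2)]] X_diff(2)[OF a(4,2)])
    ultimately show ?thesis using b(2,3) d' by linarith
  qed
  show "\<exists>\<delta>>0. \<forall>y'\<in>L2 (qT P). L2_norm (qT P) (\<lambda>z. y' z - y z) < \<delta> \<longrightarrow>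
      (\<forall>u m u' m'. is_solution P y u m \<and> is_solution P y' u' m' \<longrightarrow>
        U_norm P (U_diff P u' u) < e \<and> X_norm P (state_diff m' m) < e)"
    using \<delta> small by blast
qed

lemma saddle_point_iff_solution:
  assumes y: "y \<in> L2 (qT P)"
  shows "is_saddle_point P y u m \<longleftrightarrow> is_solution P y u m"
  unfolding is_saddle_point_iff[OF y] is_solution_iff[OF y] mixed_saddle_iff_solution[OF state_space(1) multipliers(1)] ..

end

text \<open>The constant \<open>C\<close> has to be fixed before the weights and the observation region. It is the constant
  of the energy estimate, which is expressed by \<open>T\<close>, \<open>c0\<close> and \<open>d\<close>.\<close>

theorem theorem3p1:
  fixes \<Omega> :: "(real ^ 'n::finite) set" and T c0 :: real
    and c :: "real ^ 'n \<Rightarrow> real ^ 'n ^ 'n"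
    and d :: "(real ^ 'n) \<times> real \<Rightarrow> real"
  assumes "bounded_C2_domain \<Omega>" and "T > 0"
    and "c \<in> C1_closure \<Omega>"
    and "c0 > 0" and "\<And>x \<xi>. x \<in> closure \<Omega> \<Longrightarrow> (c x *v \<xi>) \<bullet> \<xi> \<ge> c0 * (norm \<xi>)\<^sup>2"
    and "d \<in> Linf (cyl \<Omega> T)"
  shows "\<exists>C>0. \<forall>\<omega> \<rho>s \<rho>0 \<rho> \<rho>1 \<eta>1 \<eta>2.
    open \<omega> \<and> \<omega> \<noteq> {} \<and> \<omega> \<subseteq> \<Omega> \<and> \<rho>s > 0 \<and> \<eta>1 > 0 \<and> \<eta>2 > 0 \<and>
    \<rho>0 \<in> weight_class \<Omega> T \<rho>s \<and>
    \<rho> \<in> weight_class \<Omega> T \<rho>s \<inter> Linf (cyl \<Omega> T) \<and>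
    \<rho>1 \<in> weight_class \<Omega> T \<rho>s \<inter> Linf (cyl \<Omega> T) \<longrightarrow>
    (\<forall>P. P = \<lparr>Omega = \<Omega>, omega = \<omega>, horizon = T, coeff_c = c, coeff_d = d,
              wt0 = \<rho>0, wt = \<rho>, wt1 = \<rho>1, eta1 = \<eta>1, eta2 = \<eta>2\<rparr> \<longrightarrow>
      well_posed P \<and>
      (\<forall>yobs\<in>L2 (qT P). \<forall>u m. is_solution P yobs u m \<longrightarrow>
         is_saddle_point P yobs u m \<and>
         (\<forall>u' m'. is_saddle_point P yobs u' m' \<longrightarrow> u' = u \<and> X_eq P m' m) \<and>
         U_norm P u \<le> L2_norm (qT P) (\<lambda>z. yobs z / \<rho>0 z) \<and>
         X_norm P m \<le>
           2 * sqrt (max (C / \<rho>s\<^sup>2 * (Linf_norm (QT P) \<rho>1)\<^sup>2 + \<eta>1)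
                         (C / \<rho>s\<^sup>2 * (Linf_norm (QT P) \<rho>)\<^sup>2 + \<eta>2))
             * L2_norm (qT P) (\<lambda>z. yobs z / \<rho>0 z)))"
proof -
  define C where "C = exp (2 * (max 0 (Linf_norm (cyl \<Omega> T) d) + 1) * T) * max 1 (1 / (2 * c0))"
  have "C > 0" by (simp add: C_def less_max_iff_disj)
  have main: "well_posed P \<and>
      (\<forall>yobs\<in>L2 (qT P). \<forall>u m. is_solution P yobs u m \<longrightarrow>
         is_saddle_point P yobs u m \<and>
         (\<forall>u' m'. is_saddle_point P yobs u' m' \<longrightarrow> u' = u \<and> X_eq P m' m) \<and>
         U_norm P u \<le> L2_norm (qT P) (\<lambda>z. yobs z / \<rho>0 z) \<and>
         X_norm P m \<le>
           2 * sqrt (max (C / \<rho>s\<^sup>2 * (Linf_norm (QT P) \<rho>1)\<^sup>2 + \<eta>1)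
                         (C / \<rho>s\<^sup>2 * (Linf_norm (QT P) \<rho>)\<^sup>2 + \<eta>2))
             * L2_norm (qT P) (\<lambda>z. yobs z / \<rho>0 z))"
    if H: "open \<omega> \<and> \<omega> \<noteq> {} \<and> \<omega> \<subseteq> \<Omega> \<and> \<rho>s > 0 \<and> \<eta>1 > 0 \<and> \<eta>2 > 0 \<and>
        \<rho>0 \<in> weight_class \<Omega> T \<rho>s \<and>
        \<rho> \<in> weight_class \<Omega> T \<rho>s \<inter> Linf (cyl \<Omega> T) \<and>
        \<rho>1 \<in> weight_class \<Omega> T \<rho>s \<inter> Linf (cyl \<Omega> T)"
      and P: "P = \<lparr>Omega = \<Omega>, omega = \<omega>, horizon = T, coeff_c = c, coeff_d = d,
              wt0 = \<rho>0, wt = \<rho>, wt1 = \<rho>1, eta1 = \<eta>1, eta2 = \<eta>2\<rparr>"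
    for \<omega> \<rho>s \<rho>0 \<rho> \<rho>1 \<eta>1 \<eta>2 and P :: "'n problem"
  proof -
    interpret parabolic_problem P c0 \<rho>s
      by unfold_locales (use assms H in \<open>auto simp: P QT_def\<close>)
    have const: "infsup_const = sqrt (max (C / \<rho>s\<^sup>2 * (Linf_norm (QT P) \<rho>1)\<^sup>2 + \<eta>1)
        (C / \<rho>s\<^sup>2 * (Linf_norm (QT P) \<rho>)\<^sup>2 + \<eta>2))"
      unfolding infsup_const_def energy_const_def dmax_def C_def by (simp add: P QT_def)
    have w0: "wt0 P = \<rho>0" by (simp add: P)
    have "is_saddle_point P yobs u m \<and>
         (\<forall>u' m'. is_saddle_point P yobs u' m' \<longrightarrow> u' = u \<and> X_eq P m' m) \<and>
         U_norm P u \<le> L2_norm (qT P) (\<lambda>z. yobs z / \<rho>0 z) \<and>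
         X_norm P m \<le> 2 * infsup_const * L2_norm (qT P) (\<lambda>z. yobs z / \<rho>0 z)"
      if y: "yobs \<in> L2 (qT P)" and s: "is_solution P yobs u m" for yobs u m
    proof -
      have "0 \<le> infsup_const * L2_norm (qT P) (\<lambda>z. yobs z / \<rho>0 z)"
        by (intro mult_nonneg_nonneg infsup_const_nonneg L2_norm_nonneg)
      then have "X_norm P m \<le> 2 * infsup_const * L2_norm (qT P) (\<lambda>z. yobs z / \<rho>0 z)"
        using solution_bounds(2)[OF y s] unfolding w0 by linarith
      moreover have "U_norm P u \<le> L2_norm (qT P) (\<lambda>z. yobs z / \<rho>0 z)"
        using solution_bounds(1)[OF y s] unfolding w0 .
      moreover have "is_saddle_point P yobs u m" using s unfolding saddle_point_iff_solution[OF y] .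
      moreover have "u' = u \<and> X_eq P m' m" if "is_saddle_point P yobs u' m'" for u' m'
        using that solution_unique[OF y s] unfolding saddle_point_iff_solution[OF y] by blast
      ultimately show ?thesis by blast
    qed
    note bounds = this
    show ?thesis
    proof (rule conjI[OF well_posed], intro ballI allI impI)
      fix yobs u m assume "yobs \<in> L2 (qT P)" "is_solution P yobs u m"
      from bounds[OF this] show "is_saddle_point P yobs u m \<and>
         (\<forall>u' m'. is_saddle_point P yobs u' m' \<longrightarrow> u' = u \<and> X_eq P m' m) \<and>
         U_norm P u \<le> L2_norm (qT P) (\<lambda>z. yobs z / \<rho>0 z) \<and>
         X_norm P m \<le>
           2 * sqrt (max (C / \<rho>s\<^sup>2 * (Linf_norm (QT P) \<rho>1)\<^sup>2 + \<eta>1)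
                         (C / \<rho>s\<^sup>2 * (Linf_norm (QT P) \<rho>)\<^sup>2 + \<eta>2))
             * L2_norm (qT P) (\<lambda>z. yobs z / \<rho>0 z)" unfolding const .
    qed
  qed
  show ?thesis
    by (rule exI[of _ C], rule conjI[OF \<open>C > 0\<close>], intro allI impI) (rule main)
qed

end
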